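(* Let $(\mathcal{A},\Gamma,\mathcal{G},\prec)$ be a linear single-matrix graph-directed iterated function system on $\mathbb{R}^d$ with expanding matrix $A$, with invariant sets $\{E_j\}_{j\in\mathcal{A}}$. Suppose that it satisfies the open set condition and that the associated matrix $M$ of the directed graph $(\mathcal{A},\Gamma)$ is primitive. For $j\in\mathcal{A}$ put $\alpha=\dim_\omega E_j$. Then for every $j\in\mathcal{A}$ there exists a parametrization $\psi_j:[0,1]\to E_j$ of $E_j$ such that (i) $\psi_j$ is a measure isomorphism between $([0,1],\mathcal{B}([0,1]),\mathcal{L})$ and $(E_j,\mathcal{B}(E_j),\mathcal{H}_\omega^{\alpha})$; (ii) there is a constant $c>0$ such that $$\|\psi_j(x)-\psi_j(y)\|_\omega\le c\,|x-y|^{1/\alpha}\quad\text{for all }x,y\in[0,1].$$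
   Context: **Single-matrix GIFS.** Let $(\mathcal{A},\Gamma)$ be a directed graph with finite vertex set $\mathcal{A}=\{1,\dots,N\}$ and finite edge set $\Gamma$. Let $\Gamma_{ij}$ be the set of edges from $i$ to $j$; for $e\in\Gamma_{ij}$ write $t(e)=j$. A single-matrix graph-directed iterated function system (GIFS) with expanding matrix $A$ is a triple $(\mathcal{A},\Gamma,\mathcal{G})$ with $\mathcal{G}=\{g_e:\mathbb{R}^d\to\mathbb{R}^d;\ e\in\Gamma\}$ and $g_e(x)=A^{-1}(x+d_e)$, where $d_e\in\mathbb{R}^d$ and $A$ is one fixed real $d\times d$ matrix that is expanding (all its eigenvalues have modulus $>1$). Its invariant sets are the unique nonempty compact sets $E_1,\dots,E_N\subset\mathbb{R}^d$ with $E_i=\bigcup_{j=1}^N\bigcup_{e\in\Gamma_{ij}}g_e(E_j)$ for $1\le i\le N$. **Open set condition.** There exist nonempty open sets $U_1,\dots,U_N\subset\mathbb{R}^d$ such that for each $i$, $\bigcup_{j=1}^N\bigcup_{e\in\Gamma_{ij}}g_e(U_j)\subset U_i$ and the sets $g_e(U_j)$ in this union are pairwise disjoint. **Associated matrix.** $M=(m_{ij})_{1\le i,j\le N}$ with $m_{ij}=\sharp\Gamma_{ji}$ (the number of edges from $j$ to $i$). It is primitive if $M^n$ has all entries positive for some $n\ge1$. **Walks.** $\Gamma_i^k$ is the set of walks $\boldsymbol\gamma=\gamma_1+\dots+\gamma_k$ of length $k$ in the graph (the terminal vertex of each edge is the initial vertex of the next) starting at vertex $i$. Put $\Gamma_i=\Gamma_i^1$,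 $g_{\boldsymbol\gamma}=g_{\gamma_1}\circ\dots\circ g_{\gamma_k}$ and $E_{\boldsymbol\gamma}=g_{\boldsymbol\gamma}(E_{t(\gamma_k)})$. **Linear GIFS.** An ordered GIFS $(\mathcal{A},\Gamma,\mathcal{G},\prec)$ is a GIFS with a partial order $\prec$ on $\Gamma$ that is a linear order on each $\Gamma_i$, and such that elements of $\Gamma_i$ and $\Gamma_j$ are not comparable if $i\ne j$. It induces the lexicographical (linear) order on each $\Gamma_i^k$. Two distinct walks in $\Gamma_i^k$ are adjacent if no walk of $\Gamma_i^k$ lies strictly between them. The ordered GIFS is linear if for all $i\in\mathcal{A}$ and $k\ge1$, $E_{\boldsymbol\gamma}\cap E_{\boldsymbol\omega}\neq\emptyset$ for all adjacent $\boldsymbol\gamma,\boldsymbol\omega\in\Gamma_i^k$. **Pseudo-norm.** Let $q=|\det A|$, let $B(x,r)$ be the open ball with center $x$ and radius $r$, and let $V=A(B(0,1))\setminus B(0,1)$. Fix $\delta\in(0,\tfrac12)$ and a positive $C^\infty$ function $\phi_\delta$ with support in $B(0,\delta)$, $\phi_\delta(x)=\phi_\delta(-x)$ and $\int\phi_\delta=1$. Set $h(x)=\int_{\mathbb{R}^d}\chi_V(x-y)\phi_\delta(y)\,dy$ and $$\|x\|_\omega=\sum_{n\in\mathbb{Z}}q^{-n/d}h(A^nx),\qquad x\in\mathbb{R}^d.$$ **Hausdorff measure and dimension for the pseudo-norm.** For $E\subset\mathbb{R}^d$ let $\mathrm{diam}_\omega E=\sup\{\|x-y\|_\omega: x,y\in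 E\}$. For $s\ge0$, $\delta>0$, let $$\mathcal{H}^s_{\omega,\delta}(E)=\inf\Big\{\sum_{i=1}^\infty(\mathrm{diam}_\omega E_i)^s:\ E\subset\bigcup_iE_i,\ \mathrm{diam}_\omega E_i\le\delta\Big\},\qquad \mathcal{H}^s_\omega(E)=\lim_{\delta\to0}\mathcal{H}^s_{\omega,\delta}(E),$$ and $\dim_\omega E=\inf\{s:\mathcal{H}^s_\omega(E)=0\}=\sup\{s:\mathcal{H}^s_\omega(E)=\infty\}$. **Parametrization, measure isomorphism.** A parametrization of a compact set $E$ is a continuous onto map $\psi:[0,1]\to E$. $\mathcal{L}$ is Lebesgue measure and $\mathcal{B}(X)$ the Borel $\sigma$-algebra of $X$. The map $\psi$ is a measure isomorphism between $([0,1],\mathcal{B}([0,1]),\mathcal{L})$ and $(E,\mathcal{B}(E),\mathcal{H}^\alpha_\omega)$ if there exist $E'\subset E$ and $I'\subset[0,1]$ of full measure such that $\psi:I'\to E'$ is a bijection, and, with $c=\mathcal{H}^\alpha_\omega(E)$, $\mathcal{H}^\alpha_\omega(\psi(F))=c\,\mathcal{L}(F)$ and $\mathcal{L}(\psi^{-1}(B))=c^{-1}\mathcal{H}^\alpha_\omega(B)$ for all Borel sets $F\subset[0,1]$ and $B\subset E$.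
   Formalization: The directed graph is assumed to have at least two edges; with a single loop at a single vertex the invariant set is one point, α = 0, 1/α is undefined and (i) fails. *)

theory Defs
  imports "HOL-Analysis.Analysis" "Graph_Theory.Arc_Walk"
begin

section \<open>Matrices\<close>

definition expanding :: "real^'n^'n \<Rightarrow> bool" where
  "expanding A \<longleftrightarrow>
     (\<forall>(l::complex) (v::complex^'n).
        v \<noteq> 0 \<and> map_matrix complex_of_real A *v v = l *s v \<longrightarrow> 1 < cmod l)"

definition matrix_pow :: "'a::semiring_1^'n^'n \<Rightarrow> nat \<Rightarrow> 'a^'n^'n" where
  "matrix_pow A k = (((**) A) ^^ k) (mat 1)"

definition matrix_powi :: "real^'n^'n \<Rightarrow> int \<Rightarrow> real^'n^'n" where
  "matrix_powi A k =
     (if 0 \<le> k then matrix_pow A (nat k) else matrix_pow (matrix_inv A) (nat (- k)))"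

definition primitive_matrix :: "nat^'v^'v \<Rightarrow> bool" where
  "primitive_matrix M \<longleftrightarrow> (\<exists>n\<ge>1. \<forall>i j. 0 < matrix_pow M n $ i $ j)"


section \<open>Graph-directed iterated function systems\<close>

definition arcs_from_to :: "('v, 'e) pre_digraph \<Rightarrow> 'v \<Rightarrow> 'v \<Rightarrow> 'e set" where
  "arcs_from_to G i j = {e \<in> arcs G. tail G e = i \<and> head G e = j}"

text \<open>The indices are swapped: the entry at \<open>(i, j)\<close> counts the edges from \<open>j\<close> to \<open>i\<close>.\<close>

definition associated_matrix :: "('v::finite, 'e) pre_digraph \<Rightarrow> nat^'v^'v" where
  "associated_matrix G = (\<chi> i j. card (arcs_from_to G j i))"

definition gifs_map :: "real^'n^'n \<Rightarrow> ('e \<Rightarrow> real^'n) \<Rightarrow> 'e \<Rightarrow> real^'n \<Rightarrow> real^'n" where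
  "gifs_map A d e x = matrix_inv A *v (x + d e)"

definition invariant_sets ::
  "('v, 'e) pre_digraph \<Rightarrow> ('e \<Rightarrow> real^'n \<Rightarrow> real^'n) \<Rightarrow> ('v \<Rightarrow> (real^'n) set) \<Rightarrow> bool" where
  "invariant_sets G g E \<longleftrightarrow>
     (\<forall>i\<in>verts G. compact (E i) \<and> E i \<noteq> {} \<and>
        E i = (\<Union>j\<in>verts G. \<Union>e\<in>arcs_from_to G i j. g e ` E j))"

definition open_set_condition ::
  "('v, 'e) pre_digraph \<Rightarrow> ('e \<Rightarrow> real^'n \<Rightarrow> real^'n) \<Rightarrow> bool" where
  "open_set_condition G g \<longleftrightarrow>
     (\<exists>U. \<forall>i\<in>verts G. open (U i) \<and> U i \<noteq> {} \<and>
        (\<Union>j\<in>verts G. \<Union>e\<in>arcs_from_to G i j. g e ` U j) \<subseteq> U i \<and>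
        disjoint_family_on (\<lambda>e. g e ` U (head G e)) (out_arcs G i))"

definition walks :: "('v, 'e) pre_digraph \<Rightarrow> 'v \<Rightarrow> nat \<Rightarrow> 'e list set" where
  "walks G i k = {\<gamma>. length \<gamma> = k \<and> (\<exists>j. pre_digraph.awalk G i \<gamma> j)}"

text \<open>\<open>foldr g [e\<^sub>1, \<dots>, e\<^sub>k] = g e\<^sub>1 \<circ> \<dots> \<circ> g e\<^sub>k\<close>; only used for nonempty walks.\<close>

definition walk_piece ::
  "('v, 'e) pre_digraph \<Rightarrow> ('e \<Rightarrow> real^'n \<Rightarrow> real^'n) \<Rightarrow> ('v \<Rightarrow> (real^'n) set)
     \<Rightarrow> 'e list \<Rightarrow> (real^'n) set" where
  "walk_piece G g E \<gamma> = foldr g \<gamma> ` E (head G (last \<gamma>))"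

text \<open>The order \<open>prec\<close> is the strict one; \<open>lex prec\<close> is the dictionary order
  (first differing edge decides) on lists of equal length.\<close>

definition edge_order :: "('v, 'e) pre_digraph \<Rightarrow> ('e \<times> 'e) set \<Rightarrow> bool" where
  "edge_order G prec \<longleftrightarrow>
     prec \<subseteq> arcs G \<times> arcs G \<and> trans prec \<and> irrefl prec \<and>
     (\<forall>i\<in>verts G. total_on (out_arcs G i) prec) \<and>
     (\<forall>(e, f)\<in>prec. tail G e = tail G f)"

definition adjacent_walks ::
  "('v, 'e) pre_digraph \<Rightarrow> ('e \<times> 'e) set \<Rightarrow> 'v \<Rightarrow> nat \<Rightarrow> 'e list \<Rightarrow> 'e list \<Rightarrow> bool" where
  "adjacent_walks G prec i k \<gamma> \<omega> \<longleftrightarrow>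
     \<gamma> \<in> walks G i k \<and> \<omega> \<in> walks G i k \<and> \<gamma> \<noteq> \<omega> \<and>
     \<not> (\<exists>\<eta>\<in>walks G i k. ((\<gamma>, \<eta>) \<in> lex prec \<and> (\<eta>, \<omega>) \<in> lex prec) \<or>
                         ((\<omega>, \<eta>) \<in> lex prec \<and> (\<eta>, \<gamma>) \<in> lex prec))"

definition linear_gifs ::
  "('v, 'e) pre_digraph \<Rightarrow> ('e \<Rightarrow> real^'n \<Rightarrow> real^'n) \<Rightarrow> ('e \<times> 'e) set
     \<Rightarrow> ('v \<Rightarrow> (real^'n) set) \<Rightarrow> bool" where
  "linear_gifs G g prec E \<longleftrightarrow>
     edge_order G prec \<and>
     (\<forall>i\<in>verts G. \<forall>k\<ge>1. \<forall>\<gamma> \<omega>. adjacent_walks G prec i k \<gamma> \<omega> \<longrightarrow>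
        walk_piece G g E \<gamma> \<inter> walk_piece G g E \<omega> \<noteq> {})"


section \<open>The pseudo-norm\<close>

fun times_differentiable :: "nat \<Rightarrow> ('a::real_normed_vector \<Rightarrow> 'b::real_normed_vector) \<Rightarrow> bool" where
  "times_differentiable 0 f \<longleftrightarrow> continuous_on UNIV f"
| "times_differentiable (Suc k) f \<longleftrightarrow>
     f differentiable_on UNIV \<and>
     (\<forall>v. times_differentiable k (\<lambda>x. frechet_derivative f (at x) v))"

definition C_infinity :: "('a::real_normed_vector \<Rightarrow> 'b::real_normed_vector) \<Rightarrow> bool" where
  "C_infinity f \<longleftrightarrow> (\<forall>k. times_differentiable k f)"

text \<open>A function vanishing off a ball is not positive everywhere.  Positivity is required
  here as nonnegativity together with positivity at the centre, which follows from positivity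
  on the whole of \<open>ball 0 \<delta>\<close> and also allows functions whose closed support lies
  in the open ball.  With nonnegativity alone, \<open>\<phi>\<close> could be concentrated near two
  opposite points, and the pseudo-norm could then vanish at nonzero vectors.\<close>

definition mollifier :: "real \<Rightarrow> (real^'n \<Rightarrow> real) \<Rightarrow> bool" where
  "mollifier \<delta> \<phi> \<longleftrightarrow>
     C_infinity \<phi> \<and> (\<forall>x. 0 \<le> \<phi> x) \<and> 0 < \<phi> 0 \<and> {x. \<phi> x \<noteq> 0} \<subseteq> ball 0 \<delta> \<and>
     (\<forall>x. \<phi> x = \<phi> (- x)) \<and> (\<integral>x. \<phi> x \<partial>lborel) = 1"

definition smoothed_shell :: "real^'n^'n \<Rightarrow> (real^'n \<Rightarrow> real) \<Rightarrow> real^'n \<Rightarrow> real" where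
  "smoothed_shell A \<phi> x =
     (let V = ((*v) A) ` ball 0 1 - ball 0 1
      in \<integral>y. indicator V (x - y) * \<phi> y \<partial>lborel)"

definition pseudo_norm :: "real^'n^'n \<Rightarrow> (real^'n \<Rightarrow> real) \<Rightarrow> real^'n \<Rightarrow> real" where
  "pseudo_norm A \<phi> x =
     (\<Sum>\<^sub>\<infinity>n::int. \<bar>det A\<bar> powr (- real_of_int n / real CARD('n)) *
                smoothed_shell A \<phi> (matrix_powi A n *v x))"


section \<open>Hausdorff measure and dimension for a gauge\<close>

text \<open>Below, \<open>w\<close> stands for the pseudo-norm.\<close>

definition wdiam :: "('a::real_vector \<Rightarrow> real) \<Rightarrow> 'a set \<Rightarrow> ennreal" where
  "wdiam w X = (SUP (x, y)\<in>X \<times> X. ennreal (w (x - y)))"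

text \<open>The power \<open>(diam X)\<^sup>s\<close> for sets of finite diameter.  As \<open>0 powr 0 = 0\<close>
  in HOL, the case \<open>s = 0\<close> is spelled out: a nonempty set contributes \<open>1\<close>, and the
  empty set, used to pad finite covers, contributes \<open>0\<close>.\<close>

definition wdiam_power :: "('a::real_vector \<Rightarrow> real) \<Rightarrow> real \<Rightarrow> 'a set \<Rightarrow> ennreal" where
  "wdiam_power w s X =
     (if X = {} then 0 else if s = 0 then 1 else ennreal (enn2real (wdiam w X) powr s))"

definition hausdorff_pre ::
  "('a::real_vector \<Rightarrow> real) \<Rightarrow> real \<Rightarrow> real \<Rightarrow> 'a set \<Rightarrow> ennreal" where
  "hausdorff_pre w s \<delta> E =
     (INF X \<in> {X :: nat \<Rightarrow> 'a set. E \<subseteq> (\<Union>i. X i) \<and> (\<forall>i. wdiam w (X i) \<le> ennreal \<delta>)}.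
        \<Sum>i. wdiam_power w s (X i))"

definition hausdorff_outer :: "('a::real_vector \<Rightarrow> real) \<Rightarrow> real \<Rightarrow> 'a set \<Rightarrow> ennreal" where
  "hausdorff_outer w s E = Lim (at_right 0) (\<lambda>\<delta>. hausdorff_pre w s \<delta> E)"

definition hausdorff_dim :: "('a::real_vector \<Rightarrow> real) \<Rightarrow> 'a set \<Rightarrow> real" where
  "hausdorff_dim w E = Inf {s. 0 \<le> s \<and> hausdorff_outer w s E = 0}"


section \<open>Parametrizations and measure isomorphisms\<close>

definition parametrization :: "(real \<Rightarrow> 'a::topological_space) \<Rightarrow> 'a set \<Rightarrow> bool" where
  "parametrization \<psi> E \<longleftrightarrow> continuous_on {0..1} \<psi> \<and> \<psi> ` {0..1} = E"

text \<open>\<open>H\<close> is an outer measure on all sets, so \<open>H (\<psi> ` F)\<close> makes sense although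
  \<open>\<psi> ` F\<close> need not be Borel.  The last clause with \<open>B = E\<close> forces
  \<open>0 < H E < \<infinity>\<close>.\<close>

definition measure_isomorphism ::
  "(real \<Rightarrow> 'a::topological_space) \<Rightarrow> 'a set \<Rightarrow> ('a set \<Rightarrow> ennreal) \<Rightarrow> bool" where
  "measure_isomorphism \<psi> E H \<longleftrightarrow>
     (\<exists>I' E'. I' \<in> sets borel \<and> I' \<subseteq> {0..1} \<and> emeasure lborel ({0..1} - I') = 0 \<and>
              E' \<in> sets borel \<and> E' \<subseteq> E \<and> H (E - E') = 0 \<and>
              bij_betw \<psi> I' E') \<and>
     (\<forall>F\<in>sets borel. F \<subseteq> {0..1} \<longrightarrow> H (\<psi> ` F) = H E * emeasure lborel F) \<and>
     (\<forall>B\<in>sets borel. B \<subseteq> E \<longrightarrow>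
        emeasure lborel (\<psi> -` B \<inter> {0..1}) = inverse (H E) * H B)"

end

theory Submission
  imports Defs "HOL-Computational_Algebra.Fundamental_Theorem_Algebra"
begin

text \<open>
  Write \<open>w\<close> for the pseudo-norm and \<open>\<rho> = |det A| powr (1 / CARD('n))\<close>. Only three properties of \<open>w\<close> matter: it is
  homogeneous, \<open>w (A x) = \<rho> * w x\<close>, it is bounded on bounded sets, and \<open>{x. w x \<le> 1}\<close> is bounded. They rest on
  the fact that the powers of \<open>A\<inverse>\<close> tend to 0, as \<open>A\<close> is expanding. Let \<open>l > 1\<close> be the Perron eigenvalue of the
  associated matrix and \<open>v\<close> a positive vector such that the sum of \<open>v\<close> over the heads of the arcs leaving \<open>i\<close>
  is \<open>l * v i\<close>. Let \<open>\<alpha>\<close> solve \<open>\<rho> powr \<alpha> = l\<close>. Then the \<open>\<alpha>\<close>-dimensional Hausdorff measure \<open>H\<close> for \<open>w\<close> is scaled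
  by \<open>1 / l\<close> under each map of the system.

  For the parametrization of \<open>E i\<close>, divide \<open>{0..1}\<close> into consecutive intervals with lengths proportional to
  the weights of the heads of the arcs leaving \<open>i\<close>, in the given order, and iterate. A walk of length \<open>k\<close>
  from \<open>i\<close> to \<open>j\<close> receives an interval of length \<open>v j / (l ^ k * v i)\<close>, and the parametrization maps this interval
  onto the piece of \<open>E i\<close> given by the walk. The linear structure enters through \<open>pieces_close\<close>: parameters
  that are closer than the shortest interval at level \<open>k\<close> lie in intervals of equal or adjacent walks, and
  pieces of adjacent walks meet, so the values differ by \<open>A\<inverse>\<close>, applied \<open>k\<close> times, to a bounded vector. Hence
  the parametrization is well defined and continuous, and since \<open>(1 / \<rho>) ^ k = (1 / l ^ k) powr (1 / \<alpha>)\<close> it is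
  Hoelder continuous with exponent \<open>1 / \<alpha>\<close> for \<open>w\<close> (\<open>psi_hoelder\<close>).

  Covers by pieces show that \<open>H (E i)\<close> is finite. By the open set condition, a set of \<open>w\<close>-diameter
  \<open>(1 / \<rho>) ^ k\<close> meets a bounded number of pieces of level \<open>k\<close> (\<open>bounded_overlap\<close>), so by the mass distribution
  principle \<open>H (E i)\<close> is positive, and \<open>\<alpha>\<close> is the dimension. The numbers \<open>H (E i)\<close> form a subeigenvector for \<open>l\<close>
  and are therefore proportional to \<open>v\<close> (\<open>h_proportional\<close>). It follows that the measure of a piece is at most
  \<open>H (E i)\<close> times the length of its interval, and by covering that \<open>H (\<psi> F) \<le> H (E i) * L(F)\<close> for Borel sets \<open>F\<close>,
  where \<open>L\<close> is Lebesgue measure. Applied to \<open>F\<close> and to its complement, this becomes an equality by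
  subadditivity (\<open>H_psi\<close>). The equality and the additivity of \<open>L\<close> make the intersections of distinct pieces
  null sets, and off these intersections the parametrization is injective.
\<close>

section \<open>Powers of an expanding matrix\<close>

text \<open>Once \<open>b\<close> stays below \<open>(1 - r) * \<eta>\<close>, the excess of \<open>a\<close> over \<open>\<eta>\<close> decays geometrically.\<close>

lemma perturbed_contraction_tendsto_0:
  fixes a b :: "nat \<Rightarrow> real"
  assumes nonneg: "\<And>n. 0 \<le> a n"
    and step: "\<And>n. a (Suc n) \<le> r * a n + b n"
    and r: "0 \<le> r" "r < 1" and b: "b \<longlonglongrightarrow> 0"
  shows "a \<longlonglongrightarrow> 0"
proof (rule LIMSEQ_I)
  fix \<epsilon> :: real assume "0 < \<epsilon>"
  define \<eta> where "\<eta> = \<epsilon> / 2"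
  have \<eta>: "0 < \<eta>" using \<open>0 < \<epsilon>\<close> by (simp add: \<eta>_def)
  have "0 < (1 - r) * \<eta>" using \<eta> r by simp
  then obtain N where N: "\<And>n. N \<le> n \<Longrightarrow> \<bar>b n\<bar> < (1 - r) * \<eta>"
    using LIMSEQ_D[OF b] by (metis diff_zero real_norm_def)
  have decay: "a (N + k) - \<eta> \<le> r ^ k * a N" for k
  proof (induction k)
    case 0
    then show ?case using \<eta> by simp
  next
    case (Suc k)
    have "a (N + Suc k) \<le> r * a (N + k) + (1 - r) * \<eta>"
      using step[of "N + k"] N[of "N + k"] by simp
    then have "a (N + Suc k) - \<eta> \<le> r * (a (N + k) - \<eta>)" by (simp add: algebra_simps)
    also have "\<dots> \<le> r * (r ^ k * a N)" using Suc r by (intro mult_left_mono) auto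
    finally show ?case by simp
  qed
  have "(\<lambda>k. r ^ k * a N) \<longlonglongrightarrow> 0"
    using r by (intro tendsto_mult_left_zero LIMSEQ_realpow_zero) auto
  then obtain K where K: "\<And>k. K \<le> k \<Longrightarrow> \<bar>r ^ k * a N\<bar> < \<eta>"
    using LIMSEQ_D[OF _ \<eta>] by (metis diff_zero real_norm_def)
  show "\<exists>n0. \<forall>n\<ge>n0. norm (a n - 0) < \<epsilon>"
  proof (intro exI allI impI)
    fix n assume "N + K \<le> n"
    then obtain k where k: "n = N + k" "K \<le> k"
      by (metis add_le_cancel_left le_add1 le_trans nat_le_iff_add)
    have "a n < \<epsilon>" using decay[of k] K[OF k(2)] k(1) by (simp add: \<eta>_def)
    then show "norm (a n - 0) < \<epsilon>" using nonneg[of n] by simp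
  qed
qed

lemma norm_vector_scalar_mult: "norm (l *s v) = cmod l * norm v" for v :: "complex^'n"
  by (simp add: norm_vec_def norm_mult L2_set_right_distrib)

definition poly_apply :: "complex^'n^'n \<Rightarrow> complex poly \<Rightarrow> complex^'n \<Rightarrow> complex^'n" where
  "poly_apply B p v = (\<Sum>i\<le>degree p. coeff p i *s (((*v) B ^^ i) v))"

lemma poly_apply_eq_sum:
  assumes "degree p \<le> n"
  shows "poly_apply B p v = (\<Sum>i\<le>n. coeff p i *s (((*v) B ^^ i) v))"
  unfolding poly_apply_def
  by (rule sum.mono_neutral_left) (use assms in \<open>auto simp: coeff_eq_0\<close>)

lemma poly_apply_add: "poly_apply B (p + q) v = poly_apply B p v + poly_apply B q v"
proof -
  define n where "n = max (degree p) (degree q)"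
  have "degree (p + q) \<le> n" "degree p \<le> n" "degree q \<le> n"
    by (auto simp: n_def degree_add_le_max)
  then show ?thesis
    by (simp add: poly_apply_eq_sum sum.distrib vec.scale_left_distrib)
qed

lemma poly_apply_smult: "poly_apply B (smult c p) v = c *s poly_apply B p v"
  by (simp add: poly_apply_eq_sum[of _ "degree p"] degree_smult_le vec.scale_sum_right)

lemma matrix_vector_mult_sum: "B *v (\<Sum>i\<in>I. f i) = (\<Sum>i\<in>I. B *v f i)"
  for B :: "'a::field^'n^'m"
  by (induction I rule: infinite_finite_induct) (auto simp: vec.add)

lemma matrix_vector_mult_smult: "B *v (c *s v) = c *s (B *v v)"
  for B :: "'a::field^'n^'m"
  by (simp add: vec.scale)

lemma poly_apply_pCons_0: "poly_apply B (pCons 0 p) v = B *v poly_apply B p v"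
  by (simp add: poly_apply_eq_sum[of "pCons 0 p" "Suc (degree p)"] degree_pCons_le
      sum.atMost_Suc_shift matrix_vector_mult_sum matrix_vector_mult_smult
      poly_apply_eq_sum[of p "degree p"] del: sum.atMost_Suc)

lemma poly_apply_commute: "poly_apply B p (B *v v) = B *v poly_apply B p v"
  by (simp add: poly_apply_def matrix_vector_mult_sum matrix_vector_mult_smult
      flip: funpow_swap1)

lemma poly_apply_diff_smult:
  "poly_apply B p (u - l *s v) = poly_apply B p u - l *s poly_apply B p v"
proof -
  have pow: "((*v) B ^^ i) (u - l *s v) = ((*v) B ^^ i) u - l *s ((*v) B ^^ i) v" for i
    by (induction i) (simp_all add: matrix_vector_mult_diff_distrib matrix_vector_mult_smult)
  show ?thesis
    unfolding poly_apply_def pow vec.scale_right_diff_distrib sum_subtractf vec.scale_sum_right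
    by (subst vec.scale_left_commute) (rule refl)
qed

lemma poly_apply_linear_factor:
  "poly_apply B ([:- l, 1:] * p) v = B *v poly_apply B p v - l *s poly_apply B p v"
proof -
  have "[:- l, 1:] * p = pCons 0 p + smult (- l) p" by simp
  then show ?thesis
    by (simp only: poly_apply_add poly_apply_smult poly_apply_pCons_0) simp
qed

text \<open>Split off a root \<open>l\<close> of \<open>p\<close>, with quotient \<open>q\<close>. If \<open>q\<close> does not annihilate \<open>v\<close>, then \<open>l\<close> is an
  eigenvalue, so \<open>|l| < 1\<close>, and \<open>u = B v - l v\<close> is annihilated by \<open>q\<close>. The iterates of \<open>v\<close> then satisfy
  \<open>B\<^sup>n\<^sup>+\<^sup>1 v = l B\<^sup>n v + B\<^sup>n u\<close>, a contraction with a perturbation that vanishes by induction.\<close>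

lemma powers_vanish_if_annihilated:
  fixes B :: "complex^'n^'n"
  assumes eig: "\<And>l v. v \<noteq> 0 \<Longrightarrow> B *v v = l *s v \<Longrightarrow> cmod l < 1"
  shows "p \<noteq> 0 \<Longrightarrow> poly_apply B p v = 0 \<Longrightarrow> (\<lambda>n. ((*v) B ^^ n) v) \<longlonglongrightarrow> 0"
proof (induction "degree p" arbitrary: p v)
  case 0
  then obtain c where "p = [:c:]" using degree_eq_zeroE by metis
  then have "v = 0" using 0 by (simp add: poly_apply_def)
  moreover have "((*v) B ^^ n) 0 = 0" for n by (induction n) auto
  ultimately show ?case by simp
next
  case (Suc m)
  have "\<not> constant (poly p)" using Suc.hyps(2) by (simp add: constant_degree)
  then obtain l where "poly p l = 0" using fundamental_theorem_of_algebra by blast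
  then obtain q where q: "p = [:- l, 1:] * q" by (auto simp: poly_eq_0_iff_dvd elim: dvdE)
  have q0: "q \<noteq> 0" using q Suc.prems(1) by auto
  have deg: "m = degree q" using Suc.hyps(2) q q0 by (simp add: degree_mult_eq del: mult_pCons_left)
  show ?case
  proof (cases "poly_apply B q v = 0")
    case True
    then show ?thesis using Suc.hyps(1)[OF deg q0] by simp
  next
    case False
    have eigv: "B *v poly_apply B q v = l *s poly_apply B q v"
      using Suc.prems(2) unfolding q poly_apply_linear_factor by simp
    then have l: "cmod l < 1" using eig[OF False] by simp
    define u where "u = B *v v - l *s v"
    have "poly_apply B q u = 0"
      unfolding u_def poly_apply_diff_smult poly_apply_commute using eigv by simp
    then have u: "(\<lambda>n. ((*v) B ^^ n) u) \<longlonglongrightarrow> 0" using Suc.hyps(1)[OF deg q0] by simp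
    have step: "((*v) B ^^ Suc n) v = l *s ((*v) B ^^ n) v + ((*v) B ^^ n) u" for n
      by (induction n)
        (simp_all add: u_def matrix_vector_mult_diff_distrib matrix_vector_mult_smult vec.add)
    have "(\<lambda>n. norm (((*v) B ^^ n) v)) \<longlonglongrightarrow> 0"
    proof (rule perturbed_contraction_tendsto_0)
      show "norm (((*v) B ^^ Suc n) v) \<le> cmod l * norm (((*v) B ^^ n) v) + norm (((*v) B ^^ n) u)" for n
        unfolding step by (metis norm_triangle_ineq norm_vector_scalar_mult)
    qed (use l u tendsto_norm_zero in auto)
    then show ?thesis by (rule tendsto_norm_zero_cancel)
  qed
qed

lemma scaleR_eq_vector_scalar_mult: "r *\<^sub>R v = complex_of_real r *s v" for v :: "complex^'n"
proof -
  have "(r *\<^sub>R v) $ i = (complex_of_real r *s v) $ i" for i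
    unfolding vector_scaleR_component vector_smult_component by (rule scaleR_conv_of_real)
  then show ?thesis by (simp only: vec_eq_iff) simp
qed

text \<open>The first \<open>DIM + 1\<close> iterates of \<open>v\<close> are linearly dependent over the reals, unless two iterates
  coincide.\<close>

lemma annihilating_polynomial_exists:
  fixes B :: "complex^'n^'n"
  obtains p where "p \<noteq> 0" "poly_apply B p v = 0"
proof (cases "inj (\<lambda>i. ((*v) B ^^ i) v)")
  case False
  then obtain i j where ij: "i < j" "((*v) B ^^ i) v = ((*v) B ^^ j) v"
    unfolding inj_def by (metis nat_neq_iff)
  define p where "p = monom 1 j - monom (1::complex) i"
  have "poly_apply B p v = (\<Sum>k\<le>j. (if k = j then 1 else if k = i then - 1 else 0) *s ((*v) B ^^ k) v)"
    using ij(1) by (subst poly_apply_eq_sum[of _ j])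
      (auto simp: p_def degree_diff_le degree_monom_eq intro!: sum.cong)
  also have "\<dots> = (\<Sum>k\<le>j. (if k = j then ((*v) B ^^ j) v else 0) - (if k = i then ((*v) B ^^ i) v else 0))"
    using ij(1) by (intro sum.cong) auto
  also have "\<dots> = 0" using ij by (simp add: sum_subtractf)
  finally have "poly_apply B p v = 0" .
  moreover have "coeff p j \<noteq> 0" using ij(1) by (simp add: p_def)
  then have "p \<noteq> 0" by auto
  ultimately show ?thesis using that by blast
next
  case True
  define D where "D = DIM(complex^'n)"
  define S where "S = (\<lambda>i. ((*v) B ^^ i) v) ` {..D}"
  have inj: "inj_on (\<lambda>i. ((*v) B ^^ i) v) {..D}" using True by (rule inj_on_subset) auto
  have "card S = Suc D" unfolding S_def using card_image[OF inj] by simp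
  then have "dependent S" using independent_bound[of S] by (auto simp: D_def)
  moreover have "finite S" by (simp add: S_def)
  ultimately obtain c where c: "\<exists>x\<in>S. c x \<noteq> 0" "(\<Sum>x\<in>S. c x *\<^sub>R x) = 0"
    by (auto simp: real_vector.dependent_finite)
  define a where "a i = (if i \<le> D then complex_of_real (c (((*v) B ^^ i) v)) else 0)" for i
  define p where "p = Abs_poly a"
  have coeff: "coeff p = a"
    unfolding p_def by (rule Abs_poly_inverse)
      (auto simp: a_def MOST_nat intro!: exI[of _ D])
  have "degree p \<le> D" by (rule degree_le) (auto simp: coeff a_def)
  then have "poly_apply B p v = (\<Sum>i\<le>D. a i *s ((*v) B ^^ i) v)"
    by (simp add: poly_apply_eq_sum coeff)
  also have "\<dots> = (\<Sum>x\<in>S. c x *\<^sub>R x)"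
    unfolding S_def by (subst sum.reindex[OF inj]) (simp add: a_def scaleR_eq_vector_scalar_mult)
  finally have "poly_apply B p v = 0" using c by simp
  obtain i where "i \<le> D" "c (((*v) B ^^ i) v) \<noteq> 0" using c(1) unfolding S_def by auto
  then have "a i \<noteq> 0" by (simp add: a_def)
  then have "coeff p i \<noteq> 0" unfolding coeff .
  then have "p \<noteq> 0" by auto
  then show ?thesis using \<open>poly_apply B p v = 0\<close> by (rule that)
qed

lemma powers_vanish_if_eigenvalues_small:
  fixes B :: "complex^'n^'n"
  assumes "\<And>l v. v \<noteq> 0 \<Longrightarrow> B *v v = l *s v \<Longrightarrow> cmod l < 1"
  shows "(\<lambda>n. ((*v) B ^^ n) v) \<longlonglongrightarrow> 0"
proof -
  obtain p where p: "p \<noteq> 0" "poly_apply B p v = 0" by (rule annihilating_polynomial_exists)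
  show ?thesis by (rule powers_vanish_if_annihilated[OF assms p])
qed

definition complexify :: "real^'n \<Rightarrow> complex^'n" where
  "complexify x = (\<chi> i. complex_of_real (x $ i))"

lemma complexify_mult: "map_matrix complex_of_real A *v complexify x = complexify (A *v x)"
  by (simp add: vec_eq_iff complexify_def matrix_vector_mult_def)

lemma norm_complexify: "norm (complexify x) = norm x"
  by (simp add: norm_vec_def complexify_def)

lemma map_matrix_of_real_mult:
  "map_matrix complex_of_real A ** map_matrix complex_of_real B =
    map_matrix complex_of_real (A ** B)"
  by (simp add: vec_eq_iff matrix_matrix_mult_def)

lemma matrix_inv_mult:
  fixes A :: "real^'n^'n"
  assumes "invertible A"
  shows "A ** matrix_inv A = mat 1" "matrix_inv A ** A = mat 1"
proof -
  have "\<exists>A'. A ** A' = mat 1 \<and> A' ** A = mat 1" using assms by (simp add: invertible_def)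
  from someI_ex[OF this]
  show "A ** matrix_inv A = mat 1" "matrix_inv A ** A = mat 1" by (simp_all add: matrix_inv_def)
qed

lemma expanding_invertible:
  fixes A :: "real^'n^'n"
  assumes "expanding A"
  shows "invertible A"
proof -
  have "x = 0" if "A *v x = 0" for x
  proof (rule ccontr)
    assume "x \<noteq> 0"
    then have "complexify x \<noteq> 0" using norm_complexify[of x] by auto
    moreover have "map_matrix complex_of_real A *v complexify x = 0 *s complexify x"
      using that by (simp add: complexify_mult) (simp add: complexify_def vec_eq_iff)
    ultimately show False using assms unfolding expanding_def by fastforce
  qed
  then show ?thesis
    using invertible_left_inverse matrix_left_invertible_ker by blast
qed

text \<open>With \<open>B = A\<inverse>\<close>, an eigenvalue of \<open>B\<close> is the inverse of one of \<open>A\<close>, hence of modulus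
  below 1.\<close>

lemma expanding_inverse_powers_vanish:
  fixes A :: "real^'n^'n"
  assumes "expanding A"
  shows "(\<lambda>n. ((*v) (matrix_inv A) ^^ n) x) \<longlonglongrightarrow> 0"
proof -
  define B where "B = map_matrix complex_of_real (matrix_inv A)"
  have "map_matrix complex_of_real A ** B = map_matrix complex_of_real (mat 1)"
    unfolding B_def map_matrix_of_real_mult
    using matrix_inv_mult(1)[OF expanding_invertible[OF assms]] by simp
  then have AB: "map_matrix complex_of_real A ** B = mat 1"
    by (simp add: vec_eq_iff mat_def)
  have "cmod l < 1" if v: "v \<noteq> 0" "B *v v = l *s v" for l v
  proof -
    have *: "v = l *s (map_matrix complex_of_real A *v v)"
      using v(2) AB by (metis matrix_vector_mul_assoc matrix_vector_mul_lid matrix_vector_mult_smult)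
    then have l: "l \<noteq> 0" using v(1) by auto
    then have "map_matrix complex_of_real A *v v = (1 / l) *s v"
      using * by (metis divide_inverse mult_1 vec.scale_one vec.scale_scale left_inverse)
    then have "1 < cmod (1 / l)" using assms v(1) unfolding expanding_def by blast
    then show ?thesis using l by (simp add: norm_divide)
  qed
  then have lim: "(\<lambda>n. ((*v) B ^^ n) (complexify x)) \<longlonglongrightarrow> 0"
    by (rule powers_vanish_if_eigenvalues_small)
  have "((*v) B ^^ n) (complexify x) = complexify (((*v) (matrix_inv A) ^^ n) x)" for n
    by (induction n) (simp_all add: B_def complexify_mult)
  then have "(\<lambda>n. norm (((*v) (matrix_inv A) ^^ n) x)) \<longlonglongrightarrow> 0"
    using tendsto_norm_zero[OF lim] by (simp add: norm_complexify)
  then show ?thesis by (rule tendsto_norm_zero_cancel)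
qed

lemma bounded_linear_funpow_matrix: "bounded_linear ((*v) T ^^ n)" for T :: "real^'n^'n"
proof (induction n)
  case (Suc n)
  have "bounded_linear (\<lambda>x. T *v (((*v) T ^^ n) x))"
    using bounded_linear_compose[OF matrix_vector_mul_bounded_linear Suc] .
  then show ?case by (simp only: funpow.simps o_def)
next
  case 0
  show ?case using bounded_linear_ident by (simp only: funpow.simps id_def)
qed

lemma expanding_inverse_powers_onorm:
  fixes A :: "real^'n^'n"
  assumes "expanding A"
  shows "(\<lambda>n. onorm ((*v) (matrix_inv A) ^^ n)) \<longlonglongrightarrow> 0"
proof (rule tendsto_sandwich[OF _ _ tendsto_const])
  show "(\<lambda>n. \<Sum>b\<in>Basis. norm (((*v) (matrix_inv A) ^^ n) b)) \<longlonglongrightarrow> 0"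
    using expanding_inverse_powers_vanish[OF assms] by (intro tendsto_null_sum tendsto_norm_zero)
  show "\<forall>\<^sub>F n in sequentially. onorm ((*v) (matrix_inv A) ^^ n)
      \<le> (\<Sum>b\<in>Basis. norm (((*v) (matrix_inv A) ^^ n) b))"
    by (intro always_eventually allI onorm_componentwise bounded_linear_funpow_matrix)
  show "\<forall>\<^sub>F n in sequentially. 0 \<le> onorm ((*v) (matrix_inv A) ^^ n)"
    by (intro always_eventually allI onorm_pos_le bounded_linear_funpow_matrix)
qed

lemma matrix_pow_Suc: "matrix_pow T (Suc n) = T ** matrix_pow T n"
  by (simp add: matrix_pow_def)

lemma matrix_pow_mult_vec: "matrix_pow T n *v x = ((*v) T ^^ n) x" for T :: "real^'n^'n"
  by (induction n) (simp_all add: matrix_pow_def flip: matrix_vector_mul_assoc)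

lemma det_matrix_pow: "det (matrix_pow T n) = det T ^ n" for T :: "real^'n^'n"
proof (induction n)
  case 0
  show ?case by (simp add: matrix_pow_def)
next
  case (Suc n)
  then show ?case by (simp only: matrix_pow_Suc det_mul power_Suc)
qed

text \<open>The determinant is continuous, so the powers of \<open>det A\<inverse>\<close> tend to 0.\<close>

lemma expanding_abs_det_gt_1:
  fixes A :: "real^'n^'n"
  assumes "expanding A"
  shows "1 < \<bar>det A\<bar>"
proof -
  have entry: "(\<lambda>n. matrix_pow (matrix_inv A) n $ i $ j) \<longlonglongrightarrow> 0" for i j
  proof -
    have "matrix_pow (matrix_inv A) n $ i $ j = (((*v) (matrix_inv A) ^^ n) (axis j 1)) $ i" for n
      unfolding matrix_pow_mult_vec[symmetric] matrix_vector_mult_basis by (simp add: column_def)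
    moreover have "(\<lambda>n. (((*v) (matrix_inv A) ^^ n) (axis j 1)) $ i) \<longlonglongrightarrow> 0 $ i"
      by (intro tendsto_vec_nth expanding_inverse_powers_vanish assms)
    ultimately show ?thesis by simp
  qed
  have "(\<lambda>n. det (matrix_pow (matrix_inv A) n)) \<longlonglongrightarrow> 0"
    unfolding det_def
  proof (intro tendsto_null_sum tendsto_mult_right_zero)
    fix p :: "'n \<Rightarrow> 'n"
    have "(\<lambda>n. \<Prod>i\<in>UNIV. matrix_pow (matrix_inv A) n $ i $ p i) \<longlonglongrightarrow> (\<Prod>i\<in>(UNIV::'n set). 0)"
      by (intro tendsto_prod entry)
    then show "(\<lambda>n. \<Prod>i\<in>UNIV. matrix_pow (matrix_inv A) n $ i $ p i) \<longlonglongrightarrow> 0"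
      by (simp add: power_0_left)
  qed
  then have "(\<lambda>n. det (matrix_inv A) ^ n) \<longlonglongrightarrow> 0" by (simp add: det_matrix_pow)
  then obtain n where "\<bar>det (matrix_inv A) ^ n\<bar> < 1"
    using LIMSEQ_D[of _ 0 1] by fastforce
  then have less: "\<bar>det (matrix_inv A)\<bar> < 1"
    using one_le_power[of "\<bar>det (matrix_inv A)\<bar>" n] unfolding power_abs by linarith
  have "det A * det (matrix_inv A) = 1"
    unfolding det_mul[symmetric] matrix_inv_mult(1)[OF expanding_invertible[OF assms]] by (rule det_I)
  then have prod: "\<bar>det A\<bar> * \<bar>det (matrix_inv A)\<bar> = 1" by (metis abs_mult abs_one)
  show ?thesis
  proof (rule ccontr)
    assume "\<not> 1 < \<bar>det A\<bar>"
    then have "\<bar>det A\<bar> * \<bar>det (matrix_inv A)\<bar> \<le> 1 * \<bar>det (matrix_inv A)\<bar>"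
      by (intro mult_right_mono) auto
    then show False using less prod by simp
  qed
qed

section \<open>The pseudo-norm\<close>

lemma matrix_powi_shift:
  fixes A :: "real^'n^'n"
  assumes "invertible A"
  shows "matrix_powi A n *v (A *v x) = matrix_powi A (n + 1) *v x"
proof (cases "0 \<le> n")
  case True
  then have "nat (n + 1) = Suc (nat n)" by simp
  then show ?thesis using True
    by (simp add: matrix_powi_def matrix_pow_mult_vec del: funpow.simps)
      (simp add: funpow_swap1)
next
  case False
  then obtain m where m: "n = - int (Suc m)"
    by (metis int_cases le_numeral_extra(3) not_le of_nat_0_le_iff)
  have inv: "matrix_inv A *v (A *v x) = x"
    by (simp add: matrix_vector_mul_assoc matrix_inv_mult assms)
  have "matrix_powi A n *v (A *v x) = ((*v) (matrix_inv A) ^^ m) x"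
  proof -
    have "nat (- n) = Suc m" "\<not> 0 \<le> n" using m by auto
    then have "matrix_powi A n *v (A *v x) = ((*v) (matrix_inv A) ^^ Suc m) (A *v x)"
      by (simp add: matrix_powi_def matrix_pow_mult_vec del: funpow.simps)
    also have "\<dots> = ((*v) (matrix_inv A) ^^ m) x"
      by (simp only: funpow_Suc_right o_def inv)
    finally show ?thesis .
  qed
  moreover have "matrix_powi A (n + 1) *v x = ((*v) (matrix_inv A) ^^ m) x"
  proof (cases m)
    case 0
    then show ?thesis by (simp add: m matrix_powi_def matrix_pow_def)
  next
    case (Suc k)
    then have "nat (- (n + 1)) = m" "\<not> 0 \<le> n + 1" using m by auto
    then show ?thesis by (simp add: matrix_powi_def matrix_pow_mult_vec)
  qed
  ultimately show ?thesis by simp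
qed

definition pseudo_norm_term :: "real^'n^'n \<Rightarrow> (real^'n \<Rightarrow> real) \<Rightarrow> real^'n \<Rightarrow> int \<Rightarrow> real" where
  "pseudo_norm_term A \<phi> x n = \<bar>det A\<bar> powr (- real_of_int n / real CARD('n)) *
     smoothed_shell A \<phi> (matrix_powi A n *v x)"

lemma pseudo_norm_eq_infsum: "pseudo_norm A \<phi> x = (\<Sum>\<^sub>\<infinity>n. pseudo_norm_term A \<phi> x n)"
  by (simp add: pseudo_norm_def pseudo_norm_term_def)

text \<open>Multiplication by \<open>A\<close> shifts the index of summation by one.\<close>

lemma pseudo_norm_mult:
  fixes A :: "real^'n^'n"
  assumes "expanding A"
  shows "pseudo_norm A \<phi> (A *v x) = \<bar>det A\<bar> powr (1 / real CARD('n)) * pseudo_norm A \<phi> x"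
proof -
  define q where "q = \<bar>det A\<bar>"
  define D where "D = real CARD('n)"
  define f where "f n = q powr (- real_of_int n / D) * smoothed_shell A \<phi> (matrix_powi A n *v x)" for n
  have "pseudo_norm A \<phi> (A *v x) =
      (\<Sum>\<^sub>\<infinity>n. q powr (- real_of_int n / D) * smoothed_shell A \<phi> (matrix_powi A (n + 1) *v x))"
    unfolding pseudo_norm_def q_def D_def
    by (simp add: matrix_powi_shift expanding_invertible assms)
  also have "\<dots> = (\<Sum>\<^sub>\<infinity>n. q powr (1 / D) * f (n + 1))"
  proof (rule infsum_cong)
    fix n :: int
    have "- real_of_int n / D = 1 / D + - real_of_int (n + 1) / D" by (simp add: field_simps D_def)
    then have "q powr (- real_of_int n / D) = q powr (1 / D) * q powr (- real_of_int (n + 1) / D)"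
      by (metis powr_add)
    then show "q powr (- real_of_int n / D) * smoothed_shell A \<phi> (matrix_powi A (n + 1) *v x)
        = q powr (1 / D) * f (n + 1)" by (simp add: f_def)
  qed
  also have "\<dots> = q powr (1 / D) * (\<Sum>\<^sub>\<infinity>n. f (n + 1))" by (rule infsum_cmult_right')
  also have "(\<Sum>\<^sub>\<infinity>n. f (n + 1)) = (\<Sum>\<^sub>\<infinity>n. f n)"
    by (rule infsum_reindex_bij_betw) (rule bij_plus_right)
  finally show ?thesis by (simp add: f_def pseudo_norm_def q_def D_def)
qed

lemma mollifier_integrable:
  assumes "mollifier \<delta> \<phi>"
  shows "integrable lborel \<phi>"
  using assms not_integrable_integral_eq[of lborel \<phi>] by (force simp: mollifier_def)

lemma mollifier_continuous:
  assumes "mollifier \<delta> \<phi>"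
  shows "continuous_on UNIV \<phi>"
  using assms unfolding mollifier_def C_infinity_def by (metis times_differentiable.simps(1))

lemma smoothed_shell_nonneg:
  assumes "mollifier \<delta> \<phi>"
  shows "0 \<le> smoothed_shell A \<phi> x"
  using assms by (simp add: smoothed_shell_def mollifier_def integral_nonneg)

lemma smoothed_shell_le_1:
  assumes "mollifier \<delta> \<phi>"
  shows "smoothed_shell A \<phi> x \<le> 1"
proof -
  have "smoothed_shell A \<phi> x \<le> (\<integral>y. \<phi> y \<partial>lborel)"
    unfolding smoothed_shell_def Let_def
    by (rule integral_mono'[OF mollifier_integrable[OF assms]])
      (use assms in \<open>auto simp: mollifier_def indicator_def\<close>)
  then show ?thesis using assms by (simp add: mollifier_def)
qed

lemma smoothed_shell_eq_0:
  assumes "mollifier \<delta> \<phi>" "\<delta> < 1/2" "norm x < 1/2"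
  shows "smoothed_shell A \<phi> x = 0"
proof -
  have "indicator ((*v) A ` ball 0 1 - ball 0 1) (x - y) * \<phi> y = 0" for y
  proof (cases "\<phi> y = 0")
    case False
    then have "norm y < \<delta>" using assms(1) by (auto simp: mollifier_def)
    then have "norm (x - y) < 1" using assms norm_triangle_ineq4[of x y] by linarith
    then show ?thesis by simp
  qed simp
  then show ?thesis unfolding smoothed_shell_def Let_def by (simp only: integral_zero)
qed

text \<open>The terms with very negative \<open>n\<close> vanish, since \<open>A\<^sup>n x\<close> is then short; the remaining ones are
  dominated by a geometric series.\<close>

lemma pseudo_norm_terms_bounded:
  fixes A :: "real^'n^'n"
  assumes A: "expanding A" and \<phi>: "mollifier \<delta> \<phi>" "\<delta> < 1/2"
  shows "\<exists>C. \<forall>x F. norm x \<le> R \<longrightarrow> finite F \<longrightarrow>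
    (\<Sum>n\<in>F. pseudo_norm_term A \<phi> x n) \<le> C"
proof -
  define \<rho> where "\<rho> = \<bar>det A\<bar> powr (1 / real CARD('n))"
  have \<rho>: "1 < \<rho>" using expanding_abs_det_gt_1[OF A] by (simp add: \<rho>_def)
  have pow: "\<bar>det A\<bar> powr (- real_of_int n / real CARD('n)) = \<rho> powr (- real_of_int n)" for n
    by (simp add: \<rho>_def powr_powr)
  have "0 < 1 / (2 * (1 + \<bar>R\<bar>))" by simp
  then obtain N where N: "\<And>n. N \<le> n \<Longrightarrow>
      \<bar>onorm ((*v) (matrix_inv A) ^^ n)\<bar> < 1 / (2 * (1 + \<bar>R\<bar>))"
    using LIMSEQ_D[OF expanding_inverse_powers_onorm[OF A]] by (metis diff_zero real_norm_def)
  have short: "norm (((*v) (matrix_inv A) ^^ n) x) < 1/2" if "N \<le> n" "norm x \<le> R" for n x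
  proof -
    have "norm (((*v) (matrix_inv A) ^^ n) x) \<le> onorm ((*v) (matrix_inv A) ^^ n) * norm x"
      by (rule onorm[OF bounded_linear_funpow_matrix])
    also have "\<dots> \<le> 1 / (2 * (1 + \<bar>R\<bar>)) * norm x"
      using N[OF that(1)] by (intro mult_right_mono) auto
    also have "\<dots> < 1 / 2" using that(2) by (simp add: field_simps)
    finally show ?thesis .
  qed
  have vanish: "smoothed_shell A \<phi> (matrix_powi A n *v x) = 0" if "n \<le> - int (Suc N)" "norm x \<le> R" for n x
  proof -
    have "matrix_powi A n *v x = ((*v) (matrix_inv A) ^^ nat (- n)) x"
      using that by (simp add: matrix_powi_def matrix_pow_mult_vec)
    then show ?thesis using short[of "nat (- n)" x] that
      by (intro smoothed_shell_eq_0[OF \<phi>]) auto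
  qed
  define C where "C = \<rho> ^ N * (1 / (1 - 1 / \<rho>))"
  show ?thesis
  proof (intro exI[of _ C] allI impI)
    fix x :: "real^'n" and F :: "int set" assume x: "norm x \<le> R" and F: "finite F"
    let ?f = "\<lambda>n. \<rho> powr (- real_of_int n) * smoothed_shell A \<phi> (matrix_powi A n *v x)"
    define K where "K = nat (Max (insert 0 F) + int N + 1)"
    have "Max (insert 0 F) \<ge> n" if "n \<in> F" for n using F that by simp
    then have sub: "F \<inter> {- int N..} \<subseteq> (\<lambda>k. int k - int N) ` {..<K}"
    proof (intro subsetI)
      fix n assume *: "\<And>n. n \<in> F \<Longrightarrow> n \<le> Max (insert 0 F)" and n: "n \<in> F \<inter> {- int N..}"
      then have "0 \<le> n + int N" "n \<le> Max (insert 0 F)" using *[of n] by auto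
      then have "n = int (nat (n + int N)) - int N" "nat (n + int N) < K"
        unfolding K_def by linarith+
      then show "n \<in> (\<lambda>k. int k - int N) ` {..<K}" by blast
    qed
    have "(\<Sum>n\<in>F. ?f n) = (\<Sum>n\<in>F \<inter> {- int N..}. ?f n)"
    proof (rule sum.mono_neutral_right[OF F])
      show "\<forall>n\<in>F - F \<inter> {- int N..}. ?f n = 0"
      proof
        fix n assume "n \<in> F - F \<inter> {- int N..}"
        then have "n \<le> - int (Suc N)" by auto
        then show "?f n = 0" using vanish[OF _ x] by simp
      qed
    qed auto
    also have "\<dots> \<le> (\<Sum>n\<in>F \<inter> {- int N..}. \<rho> powr (- real_of_int n))"
      using \<rho> by (intro sum_mono mult_left_le smoothed_shell_le_1[OF \<phi>(1)]) auto
    also have "\<dots> \<le> (\<Sum>n\<in>(\<lambda>k. int k - int N) ` {..<K}. \<rho> powr (- real_of_int n))"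
      using sub by (intro sum_mono2) auto
    also have "\<dots> = (\<Sum>k<K. \<rho> ^ N * (1 / \<rho>) ^ k)"
    proof (subst sum.reindex)
      show "inj_on (\<lambda>k. int k - int N) {..<K}" by (auto simp: inj_on_def)
      have "\<rho> powr (- real_of_int (int k - int N)) = \<rho> ^ N * (1 / \<rho>) ^ k" for k
        using \<rho> by (simp add: powr_diff powr_realpow power_divide)
      then show "sum ((\<lambda>n. \<rho> powr (- real_of_int n)) \<circ> (\<lambda>k. int k - int N)) {..<K}
          = (\<Sum>k<K. \<rho> ^ N * (1 / \<rho>) ^ k)" by simp
    qed
    also have "\<dots> = \<rho> ^ N * (\<Sum>k<K. (1 / \<rho>) ^ k)" by (simp add: sum_distrib_left)
    also have "(\<Sum>k<K. (1 / \<rho>) ^ k) = (1 - (1 / \<rho>) ^ K) / (1 - 1 / \<rho>)"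
      using \<rho> by (simp add: sum_gp_strict)
    also have "\<rho> ^ N * \<dots> \<le> C"
      unfolding C_def using \<rho> by (intro mult_left_mono divide_right_mono) auto
    finally show "(\<Sum>n\<in>F. pseudo_norm_term A \<phi> x n) \<le> C"
      unfolding pseudo_norm_term_def pow .
  qed
qed

lemma pseudo_norm_term_nonneg:
  assumes "mollifier \<delta> \<phi>"
  shows "0 \<le> pseudo_norm_term A \<phi> x n"
  unfolding pseudo_norm_term_def
  by (intro mult_nonneg_nonneg powr_ge_zero smoothed_shell_nonneg[OF assms])

lemma pseudo_norm_summable:
  fixes A :: "real^'n^'n"
  assumes A: "expanding A" and \<phi>: "mollifier \<delta> \<phi>" "\<delta> < 1/2"
  shows "pseudo_norm_term A \<phi> x summable_on UNIV"
proof -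
  obtain C where "\<forall>y F. norm y \<le> norm x \<longrightarrow> finite F \<longrightarrow> (\<Sum>n\<in>F. pseudo_norm_term A \<phi> y n) \<le> C"
    using pseudo_norm_terms_bounded[OF assms, of "norm x"] by blast
  then have C: "(\<Sum>n\<in>F. pseudo_norm_term A \<phi> x n) \<le> C" if "finite F" for F
    using that by blast
  show ?thesis
    by (intro nonneg_bdd_above_summable_on bdd_aboveI[of _ C])
      (auto intro!: C pseudo_norm_term_nonneg[OF \<phi>(1)])
qed

lemma pseudo_norm_bounded_on_bounded:
  fixes A :: "real^'n^'n"
  assumes "expanding A" "mollifier \<delta> \<phi>" "\<delta> < 1/2"
  shows "\<exists>C. \<forall>x. norm x \<le> R \<longrightarrow> pseudo_norm A \<phi> x \<le> C"
proof -
  obtain C where C: "\<forall>x F. norm x \<le> R \<longrightarrow> finite F \<longrightarrow> (\<Sum>n\<in>F. pseudo_norm_term A \<phi> x n) \<le> C"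
    using pseudo_norm_terms_bounded[OF assms, of R] by blast
  have "pseudo_norm A \<phi> x \<le> C" if "norm x \<le> R" for x
    unfolding pseudo_norm_eq_infsum
    by (intro infsum_le_finite_sums pseudo_norm_summable[OF assms]) (use C that in blast)
  then show ?thesis by blast
qed

lemma smoothed_shell_le_pseudo_norm:
  fixes A :: "real^'n^'n"
  assumes "expanding A" "mollifier \<delta> \<phi>" "\<delta> < 1/2"
  shows "smoothed_shell A \<phi> x \<le> pseudo_norm A \<phi> x"
proof -
  have "\<bar>det A\<bar> powr 0 = 1" using expanding_abs_det_gt_1[OF assms(1)] by simp
  then have zero: "pseudo_norm_term A \<phi> x 0 = smoothed_shell A \<phi> x"
    by (simp add: pseudo_norm_term_def matrix_powi_def matrix_pow_def)
  show ?thesis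
    using finite_sum_le_infsum[OF pseudo_norm_summable[OF assms], of "{0}" x]
      pseudo_norm_term_nonneg[OF assms(2)]
    unfolding pseudo_norm_eq_infsum by (simp add: zero)
qed

text \<open>Around a point \<open>z\<close> of the shell there is, slightly further out in the direction of \<open>z\<close>, a small
  ball inside the shell. It contributes to the smoothed indicator at all points near \<open>z\<close>.\<close>

lemma smoothed_shell_locally_bounded_below:
  fixes A :: "real^'n^'n"
  assumes A: "invertible A" and \<phi>: "mollifier \<delta> \<phi>"
    and c: "0 < c" "0 < r" "\<And>y. norm y < r \<Longrightarrow> c \<le> \<phi> y"
    and z: "z \<in> (*v) A ` ball 0 1 - ball 0 1"
  shows "\<exists>\<eta>>0. \<forall>z'\<in>ball z (r/2). \<eta> \<le> smoothed_shell A \<phi> z'"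
proof -
  define V where "V = (*v) A ` ball 0 1 - ball 0 1"
  have surj: "surj ((*v) A)"
    using A invertible_eq_bij bij_is_surj by blast
  have op: "open ((*v) A ` ball 0 1)"
    by (rule open_surjective_linear_image[OF _ matrix_vector_mul_linear surj]) simp
  then obtain e0 where e0: "0 < e0" "ball z e0 \<subseteq> (*v) A ` ball 0 1"
    using z openE by blast
  define e where "e = min e0 (r / 2)"
  have e: "0 < e" "e \<le> r / 2" "ball z e \<subseteq> (*v) A ` ball 0 1"
    using e0 c by (auto simp: e_def)
  have z1: "1 \<le> norm z" using z by auto
  define p where "p = (1 + e / (2 * norm z)) *\<^sub>R z"
  have pz0: "p - z = (e / (2 * norm z)) *\<^sub>R z" by (simp add: p_def algebra_simps)
  have "z \<noteq> 0" using z1 by auto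
  with pz0 have pz: "norm (p - z) = e / 2" using e by simp
  have "norm p = (1 + e / (2 * norm z)) * norm z" using e z1 by (simp add: p_def)
  also have "\<dots> = norm z + e / 2" using \<open>z \<noteq> 0\<close> by (simp add: field_simps)
  finally have np: "norm p = norm z + e / 2" .
  have sub1: "ball p (e/2) \<subseteq> ball z e"
  proof
    fix y assume "y \<in> ball p (e/2)"
    then have "dist p y < e / 2" by simp
    then show "y \<in> ball z e"
      using dist_triangle[of z y p] pz by (simp add: dist_norm norm_minus_commute)
  qed
  have sub2: "ball p (e/2) \<inter> ball 0 1 = {}"
  proof -
    have "1 \<le> norm y" if "norm (p - y) < e / 2" for y
      using norm_triangle_sub[of p y] that np z1 by linarith
    then show ?thesis by (force simp: dist_norm)
  qed
  have inV: "ball p (e/2) \<subseteq> V" using sub1 sub2 e by (auto simp: V_def)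
  have "V \<in> sets borel" unfolding V_def using op by auto
  note [measurable] = this mollifier_continuous[OF \<phi>, THEN borel_measurable_continuous_onI]
  have int: "integrable lborel (\<lambda>y. indicator V (z' - y) * \<phi> y)" for z'
    by (rule Bochner_Integration.integrable_bound[OF mollifier_integrable[OF \<phi>]])
      (auto simp: indicator_def)
  define \<eta> where "\<eta> = c * measure lborel (ball (0::real^'n) (e/2))"
  show ?thesis
  proof (intro exI[of _ \<eta>] conjI ballI)
    show "0 < \<eta>" using c e by (simp add: \<eta>_def content_ball_pos)
    fix z' assume z': "z' \<in> ball z (r/2)"
    have "measure lborel (ball (z' - p) (e/2)) = measure lborel (ball (0::real^'n) (e/2))"
      using e by (simp add: content_ball)
    then have "\<eta> = (\<integral>y. c * indicator (ball (z' - p) (e/2)) y \<partial>lborel)"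
      by (simp add: \<eta>_def)
    also have "\<dots> \<le> (\<integral>y. indicator V (z' - y) * \<phi> y \<partial>lborel)"
    proof (rule integral_mono'[OF int])
      fix y
      show "0 \<le> indicator V (z' - y) * \<phi> y" using \<phi> by (simp add: mollifier_def)
      show "c * indicator (ball (z' - p) (e/2)) y \<le> indicator V (z' - y) * \<phi> y"
      proof (cases "y \<in> ball (z' - p) (e/2)")
        case True
        then have near: "z' - y \<in> ball p (e/2)"
          by (simp add: dist_norm norm_minus_commute algebra_simps)
        then have "z' - y \<in> ball z e" using sub1 by blast
        then have "norm (z - (z' - y)) < r / 2" using e by (simp add: dist_norm)
        moreover have "norm (z - z') < r / 2" using z' by (simp add: dist_norm)
        moreover have "y = (z - (z' - y)) - (z - z')" by simp
        ultimately have "norm y < r" using norm_triangle_ineq4[of "z - (z' - y)" "z - z'"] by simp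
        then show ?thesis using near inV True c(3)[of y] by auto
      qed (use \<phi> in \<open>simp add: mollifier_def\<close>)
    qed
    finally show "\<eta> \<le> smoothed_shell A \<phi> z'" by (simp add: smoothed_shell_def V_def)
  qed
qed

text \<open>Finitely many of the neighbourhoods of the preceding lemma cover the closure of the shell.\<close>

lemma smoothed_shell_bounded_below:
  fixes A :: "real^'n^'n"
  assumes A: "invertible A" and \<phi>: "mollifier \<delta> \<phi>"
  shows "\<exists>\<eta>>0. \<forall>z\<in>(*v) A ` ball 0 1 - ball 0 1. \<eta> \<le> smoothed_shell A \<phi> z"
proof -
  define V where "V = (*v) A ` ball 0 1 - ball 0 1"
  have "0 < \<phi> 0" using \<phi> by (simp add: mollifier_def)
  moreover have "isCont \<phi> 0"
    using mollifier_continuous[OF \<phi>] by (simp add: continuous_on_eq_continuous_at)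
  ultimately obtain r where r0: "0 < r" "\<And>y. dist y 0 < r \<Longrightarrow> dist (\<phi> y) (\<phi> 0) < \<phi> 0 / 2"
    unfolding continuous_at_eps_delta by (meson half_gt_zero)
  have r: "0 < r" "\<And>y. norm y < r \<Longrightarrow> \<phi> 0 / 2 \<le> \<phi> y"
  proof -
    fix y :: "real^'n" assume "norm y < r"
    then have "dist (\<phi> y) (\<phi> 0) < \<phi> 0 / 2" by (intro r0(2)) simp
    then show "\<phi> 0 / 2 \<le> \<phi> y" unfolding dist_real_def by linarith
  qed (rule r0(1))
  have "\<exists>\<eta>>0. \<forall>z'\<in>ball z (r/2). \<eta> \<le> smoothed_shell A \<phi> z'" if "z \<in> V" for z
    using smoothed_shell_locally_bounded_below[OF A \<phi> _ r, of z] \<open>0 < \<phi> 0\<close> that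
    unfolding V_def by simp
  then obtain H where H: "\<And>z. z \<in> V \<Longrightarrow> 0 < H z"
      "\<And>z z'. z \<in> V \<Longrightarrow> z' \<in> ball z (r/2) \<Longrightarrow> H z \<le> smoothed_shell A \<phi> z'"
    by metis
  have "bounded V" unfolding V_def
    by (rule bounded_subset[OF bounded_linear_image[OF bounded_ball matrix_vector_mul_bounded_linear]])
      auto
  then have cpt: "compact (closure V)" by (simp add: compact_closure)
  have cov: "closure V \<subseteq> (\<Union>z\<in>V. ball z (r/2))"
  proof
    fix y assume "y \<in> closure V"
    then obtain z where "z \<in> V" "dist z y < r / 2"
      using r(1) by (meson closure_approachable half_gt_zero)
    then show "y \<in> (\<Union>z\<in>V. ball z (r/2))" by auto
  qed
  obtain F where F: "F \<subseteq> V" "finite F" "closure V \<subseteq> (\<Union>z\<in>F. ball z (r/2))"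
    using compactE_image[OF cpt _ cov] open_ball by metis
  define \<eta> where "\<eta> = Min (insert 1 (H ` F))"
  show ?thesis
  proof (intro exI[of _ \<eta>] conjI ballI)
    have "\<forall>y\<in>insert 1 (H ` F). 0 < y" using F(1) H(1) by auto
    then show "0 < \<eta>" unfolding \<eta>_def using F(2) by simp
    fix z assume "z \<in> (*v) A ` ball 0 1 - ball 0 1"
    then have "z \<in> V" unfolding V_def .
    then have "z \<in> closure V" by (rule subsetD[OF closure_subset])
    with F(3) have "z \<in> (\<Union>z\<in>F. ball z (r/2))" by (rule subsetD)
    then obtain y where y: "y \<in> F" "z \<in> ball y (r/2)" by (rule UN_E)
    have "\<eta> \<le> H y" unfolding \<eta>_def by (intro Min_le) (use F(2) y(1) in auto)
    also have "H y \<le> smoothed_shell A \<phi> z" using H(2) y F(1) by blast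
    finally show "\<eta> \<le> smoothed_shell A \<phi> z" .
  qed
qed

text \<open>A long vector \<open>x\<close> needs many applications of \<open>A\<inverse>\<close> to reach the unit ball. The last iterate
  outside the ball lies in the shell, where the pseudo-norm is bounded below, so the pseudo-norm
  of \<open>x\<close> is large.\<close>

lemma pseudo_norm_sublevel_bounded:
  fixes A :: "real^'n^'n"
  assumes A: "expanding A" and \<phi>: "mollifier \<delta> \<phi>" "\<delta> < 1/2"
  shows "\<exists>R. \<forall>x. pseudo_norm A \<phi> x \<le> 1 \<longrightarrow> norm x \<le> R"
proof -
  define T where "T = matrix_inv A"
  define \<rho> where "\<rho> = \<bar>det A\<bar> powr (1 / real CARD('n))"
  have \<rho>: "1 < \<rho>" using expanding_abs_det_gt_1[OF A] by (simp add: \<rho>_def)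
  obtain \<eta> where \<eta>: "0 < \<eta>"
    "\<forall>z\<in>(*v) A ` ball 0 1 - ball 0 1. \<eta> \<le> smoothed_shell A \<phi> z"
    using smoothed_shell_bounded_below[OF expanding_invertible[OF A] \<phi>(1)] by blast
  obtain m where m: "1 / \<eta> < \<rho> ^ m" using real_arch_pow[OF \<rho>] by blast
  define R where "R = 1 + (\<Sum>k\<le>Suc m. onorm ((*v) A ^^ k))"
  have onn: "0 \<le> onorm ((*v) A ^^ k)" for k by (rule onorm_pos_le[OF bounded_linear_funpow_matrix])
  have AT: "A *v (T *v x) = x" for x
    by (simp add: T_def matrix_vector_mul_assoc matrix_inv_mult expanding_invertible[OF A])
  have powAT: "((*v) A ^^ k) (((*v) T ^^ k) x) = x" for k x
  proof (induction k)
    case (Suc k)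
    have "((*v) A ^^ Suc k) (((*v) T ^^ Suc k) x) = ((*v) A ^^ k) (A *v (T *v ((*v) T ^^ k) x))"
      by (simp add: funpow_swap1)
    then show ?case using Suc by (simp add: AT)
  qed simp
  have scale: "pseudo_norm A \<phi> x = \<rho> ^ k * pseudo_norm A \<phi> (((*v) T ^^ k) x)" for k x
  proof (induction k)
    case (Suc k)
    have "pseudo_norm A \<phi> (((*v) T ^^ k) x) = \<rho> * pseudo_norm A \<phi> (T *v ((*v) T ^^ k) x)"
      unfolding \<rho>_def pseudo_norm_mult[OF A, symmetric] AT ..
    then show ?case using Suc by simp
  qed simp
  show ?thesis
  proof (intro exI[of _ R] allI impI)
    fix x :: "real^'n" assume w: "pseudo_norm A \<phi> x \<le> 1"
    show "norm x \<le> R"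
    proof (cases "norm x < 1")
      case True
      moreover have "0 \<le> (\<Sum>k\<le>Suc m. onorm ((*v) A ^^ k))" using onn by (intro sum_nonneg) auto
      ultimately show ?thesis unfolding R_def by linarith
    next
      case False
      have "\<exists>k. norm (((*v) T ^^ k) x) < 1"
        using LIMSEQ_D[OF expanding_inverse_powers_vanish[OF A], of 1 x] unfolding T_def
        by (metis diff_zero order_refl zero_less_one)
      then obtain k where k: "norm (((*v) T ^^ k) x) < 1" "\<And>j. j < k \<Longrightarrow> \<not> norm (((*v) T ^^ j) x) < 1"
        using exists_least_iff[of "\<lambda>k. norm (((*v) T ^^ k) x) < 1"] by blast
      then obtain j where j: "k = Suc j" using False by (cases k) auto
      define z where "z = ((*v) T ^^ j) x"
      have "z = A *v (((*v) T ^^ k) x)" by (simp add: z_def j AT)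
      then have "z \<in> (*v) A ` ball 0 1 - ball 0 1"
        using k(1) k(2)[of j] j by (auto simp: z_def)
      then have "\<eta> \<le> pseudo_norm A \<phi> z"
        using \<eta>(2) smoothed_shell_le_pseudo_norm[OF A \<phi>, of z] by (meson order_trans)
      then have "\<rho> ^ j * \<eta> \<le> \<rho> ^ j * pseudo_norm A \<phi> z" using \<rho> by (intro mult_left_mono) auto
      also have "\<dots> = pseudo_norm A \<phi> x" unfolding z_def by (rule scale[symmetric])
      finally have "\<rho> ^ j * \<eta> \<le> 1" using w by simp
      then have "\<rho> ^ j \<le> 1 / \<eta>" using \<eta>(1) by (simp add: field_simps)
      then have "\<rho> ^ j < \<rho> ^ m" using m by simp
      then have "k \<le> Suc m" using \<rho> j by (simp add: power_less_imp_less_exp less_imp_le)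
      have "norm x = norm (((*v) A ^^ k) (((*v) T ^^ k) x))" by (simp add: powAT)
      also have "\<dots> \<le> onorm ((*v) A ^^ k) * norm (((*v) T ^^ k) x)"
        by (rule onorm[OF bounded_linear_funpow_matrix])
      also have "\<dots> \<le> onorm ((*v) A ^^ k)"
        by (rule mult_left_le[OF less_imp_le[OF k(1)] onn])
      also have "\<dots> \<le> (\<Sum>k\<le>Suc m. onorm ((*v) A ^^ k))"
        by (rule member_le_sum) (use \<open>k \<le> Suc m\<close> in \<open>simp_all only: atMost_iff onn finite_atMost\<close>)
      finally show ?thesis unfolding R_def by linarith
    qed
  qed
qed

section \<open>Hausdorff measures for a gauge\<close>

lemma le_mult_INF_ennreal:
  fixes f :: "'i \<Rightarrow> ennreal"
  assumes c: "0 < c" and le: "\<And>i. i \<in> I \<Longrightarrow> x \<le> ennreal c * f i"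
  shows "x \<le> ennreal c * (INF i\<in>I. f i)"
proof -
  have x: "x = ennreal c * (ennreal (1 / c) * x)"
    using c by (simp add: mult.assoc[symmetric] ennreal_mult[symmetric])
  have "ennreal (1 / c) * x \<le> f i" if "i \<in> I" for i
  proof -
    have "ennreal c * (ennreal (1 / c) * x) \<le> ennreal c * f i" using le[OF that] x by simp
    then show ?thesis by (subst (asm) ennreal_mult_le_mult_iff) (use c in auto)
  qed
  then have "ennreal (1 / c) * x \<le> (INF i\<in>I. f i)" by (rule INF_greatest)
  then have "ennreal c * (ennreal (1 / c) * x) \<le> ennreal c * (INF i\<in>I. f i)"
    by (rule mult_left_mono) simp
  then show ?thesis using x by simp
qed

lemma hausdorff_pre_antimono:
  assumes "\<delta> \<le> \<delta>'"
  shows "hausdorff_pre w s \<delta>' X \<le> hausdorff_pre w s \<delta> X"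
  unfolding hausdorff_pre_def
  by (rule INF_superset_mono) (use assms in \<open>auto intro: order_trans ennreal_leI\<close>)

lemma hausdorff_outer_eq_SUP:
  "hausdorff_outer w s X = (SUP \<delta>\<in>{0<..}. hausdorff_pre w s \<delta> X)"
proof -
  let ?f = "\<lambda>\<delta>. hausdorff_pre w s \<delta> X"
  have "(?f \<longlongrightarrow> (SUP \<delta>\<in>{0<..}. ?f \<delta>)) (at_right 0)"
  proof (rule order_tendstoI)
    fix a assume "a < (SUP \<delta>\<in>{0<..}. ?f \<delta>)"
    then obtain \<delta>0 where \<delta>0: "0 < \<delta>0" "a < ?f \<delta>0" by (auto simp: less_SUP_iff)
    then have "a < ?f \<delta>" if "0 < \<delta>" "\<delta> < \<delta>0" for \<delta>
      using hausdorff_pre_antimono[of \<delta> \<delta>0 w s X] that by (meson less_imp_le less_le_trans)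
    then show "\<forall>\<^sub>F \<delta> in at_right 0. a < ?f \<delta>"
      unfolding eventually_at_right_field using \<delta>0(1) by blast
  next
    fix a assume a: "(SUP \<delta>\<in>{0<..}. ?f \<delta>) < a"
    have "?f \<delta> < a" if "0 < \<delta>" for \<delta>
      using a that by (meson SUP_upper greaterThan_iff le_less_trans)
    then show "\<forall>\<^sub>F \<delta> in at_right 0. ?f \<delta> < a"
      unfolding eventually_at_right_field using zero_less_one by blast
  qed
  then show ?thesis
    unfolding hausdorff_outer_def by (intro tendsto_Lim) simp_all
qed

lemma hausdorff_pre_le_outer: "0 < \<delta> \<Longrightarrow> hausdorff_pre w s \<delta> X \<le> hausdorff_outer w s X"
  unfolding hausdorff_outer_eq_SUP by (rule SUP_upper) simp

lemma hausdorff_outer_leI: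
  assumes "\<And>\<delta>. 0 < \<delta> \<Longrightarrow> hausdorff_pre w s \<delta> X \<le> c"
  shows "hausdorff_outer w s X \<le> c"
  unfolding hausdorff_outer_eq_SUP by (rule SUP_least) (use assms in auto)

lemma hausdorff_pre_le_cover:
  assumes "X \<subseteq> (\<Union>i::nat. C i)" "\<And>i. wdiam w (C i) \<le> ennreal \<delta>"
  shows "hausdorff_pre w s \<delta> X \<le> (\<Sum>i. wdiam_power w s (C i))"
  unfolding hausdorff_pre_def by (rule INF_lower) (use assms in auto)

lemma hausdorff_outer_mono:
  assumes "X \<subseteq> Y"
  shows "hausdorff_outer w s X \<le> hausdorff_outer w s Y"
proof (rule hausdorff_outer_leI)
  fix \<delta> :: real assume "0 < \<delta>"
  have "hausdorff_pre w s \<delta> X \<le> hausdorff_pre w s \<delta> Y"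
    unfolding hausdorff_pre_def by (rule INF_superset_mono) (use assms in auto)
  also have "\<dots> \<le> hausdorff_outer w s Y" by (rule hausdorff_pre_le_outer[OF \<open>0 < \<delta>\<close>])
  finally show "hausdorff_pre w s \<delta> X \<le> hausdorff_outer w s Y" .
qed

lemma wdiam_empty [simp]: "wdiam w {} = 0"
  by (simp add: wdiam_def bot_ennreal)

lemma wdiam_power_empty [simp]: "wdiam_power w s {} = 0"
  by (simp add: wdiam_power_def)

lemma hausdorff_outer_empty: "hausdorff_outer w s {} = 0"
proof -
  have "hausdorff_pre w s \<delta> {} \<le> 0" for \<delta>
    using hausdorff_pre_le_cover[of "{}" "\<lambda>_. {}" w \<delta> s] by simp
  then have "hausdorff_outer w s {} \<le> 0" by (intro hausdorff_outer_leI)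
  then show ?thesis by simp
qed

lemma hausdorff_pre_le_finite_cover:
  assumes "finite I" "X \<subseteq> (\<Union>i\<in>I. C i)" "\<And>i. i \<in> I \<Longrightarrow> wdiam w (C i) \<le> ennreal \<delta>"
  shows "hausdorff_pre w s \<delta> X \<le> (\<Sum>i\<in>I. wdiam_power w s (C i))"
proof -
  obtain h where h: "bij_betw h {0..<card I} I" using ex_bij_betw_nat_finite[OF assms(1)] by blast
  define D where "D n = (if n < card I then C (h n) else {})" for n
  have "hausdorff_pre w s \<delta> X \<le> (\<Sum>n. wdiam_power w s (D n))"
  proof (rule hausdorff_pre_le_cover)
    show "X \<subseteq> (\<Union>n. D n)"
    proof
      fix x assume "x \<in> X"
      then obtain i where i: "i \<in> I" "x \<in> C i" using assms(2) by blast
      have "i \<in> h ` {0..<card I}" using h i(1) by (simp add: bij_betw_def)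
      then obtain n where "n < card I" "h n = i" by auto
      then have "x \<in> D n" using i by (simp add: D_def)
      then show "x \<in> (\<Union>n. D n)" by blast
    qed
    show "wdiam w (D n) \<le> ennreal \<delta>" for n
    proof (cases "n < card I")
      case True
      then have "h n \<in> I" using h by (auto simp: bij_betw_def)
      then show ?thesis using True assms(3) by (simp add: D_def)
    qed (simp add: D_def)
  qed
  also have "\<dots> = (\<Sum>n\<in>{0..<card I}. wdiam_power w s (D n))"
    by (rule suminf_finite) (auto simp: D_def)
  also have "\<dots> = (\<Sum>n\<in>{0..<card I}. wdiam_power w s (C (h n)))"
    by (intro sum.cong) (auto simp: D_def)
  also have "\<dots> = (\<Sum>i\<in>I. wdiam_power w s (C i))" by (rule sum.reindex_bij_betw[OF h])
  finally show ?thesis .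
qed

lemma hausdorff_outer_UN_le:
  "hausdorff_outer w s (\<Union>n::nat. X n) \<le> (\<Sum>n. hausdorff_outer w s (X n))"
proof (rule hausdorff_outer_leI)
  fix \<delta> :: real assume \<delta>: "0 < \<delta>"
  show "hausdorff_pre w s \<delta> (\<Union>n. X n) \<le> (\<Sum>n. hausdorff_outer w s (X n))"
  proof (rule ennreal_le_epsilon)
    fix e :: real assume e: "0 < e" and fin: "(\<Sum>n. hausdorff_outer w s (X n)) < top"
    have "\<exists>C. X n \<subseteq> (\<Union>i::nat. C i) \<and> (\<forall>i. wdiam w (C i) \<le> ennreal \<delta>) \<and>
        (\<Sum>i. wdiam_power w s (C i)) \<le> hausdorff_outer w s (X n) + ennreal (e * (1/2) ^ Suc n)" for n
    proof -
      have "hausdorff_outer w s (X n) < top" using fin by (rule ennreal_suminf_lessD)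
      moreover have "0 < ennreal (e * (1/2) ^ Suc n)" using e by simp
      ultimately have "hausdorff_outer w s (X n) < hausdorff_outer w s (X n) + ennreal (e * (1/2) ^ Suc n)"
        by (cases "hausdorff_outer w s (X n)") (auto simp flip: ennreal_plus simp: ennreal_less_iff e)
      then have "hausdorff_pre w s \<delta> (X n) < hausdorff_outer w s (X n) + ennreal (e * (1/2) ^ Suc n)"
        using hausdorff_pre_le_outer[OF \<delta>] by (rule le_less_trans[rotated])
      then obtain C where "X n \<subseteq> (\<Union>i::nat. C i) \<and> (\<forall>i. wdiam w (C i) \<le> ennreal \<delta>)"
        "(\<Sum>i. wdiam_power w s (C i)) < hausdorff_outer w s (X n) + ennreal (e * (1/2) ^ Suc n)"
        unfolding hausdorff_pre_def INF_less_iff mem_Collect_eq by blast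
      then show ?thesis using less_imp_le by blast
    qed
    then obtain C where C: "\<And>n. X n \<subseteq> (\<Union>i::nat. C n i)" "\<And>n i. wdiam w (C n i) \<le> ennreal \<delta>"
        "\<And>n. (\<Sum>i. wdiam_power w s (C n i)) \<le> hausdorff_outer w s (X n) + ennreal (e * (1/2) ^ Suc n)"
      by metis
    define D where "D k = case_prod C (prod_decode k)" for k
    have "(\<Union>n. X n) \<subseteq> (\<Union>k. D k)"
    proof
      fix x assume "x \<in> (\<Union>n. X n)"
      then obtain n i where "x \<in> C n i" using C(1) by blast
      then have "x \<in> D (prod_encode (n, i))" by (simp add: D_def)
      then show "x \<in> (\<Union>k. D k)" by blast
    qed
    then have "hausdorff_pre w s \<delta> (\<Union>n. X n) \<le> (\<Sum>k. wdiam_power w s (D k))"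
      by (rule hausdorff_pre_le_cover) (simp add: D_def C(2) split: prod.split)
    also have "\<dots> = (\<Sum>k. (\<lambda>p. wdiam_power w s (case_prod C p)) (prod_decode k))"
      by (simp add: D_def)
    also have "\<dots> = (\<Sum>n. \<Sum>i. wdiam_power w s (C n i))"
      by (rule suminf_ennreal_2dimen) simp
    also have "\<dots> \<le> (\<Sum>n. hausdorff_outer w s (X n) + ennreal (e * (1/2) ^ Suc n))"
      by (intro suminf_le C(3)) auto
    also have "\<dots> = (\<Sum>n. hausdorff_outer w s (X n)) + (\<Sum>n. ennreal (e * (1/2) ^ Suc n))"
      by (rule suminf_add[symmetric]) auto
    also have "(\<Sum>n. ennreal (e * (1/2) ^ Suc n)) = ennreal e"
    proof (rule sums_unique[symmetric])
      have "(\<lambda>n. e * (1/2) ^ Suc n) sums (e * 1)" by (intro sums_mult power_half_series)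
      then show "(\<lambda>n. ennreal (e * (1/2) ^ Suc n)) sums ennreal e" using e by simp
    qed
    finally show "hausdorff_pre w s \<delta> (\<Union>n. X n) \<le> (\<Sum>n. hausdorff_outer w s (X n)) + ennreal e" .
  qed
qed

lemma hausdorff_outer_Un_le:
  "hausdorff_outer w s (X \<union> Y) \<le> hausdorff_outer w s X + hausdorff_outer w s Y"
proof -
  define Z where "Z n = (if n = 0 then X else if n = Suc 0 then Y else {})" for n
  have "(\<Union>n. Z n) = X \<union> Y" by (auto simp: Z_def split: if_splits)
  moreover have "(\<Sum>n. hausdorff_outer w s (Z n)) = (\<Sum>n\<in>{0, Suc 0}. hausdorff_outer w s (Z n))"
    by (rule suminf_finite) (auto simp: Z_def hausdorff_outer_empty)
  ultimately show ?thesis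
    using hausdorff_outer_UN_le[of w s Z] by (simp add: Z_def)
qed

lemma hausdorff_outer_finite_UN_le:
  assumes "finite I"
  shows "hausdorff_outer w s (\<Union>i\<in>I. X i) \<le> (\<Sum>i\<in>I. hausdorff_outer w s (X i))"
  using assms
proof induction
  case (insert i I)
  have "hausdorff_outer w s (\<Union>j\<in>insert i I. X j)
      \<le> hausdorff_outer w s (X i) + hausdorff_outer w s (\<Union>j\<in>I. X j)"
    using hausdorff_outer_Un_le by simp
  also have "\<dots> \<le> hausdorff_outer w s (X i) + (\<Sum>j\<in>I. hausdorff_outer w s (X j))"
    by (intro add_left_mono insert.IH)
  finally show ?case using insert by simp
qed (simp add: hausdorff_outer_empty)

lemma hausdorff_outer_countable_UN_le:
  assumes "countable I"
  shows "hausdorff_outer w s (\<Union>i\<in>I. X i) \<le> (\<integral>\<^sup>+i. hausdorff_outer w s (X i) \<partial>count_space I)"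
proof (cases "finite I")
  case True
  then show ?thesis using hausdorff_outer_finite_UN_le by (simp add: nn_integral_count_space_finite)
next
  case False
  then have bij: "bij_betw (from_nat_into I) UNIV I"
    using assms by (simp add: bij_betw_from_nat_into)
  have "(\<Union>i\<in>I. X i) = (\<Union>i\<in>range (from_nat_into I). X i)"
    using bij by (simp add: bij_betw_def)
  also have "\<dots> = (\<Union>n. X (from_nat_into I n))" by (rule SUP_image[unfolded o_def])
  finally have "hausdorff_outer w s (\<Union>i\<in>I. X i) \<le> (\<Sum>n. hausdorff_outer w s (X (from_nat_into I n)))"
    using hausdorff_outer_UN_le[of w s "\<lambda>n. X (from_nat_into I n)"] by simp
  also have "\<dots> = (\<integral>\<^sup>+n. hausdorff_outer w s (X (from_nat_into I n)) \<partial>count_space UNIV)"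
    by (simp add: nn_integral_count_space_nat)
  also have "\<dots> = (\<integral>\<^sup>+i. hausdorff_outer w s (X i) \<partial>count_space I)"
    by (rule nn_integral_bij_count_space[OF bij])
  finally show ?thesis .
qed

lemma wdiam_power_pos_exponent:
  "0 < s \<Longrightarrow> wdiam_power w s X = ennreal (enn2real (wdiam w X) powr s)"
  by (simp add: wdiam_power_def)

lemma wdiam_power_le:
  assumes "0 < s" "0 \<le> u" "wdiam w X \<le> ennreal u"
  shows "wdiam_power w s X \<le> ennreal (u powr s)"
proof -
  have "enn2real (wdiam w X) \<le> u" using enn2real_mono[OF assms(3)] assms(2) by simp
  then show ?thesis using assms
    by (simp add: wdiam_power_pos_exponent powr_mono2 ennreal_leI)
qed

lemma wdiam_le_iff: "wdiam w X \<le> c \<longleftrightarrow> (\<forall>x\<in>X. \<forall>y\<in>X. ennreal (w (x - y)) \<le> c)"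
  by (auto simp: wdiam_def SUP_le_iff)

text \<open>A cover of \<open>X\<close> is first intersected with \<open>X\<close>, where the Lipschitz bound holds, and then mapped by \<open>f\<close>.\<close>

lemma hausdorff_outer_image_le:
  assumes s: "0 < s" and r: "0 < r"
    and lip: "\<And>x y. x \<in> X \<Longrightarrow> y \<in> X \<Longrightarrow> w (f x - f y) \<le> r * w (x - y)"
  shows "hausdorff_outer w s (f ` X) \<le> ennreal (r powr s) * hausdorff_outer w s X"
proof (rule hausdorff_outer_leI)
  fix \<delta> :: real assume \<delta>: "0 < \<delta>"
  have "hausdorff_pre w s \<delta> (f ` X) \<le> ennreal (r powr s) * hausdorff_pre w s (\<delta> / r) X"
    unfolding hausdorff_pre_def[of w s "\<delta> / r"]
  proof (rule le_mult_INF_ennreal)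
    fix C assume "C \<in> {C :: nat \<Rightarrow> _. X \<subseteq> (\<Union>i. C i) \<and> (\<forall>i. wdiam w (C i) \<le> ennreal (\<delta> / r))}"
    then have C: "X \<subseteq> (\<Union>i. C i)" "\<And>i. wdiam w (C i) \<le> ennreal (\<delta> / r)" by auto
    define D where "D i = f ` (C i \<inter> X)" for i
    have D: "wdiam w (D i) \<le> ennreal (r * enn2real (wdiam w (C i)))" for i
      unfolding wdiam_le_iff
    proof (intro ballI)
      fix a b assume "a \<in> D i" "b \<in> D i"
      then obtain x y where xy: "a = f x" "b = f y" "x \<in> C i" "y \<in> C i" "x \<in> X" "y \<in> X"
        by (auto simp: D_def)
      have fin: "wdiam w (C i) < top" using C(2)[of i] by (metis ennreal_less_top le_less_trans)
      have "ennreal (w (x - y)) \<le> wdiam w (C i)" using xy(3,4) wdiam_le_iff[of w "C i"] by blast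
      then have "w (x - y) \<le> enn2real (wdiam w (C i))"
        using fin by (cases "wdiam w (C i)") (auto simp: ennreal_le_iff2)
      then have "w (f x - f y) \<le> r * enn2real (wdiam w (C i))"
        using lip[OF xy(5,6)] r by (meson mult_left_mono less_imp_le order_trans)
      then show "ennreal (w (a - b)) \<le> ennreal (r * enn2real (wdiam w (C i)))"
        using xy by (simp add: ennreal_leI)
    qed
    have small: "r * enn2real (wdiam w (C i)) \<le> \<delta>" for i
      using enn2real_mono[OF C(2)[of i]] r \<delta> by (simp add: field_simps)
    have "hausdorff_pre w s \<delta> (f ` X) \<le> (\<Sum>i. wdiam_power w s (D i))"
    proof (rule hausdorff_pre_le_cover)
      show "f ` X \<subseteq> (\<Union>i. D i)" using C(1) by (fastforce simp: D_def)
      show "wdiam w (D i) \<le> ennreal \<delta>" for i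
        by (rule order_trans[OF D ennreal_leI[OF small]])
    qed
    also have "\<dots> \<le> (\<Sum>i. ennreal (r powr s) * wdiam_power w s (C i))"
    proof (intro suminf_le)
      fix i
      have "wdiam_power w s (D i) \<le> ennreal ((r * enn2real (wdiam w (C i))) powr s)"
        using r by (intro wdiam_power_le[OF s _ D]) simp
      also have "\<dots> = ennreal (r powr s) * wdiam_power w s (C i)"
        using r s by (simp add: wdiam_power_pos_exponent powr_mult ennreal_mult)
      finally show "wdiam_power w s (D i) \<le> ennreal (r powr s) * wdiam_power w s (C i)" .
    qed auto
    finally show "hausdorff_pre w s \<delta> (f ` X) \<le> ennreal (r powr s) * (\<Sum>i. wdiam_power w s (C i))"
      by simp
  qed (use r in simp)
  also have "\<dots> \<le> ennreal (r powr s) * hausdorff_outer w s X"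
    using r \<delta> by (intro mult_left_mono hausdorff_pre_le_outer) auto
  finally show "hausdorff_pre w s \<delta> (f ` X) \<le> ennreal (r powr s) * hausdorff_outer w s X" .
qed

text \<open>On sets of diameter at most \<open>\<delta>\<close>, the power with exponent \<open>t\<close> is at most \<open>\<delta> powr (t - \<alpha>)\<close> times the one
  with exponent \<open>\<alpha>\<close>.\<close>

lemma hausdorff_outer_eq_0_above:
  assumes \<alpha>: "0 < \<alpha>" "\<alpha> < t" and fin: "hausdorff_outer w \<alpha> X < top"
  shows "hausdorff_outer w t X = 0"
proof -
  obtain h where h: "0 \<le> h" "hausdorff_outer w \<alpha> X = ennreal h"
    using fin by (cases "hausdorff_outer w \<alpha> X") auto
  have pre: "hausdorff_pre w t \<delta> X \<le> ennreal (\<delta> powr (t - \<alpha>) * h)" if \<delta>: "0 < \<delta>" for \<delta>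
  proof -
    have "hausdorff_pre w t \<delta> X \<le> ennreal (\<delta> powr (t - \<alpha>)) * hausdorff_pre w \<alpha> \<delta> X"
      unfolding hausdorff_pre_def[of w \<alpha>]
    proof (rule le_mult_INF_ennreal)
      fix C assume "C \<in> {C :: nat \<Rightarrow> _. X \<subseteq> (\<Union>i. C i) \<and> (\<forall>i. wdiam w (C i) \<le> ennreal \<delta>)}"
      then have C: "X \<subseteq> (\<Union>i. C i)" "\<And>i. wdiam w (C i) \<le> ennreal \<delta>" by auto
      have "hausdorff_pre w t \<delta> X \<le> (\<Sum>i. wdiam_power w t (C i))"
        by (rule hausdorff_pre_le_cover[OF C])
      also have "\<dots> \<le> (\<Sum>i. ennreal (\<delta> powr (t - \<alpha>)) * wdiam_power w \<alpha> (C i))"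
      proof (intro suminf_le)
        fix i
        define u where "u = enn2real (wdiam w (C i))"
        have u: "0 \<le> u" "u \<le> \<delta>"
          using enn2real_mono[OF C(2)[of i]] \<delta> by (simp_all add: u_def)
        have "u powr t = u powr (t - \<alpha>) * u powr \<alpha>" by (simp flip: powr_add)
        also have "\<dots> \<le> \<delta> powr (t - \<alpha>) * u powr \<alpha>"
          using u \<alpha> by (intro mult_right_mono powr_mono2) auto
        finally show "wdiam_power w t (C i) \<le> ennreal (\<delta> powr (t - \<alpha>)) * wdiam_power w \<alpha> (C i)"
          using \<alpha> by (simp add: wdiam_power_pos_exponent u_def ennreal_leI flip: ennreal_mult)
      qed auto
      finally show "hausdorff_pre w t \<delta> X \<le> ennreal (\<delta> powr (t - \<alpha>)) * (\<Sum>i. wdiam_power w \<alpha> (C i))"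
        by simp
    qed (use \<delta> in simp)
    also have "\<dots> \<le> ennreal (\<delta> powr (t - \<alpha>)) * ennreal h"
      unfolding h(2)[symmetric] by (intro mult_left_mono hausdorff_pre_le_outer \<delta>) simp
    finally show ?thesis using h by (simp add: ennreal_mult)
  qed
  have "hausdorff_outer w t X \<le> 0"
  proof (rule hausdorff_outer_leI, rule ennreal_le_epsilon)
    fix \<delta> e :: real assume \<delta>: "0 < \<delta>" and e: "0 < e"
    define \<eta> where "\<eta> = min \<delta> ((e / (h + 1)) powr (1 / (t - \<alpha>)))"
    have \<eta>: "0 < \<eta>" "\<eta> \<le> \<delta>" using \<delta> e h by (auto simp: \<eta>_def)
    have "\<eta> powr (t - \<alpha>) \<le> ((e / (h + 1)) powr (1 / (t - \<alpha>))) powr (t - \<alpha>)"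
      using \<eta> \<alpha> by (intro powr_mono2) (auto simp: \<eta>_def)
    also have "\<dots> = e / (h + 1)" using \<alpha> e h by (simp add: powr_powr)
    finally have "\<eta> powr (t - \<alpha>) * h \<le> e / (h + 1) * h" using h by (intro mult_right_mono) auto
    also have "\<dots> \<le> e" using e h by (simp add: field_simps)
    finally have le: "\<eta> powr (t - \<alpha>) * h \<le> e" .
    have "hausdorff_pre w t \<delta> X \<le> hausdorff_pre w t \<eta> X" by (rule hausdorff_pre_antimono[OF \<eta>(2)])
    also have "\<dots> \<le> ennreal e" using pre[OF \<eta>(1)] ennreal_leI[OF le] by (rule order_trans)
    finally show "hausdorff_pre w t \<delta> X \<le> 0 + ennreal e" by simp
  qed
  then show ?thesis by simp
qed

text \<open>Powers of diameters decrease in the exponent only for diameters at most 1; covers with larger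
  sets are avoided because the premeasures increase as \<open>\<delta>\<close> decreases.\<close>

lemma hausdorff_outer_antimono_exponent:
  assumes \<alpha>: "0 \<le> t" "t < \<alpha>"
  shows "hausdorff_outer w \<alpha> X \<le> hausdorff_outer w t X"
proof (rule hausdorff_outer_leI)
  fix \<delta>0 :: real assume "0 < \<delta>0"
  define \<delta> where "\<delta> = min \<delta>0 1"
  have \<delta>: "0 < \<delta>" "\<delta> \<le> \<delta>0" "\<delta> \<le> 1" using \<open>0 < \<delta>0\<close> by (auto simp: \<delta>_def)
  have "hausdorff_pre w \<alpha> \<delta>0 X \<le> hausdorff_pre w \<alpha> \<delta> X" by (rule hausdorff_pre_antimono[OF \<delta>(2)])
  also have "\<dots> \<le> hausdorff_pre w t \<delta> X"
    unfolding hausdorff_pre_def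
  proof (rule INF_mono)
    fix C assume C: "C \<in> {C :: nat \<Rightarrow> _. X \<subseteq> (\<Union>i. C i) \<and> (\<forall>i. wdiam w (C i) \<le> ennreal \<delta>)}"
    have "wdiam_power w \<alpha> (C i) \<le> wdiam_power w t (C i)" for i
    proof -
      have "wdiam w (C i) \<le> ennreal \<delta>" using C by auto
      from enn2real_mono[OF this] have u: "enn2real (wdiam w (C i)) \<le> 1" using \<delta> by simp
      have "enn2real (wdiam w (C i)) powr \<alpha> \<le> 1"
        using u \<alpha> by (intro powr_le1) auto
      moreover have "enn2real (wdiam w (C i)) powr \<alpha> \<le> enn2real (wdiam w (C i)) powr t"
        using u \<alpha> by (intro powr_mono') auto
      ultimately show ?thesis using \<alpha> by (auto simp: wdiam_power_def intro: ennreal_leI)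
    qed
    then have "(\<Sum>i. wdiam_power w \<alpha> (C i)) \<le> (\<Sum>i. wdiam_power w t (C i))"
      by (intro suminf_le) auto
    then show "\<exists>C'\<in>{C :: nat \<Rightarrow> _. X \<subseteq> (\<Union>i. C i) \<and> (\<forall>i. wdiam w (C i) \<le> ennreal \<delta>)}.
        (\<Sum>i. wdiam_power w \<alpha> (C' i)) \<le> (\<Sum>i. wdiam_power w t (C i))"
      using C by blast
  qed
  also have "\<dots> \<le> hausdorff_outer w t X" by (rule hausdorff_pre_le_outer[OF \<delta>(1)])
  finally show "hausdorff_pre w \<alpha> \<delta>0 X \<le> hausdorff_outer w t X" .
qed

lemma hausdorff_dim_eqI:
  assumes "0 < \<alpha>" "hausdorff_outer w \<alpha> X \<noteq> 0" "hausdorff_outer w \<alpha> X < top"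
  shows "hausdorff_dim w X = \<alpha>"
  unfolding hausdorff_dim_def
proof (rule cInf_eq_non_empty)
  let ?S = "{s. 0 \<le> s \<and> hausdorff_outer w s X = 0}"
  have above: "t \<in> ?S" if "\<alpha> < t" for t
    using hausdorff_outer_eq_0_above[OF assms(1) that assms(3)] that assms(1) by simp
  show "?S \<noteq> {}" using above[of "\<alpha> + 1"] by (metis empty_iff less_add_one)
  show "\<alpha> \<le> t" if "t \<in> ?S" for t
    using that hausdorff_outer_antimono_exponent[of t \<alpha> w X] assms(2) by force
  show "y \<le> \<alpha>" if "\<And>t. t \<in> ?S \<Longrightarrow> y \<le> t" for y
    using that above by (meson dense_ge)
qed

text \<open>The sets \<open>C\<close> are arbitrary, so their preimages need not be measurable; measurable supersets \<open>J\<close> of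
  the preimages suffice to bound the total mass by the sum over a cover.\<close>

lemma mass_distribution_principle:
  assumes c: "0 < c" and \<delta>: "0 < \<delta>"
    and mass: "\<And>C. wdiam w C \<le> ennreal \<delta> \<Longrightarrow>
      \<exists>J\<in>sets M. f -` C \<inter> space M \<subseteq> J \<and> emeasure M J \<le> ennreal c * wdiam_power w s C"
    and f: "f ` space M \<subseteq> X"
  shows "emeasure M (space M) \<le> ennreal c * hausdorff_outer w s X"
proof -
  have "emeasure M (space M) \<le> ennreal c * hausdorff_pre w s \<delta> X"
    unfolding hausdorff_pre_def
  proof (rule le_mult_INF_ennreal[OF c])
    fix C assume "C \<in> {C :: nat \<Rightarrow> _. X \<subseteq> (\<Union>i. C i) \<and> (\<forall>i. wdiam w (C i) \<le> ennreal \<delta>)}"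
    then have C: "X \<subseteq> (\<Union>i. C i)" "\<And>i. wdiam w (C i) \<le> ennreal \<delta>" by auto
    have "\<forall>i. \<exists>J. J \<in> sets M \<and> f -` C i \<inter> space M \<subseteq> J \<and> emeasure M J \<le> ennreal c * wdiam_power w s (C i)"
      using mass[OF C(2)] by blast
    then obtain J where J: "\<And>i. J i \<in> sets M" "\<And>i. f -` C i \<inter> space M \<subseteq> J i"
        "\<And>i. emeasure M (J i) \<le> ennreal c * wdiam_power w s (C i)"
      by metis
    have "space M \<subseteq> (\<Union>i. J i)"
    proof
      fix x assume x: "x \<in> space M"
      then obtain i where "f x \<in> C i" using f C(1) by blast
      then show "x \<in> (\<Union>i. J i)" using J(2)[of i] x by blast
    qed
    then have "emeasure M (space M) \<le> emeasure M (\<Union>i. J i)"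
      using J(1) by (intro emeasure_mono sets.countable_UN) auto
    also have "\<dots> \<le> (\<Sum>i. emeasure M (J i))"
      using J(1) by (intro emeasure_subadditive_countably) auto
    also have "\<dots> \<le> (\<Sum>i. ennreal c * wdiam_power w s (C i))"
      by (intro suminf_le J(3)) auto
    finally show "emeasure M (space M) \<le> ennreal c * (\<Sum>i. wdiam_power w s (C i))" by simp
  qed
  also have "\<dots> \<le> ennreal c * hausdorff_outer w s X"
    by (intro mult_left_mono hausdorff_pre_le_outer \<delta>) simp
  finally show ?thesis .
qed

section \<open>Walks and the Perron eigenvector\<close>

text \<open>The last arc of a walk determines its end unless the walk is empty, hence the initial vertex as
  a second argument.\<close>

definition walk_end :: "('v, 'e) pre_digraph \<Rightarrow> 'v \<Rightarrow> 'e list \<Rightarrow> 'v" where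
  "walk_end G i \<gamma> = (if \<gamma> = [] then i else head G (last \<gamma>))"

lemma walk_end_Nil [simp]: "walk_end G i [] = i"
  by (simp add: walk_end_def)

lemma walk_end_Cons [simp]: "walk_end G i (e # \<gamma>) = walk_end G (head G e) \<gamma>"
  by (simp add: walk_end_def)

context fin_digraph
begin

lemma walks_0: "i \<in> verts G \<Longrightarrow> walks G i 0 = {[]}"
  by (auto simp: walks_def awalk_def)

lemma Cons_in_walks_iff:
  "e # \<gamma> \<in> walks G i (Suc k) \<longleftrightarrow> e \<in> out_arcs G i \<and> \<gamma> \<in> walks G (head G e) k"
  by (auto simp: walks_def awalk_def)

lemma walks_Suc: "walks G i (Suc k) = (\<Union>e\<in>out_arcs G i. (#) e ` walks G (head G e) k)"
proof (intro equalityI subsetI)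
  fix \<gamma> assume \<gamma>: "\<gamma> \<in> walks G i (Suc k)"
  then obtain e \<omega> where "\<gamma> = e # \<omega>" by (cases \<gamma>) (auto simp: walks_def)
  then show "\<gamma> \<in> (\<Union>e\<in>out_arcs G i. (#) e ` walks G (head G e) k)"
    using \<gamma> Cons_in_walks_iff by auto
next
  fix \<gamma> assume "\<gamma> \<in> (\<Union>e\<in>out_arcs G i. (#) e ` walks G (head G e) k)"
  then obtain e \<omega> where "\<gamma> = e # \<omega>" "e \<in> out_arcs G i" "\<omega> \<in> walks G (head G e) k" by blast
  then show "\<gamma> \<in> walks G i (Suc k)" by (simp only: Cons_in_walks_iff)
qed

lemma length_walk: "\<gamma> \<in> walks G i k \<Longrightarrow> length \<gamma> = k"
  by (simp add: walks_def)

lemma finite_walks: "i \<in> verts G \<Longrightarrow> finite (walks G i k)"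
proof (induction k arbitrary: i)
  case (Suc k)
  have "head G e \<in> verts G" if "e \<in> out_arcs G i" for e using that by auto
  then show ?case unfolding walks_Suc using Suc.IH by auto
qed (simp add: walks_0)

lemma sum_walks_Suc:
  fixes f :: "'b list \<Rightarrow> 'c::comm_monoid_add"
  shows "(\<Sum>\<gamma>\<in>walks G i (Suc k). f \<gamma>) = (\<Sum>e\<in>out_arcs G i. \<Sum>\<gamma>\<in>walks G (head G e) k. f (e # \<gamma>))"
proof -
  have "(\<Sum>\<gamma>\<in>walks G i (Suc k). f \<gamma>) =
      (\<Sum>e\<in>out_arcs G i. \<Sum>\<gamma>\<in>(#) e ` walks G (head G e) k. f \<gamma>)"
    unfolding walks_Suc
    by (intro sum.UNION_disjoint) (auto intro!: finite_imageI finite_walks)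
  also have "\<dots> = (\<Sum>e\<in>out_arcs G i. \<Sum>\<gamma>\<in>walks G (head G e) k. f (e # \<gamma>))"
    by (simp add: sum.reindex)
  finally show ?thesis .
qed

lemma sum_walks_eigenvector:
  fixes v :: "'a \<Rightarrow> real"
  assumes "\<And>i. i \<in> verts G \<Longrightarrow> (\<Sum>e\<in>out_arcs G i. v (head G e)) = l * v i"
  shows "i \<in> verts G \<Longrightarrow> (\<Sum>\<gamma>\<in>walks G i k. v (walk_end G i \<gamma>)) = l ^ k * v i"
proof (induction k arbitrary: i)
  case (Suc k)
  have "(\<Sum>\<gamma>\<in>walks G i (Suc k). v (walk_end G i \<gamma>)) = (\<Sum>e\<in>out_arcs G i. l ^ k * v (head G e))"
    unfolding sum_walks_Suc by (intro sum.cong refl) (simp add: Suc.IH)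
  also have "\<dots> = l ^ Suc k * v i"
    using Suc.prems assms by (simp add: sum_distrib_left[symmetric])
  finally show ?case .
qed (simp add: walks_0)

end

lemma matrix_pow_Suc_right: "matrix_pow M (Suc n) = matrix_pow M n ** M"
  for M :: "'s::semiring_1^'m^'m"
proof (induction n)
  case (Suc n)
  have "matrix_pow M (Suc (Suc n)) = M ** (matrix_pow M n ** M)"
    using Suc by (simp only: matrix_pow_def funpow.simps o_def)
  then show ?case by (simp only: matrix_mul_assoc matrix_pow_def funpow.simps o_def)
qed (simp add: matrix_pow_def)

lemma walk_if_entry_pos:
  fixes G :: "('v::finite, 'e) pre_digraph"
  assumes "fin_digraph G" "verts G = UNIV"
  shows "0 < matrix_pow (associated_matrix G) n $ j $ i \<Longrightarrow>
    \<exists>\<gamma>\<in>walks G i n. walk_end G i \<gamma> = j"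
proof (induction n arbitrary: i)
  case 0
  then have "i = j" by (simp add: matrix_pow_def mat_def split: if_splits)
  then show ?case using fin_digraph.walks_0[OF assms(1)] assms(2) by simp
next
  case (Suc n)
  have "matrix_pow (associated_matrix G) (Suc n) $ j $ i =
      (\<Sum>k\<in>UNIV. matrix_pow (associated_matrix G) n $ j $ k * associated_matrix G $ k $ i)"
    unfolding matrix_pow_Suc_right by (simp add: matrix_matrix_mult_def)
  with Suc.prems
  have "(\<Sum>k\<in>UNIV. matrix_pow (associated_matrix G) n $ j $ k * associated_matrix G $ k $ i) \<noteq> 0"
    by linarith
  then obtain k where "matrix_pow (associated_matrix G) n $ j $ k * associated_matrix G $ k $ i \<noteq> 0"
    by (rule sum.not_neutral_contains_not_neutral)
  then have k: "matrix_pow (associated_matrix G) n $ j $ k \<noteq> 0" "associated_matrix G $ k $ i \<noteq> 0"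
    by auto
  obtain \<gamma> where \<gamma>: "\<gamma> \<in> walks G k n" "walk_end G k \<gamma> = j" using Suc.IH k(1) by blast
  have "arcs_from_to G i k \<noteq> {}" using k(2) by (auto simp: associated_matrix_def)
  then obtain e where e: "e \<in> out_arcs G i" "head G e = k" by (auto simp: arcs_from_to_def)
  then have "e # \<gamma> \<in> walks G i (Suc n)"
    using \<gamma>(1) fin_digraph.Cons_in_walks_iff[OF assms(1)] by blast
  then show ?case using \<gamma>(2) e(2) by force
qed

lemma unit_simplex_compact_convex:
  defines "S \<equiv> {x :: real^'n. (\<forall>i. 0 \<le> x $ i) \<and> (\<Sum>i\<in>UNIV. x $ i) = 1}"
  shows "compact S" "convex S" "S \<noteq> {}"
proof -
  have "closed S"
  proof -
    have "S = (\<Inter>i. {x. 0 \<le> x $ i}) \<inter> {x. (\<Sum>i\<in>UNIV. x $ i) = 1}" by (auto simp: S_def)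
    moreover have "closed {x :: real^'n. 0 \<le> x $ i}" for i
      by (intro closed_Collect_le continuous_intros)
    moreover have "closed {x :: real^'n. (\<Sum>i\<in>UNIV. x $ i) = 1}"
      by (intro closed_Collect_eq continuous_intros)
    ultimately show ?thesis by auto
  qed
  moreover have "bounded S"
  proof (rule boundedI)
    fix x assume "x \<in> S"
    then have "(\<Sum>i\<in>UNIV. \<bar>x $ i\<bar>) = 1" by (simp add: S_def)
    then show "norm x \<le> 1" using norm_le_l1_cart[of x] by simp
  qed
  ultimately show "compact S" by (simp add: compact_eq_bounded_closed)
  show "convex S"
  proof (rule convexI)
    fix x y :: "real^'n" and a b :: real
    assume "x \<in> S" "y \<in> S" "0 \<le> a" "0 \<le> b" "a + b = 1"
    then show "a *\<^sub>R x + b *\<^sub>R y \<in> S"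
      by (simp add: S_def sum.distrib flip: sum_distrib_left)
  qed
  have "axis undefined 1 \<in> S" by (auto simp: S_def axis_def if_distrib[of "\<lambda>t. 0 \<le> t"])
  then show "S \<noteq> {}" by blast
qed

text \<open>The map \<open>x \<mapsto> B x / |B x|\<^sub>1\<close> of the unit simplex, where \<open>B\<close> is the transpose of the associated
  matrix, has a fixed point by Brouwer's theorem. Since every vertex reaches every other one, the
  fixed point has no vanishing coordinate.\<close>

lemma perron_eigenvector:
  fixes G :: "('v::finite, 'e) pre_digraph"
  assumes G: "fin_digraph G" "verts G = UNIV"
    and conn: "0 < n" "\<And>i j. \<exists>\<gamma>\<in>walks G i n. walk_end G i \<gamma> = j"
  shows "\<exists>v l. (\<forall>i. 0 < v i) \<and> 0 < l \<and> (\<forall>i. (\<Sum>e\<in>out_arcs G i. v (head G e)) = l * (v i :: real))"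
proof -
  interpret fin_digraph G by (rule G(1))
  define B :: "real^'v \<Rightarrow> real^'v" where "B x = (\<chi> i. \<Sum>e\<in>out_arcs G i. x $ head G e)" for x
  define s where "s x = (\<Sum>i\<in>UNIV. B x $ i)" for x
  define S :: "(real^'v) set" where "S = {x. (\<forall>i. 0 \<le> x $ i) \<and> (\<Sum>i\<in>UNIV. x $ i) = 1}"
  have nonneg: "0 \<le> B x $ i" if "x \<in> S" for x i
    using that by (auto simp: B_def S_def intro: sum_nonneg)
  have support: "\<exists>j. 0 < x $ j" if "x \<in> S" for x
    using that sum_nonpos[of UNIV "($) x"] by (force simp: S_def not_less)
  have pos: "0 < s x" if x: "x \<in> S" for x
  proof -
    obtain j where j: "0 < x $ j" using support[OF x] by blast
    obtain \<gamma> where \<gamma>: "\<gamma> \<in> walks G j n" "walk_end G j \<gamma> = j" using conn(2) by blast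
    have "\<gamma> \<noteq> []" using length_walk[OF \<gamma>(1)] conn(1) by auto
    then have "last \<gamma> \<in> arcs G" "head G (last \<gamma>) = j"
      using \<gamma> by (auto simp: walks_def awalk_def walk_end_def)
    then have last: "last \<gamma> \<in> out_arcs G (tail G (last \<gamma>))" "x $ head G (last \<gamma>) = x $ j" by auto
    have "x $ j \<le> B x $ tail G (last \<gamma>)"
      unfolding B_def vec_lambda_beta last(2)[symmetric]
      by (rule member_le_sum[OF last(1)]) (use x in \<open>auto simp: S_def\<close>)
    also have "\<dots> \<le> s x" unfolding s_def using nonneg[OF x] by (intro member_le_sum) auto
    finally show ?thesis using j by simp
  qed
  have contB: "continuous_on S B" unfolding B_def by (intro continuous_intros)
  have "continuous_on S (\<lambda>x. (1 / s x) *\<^sub>R B x)"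
    unfolding s_def
    by (intro continuous_intros contB) (use pos in \<open>force simp: s_def\<close>)
  moreover have "(\<lambda>x. (1 / s x) *\<^sub>R B x) \<in> S \<rightarrow> S"
  proof
    fix x assume x: "x \<in> S"
    have "(\<Sum>i\<in>UNIV. ((1 / s x) *\<^sub>R B x) $ i) = (1 / s x) * s x"
      unfolding s_def by (simp add: sum_divide_distrib[symmetric])
    then show "(1 / s x) *\<^sub>R B x \<in> S"
      using pos[OF x] nonneg[OF x] by (simp add: S_def)
  qed
  ultimately obtain x where x: "x \<in> S" "(1 / s x) *\<^sub>R B x = x"
    using brouwer[of S "\<lambda>x. (1 / s x) *\<^sub>R B x"] unit_simplex_compact_convex[where 'n = 'v]
    unfolding S_def[symmetric] by blast
  have eigen: "(\<Sum>e\<in>out_arcs G i. x $ head G e) = s x * x $ i" for i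
  proof -
    have "x $ i = ((1 / s x) *\<^sub>R B x) $ i" by (simp only: x(2))
    then have "x $ i = (1 / s x) * B x $ i" by (simp only: vector_scaleR_component real_scaleR_def)
    then show ?thesis using pos[OF x(1)] by (simp add: B_def)
  qed
  have "0 < x $ i" for i
  proof -
    obtain j where j: "0 < x $ j" using support[OF x(1)] by blast
    obtain \<gamma> where \<gamma>: "\<gamma> \<in> walks G i n" "walk_end G i \<gamma> = j" using conn(2) by blast
    have "x $ j \<le> (\<Sum>\<gamma>\<in>walks G i n. x $ walk_end G i \<gamma>)"
      unfolding \<gamma>(2)[symmetric]
      by (rule member_le_sum[OF \<gamma>(1)]) (use x G finite_walks in \<open>auto simp: S_def\<close>)
    also have "\<dots> = s x ^ n * x $ i"
      by (rule sum_walks_eigenvector) (auto simp: eigen G)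
    finally have "0 < s x ^ n * x $ i" using j by linarith
    then show ?thesis by (rule zero_less_mult_pos) (simp add: pos[OF x(1)])
  qed
  then show ?thesis using eigen pos[OF x(1)] by (intro exI[of _ "\<lambda>i. x $ i"] exI[of _ "s x"]) simp
qed

text \<open>If \<open>l \<le> 1\<close>, the eigenvector equation for walks of length \<open>n\<close> bounds the sum of all weights by each
  single weight. Then there is only one vertex, and \<open>l\<close> is the number of its loops.\<close>

lemma perron_eigenvalue_gt_1:
  fixes G :: "('v::finite, 'e) pre_digraph"
  assumes G: "fin_digraph G" "verts G = UNIV"
    and conn: "\<And>i j. \<exists>\<gamma>\<in>walks G i n. walk_end G i \<gamma> = j"
    and v: "\<And>i. 0 < v i" "0 < l" "\<And>i. (\<Sum>e\<in>out_arcs G i. v (head G e)) = l * (v i :: real)"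
    and arcs: "2 \<le> card (arcs G)"
  shows "1 < l"
proof (rule ccontr)
  interpret fin_digraph G by (rule G(1))
  assume "\<not> 1 < l"
  fix j :: 'v
  have "(\<Sum>i\<in>UNIV. v i) = (\<Sum>i\<in>walk_end G j ` walks G j n. v i)"
  proof (rule sum.cong)
    show "UNIV = walk_end G j ` walks G j n"
    proof (intro equalityI subsetI)
      fix i
      obtain \<gamma> where "\<gamma> \<in> walks G j n" "walk_end G j \<gamma> = i" using conn by blast
      then show "i \<in> walk_end G j ` walks G j n" by blast
    qed simp
  qed simp
  also have "\<dots> \<le> (\<Sum>\<gamma>\<in>walks G j n. v (walk_end G j \<gamma>))"
    by (rule sum_image_le[unfolded o_def]) (use v finite_walks G in \<open>auto intro: less_imp_le\<close>)
  also have "\<dots> = l ^ n * v j" by (rule sum_walks_eigenvector) (auto simp: v G)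
  also have "\<dots> \<le> v j" using \<open>\<not> 1 < l\<close> v by (simp add: mult_le_cancel_right1 power_le_one less_imp_le)
  finally have le: "(\<Sum>i\<in>UNIV. v i) \<le> v j" .
  have single: "i = j" for i
  proof (rule ccontr)
    assume "i \<noteq> j"
    then have "v i + v j = (\<Sum>k\<in>{i, j}. v k)" by simp
    also have "\<dots> \<le> (\<Sum>i\<in>UNIV. v i)" using v(1) by (intro sum_mono2) (auto intro: less_imp_le)
    finally show False using le v(1)[of i] by simp
  qed
  have "out_arcs G j = arcs G" using single by auto
  then have "l * v j = (\<Sum>e\<in>arcs G. v (head G e))" using v(3)[of j] by simp
  also have "\<dots> = (\<Sum>e\<in>arcs G. v j)" by (intro sum.cong refl arg_cong[of _ _ v] single)
  finally have "l * v j = real (card (arcs G)) * v j" by simp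
  then have "l = real (card (arcs G))" using v(1)[of j] by simp
  then show False using arcs \<open>\<not> 1 < l\<close> by simp
qed

section \<open>The parametrization\<close>

text \<open>The eigenvector \<open>v\<close> gives the proportions of the masses of the sets \<open>E i\<close>, and each arc scales mass by
  \<open>1 / l\<close>.\<close>

locale weighted_linear_gifs = fin_digraph G
  for G :: "('v::finite, 'e) pre_digraph" +
  fixes A :: "real^'n^'n" and d :: "'e \<Rightarrow> real^'n" and prec :: "('e \<times> 'e) set"
    and E :: "'v \<Rightarrow> (real^'n) set" and v :: "'v \<Rightarrow> real" and l :: real
  assumes verts: "verts G = UNIV"
    and expanding: "expanding A"
    and invariant: "invariant_sets G (gifs_map A d) E"
    and linear: "linear_gifs G (gifs_map A d) prec E"
    and weight_pos: "\<And>i. 0 < v i"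
    and l_gt_1: "1 < l"
    and weight_eigen: "\<And>i. (\<Sum>e\<in>out_arcs G i. v (head G e)) = l * v i"
begin

abbreviation g :: "'e \<Rightarrow> real^'n \<Rightarrow> real^'n" where "g \<equiv> gifs_map A d"

abbreviation T :: "real^'n \<Rightarrow> real^'n" where "T \<equiv> (*v) (matrix_inv A)"

definition piece :: "'v \<Rightarrow> 'e list \<Rightarrow> (real^'n) set" where
  "piece i \<gamma> = foldr g \<gamma> ` E (walk_end G i \<gamma>)"

lemma walk_piece_eq: "\<gamma> \<noteq> [] \<Longrightarrow> walk_piece G g E \<gamma> = piece i \<gamma>"
  by (simp add: walk_piece_def piece_def walk_end_def)

lemma compact_E: "compact (E i)" and E_nonempty: "E i \<noteq> {}"
  using invariant unfolding invariant_sets_def verts by blast+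

lemma E_eq: "E i = (\<Union>e\<in>out_arcs G i. g e ` E (head G e))"
proof -
  have "E i = (\<Union>j\<in>verts G. \<Union>e\<in>arcs_from_to G i j. g e ` E j)"
    using invariant unfolding invariant_sets_def verts by blast
  also have "\<dots> = (\<Union>e\<in>out_arcs G i. g e ` E (head G e))"
    unfolding arcs_from_to_def verts out_arcs_def by blast
  finally show ?thesis .
qed

lemma g_in_E: "e \<in> out_arcs G i \<Longrightarrow> x \<in> E (head G e) \<Longrightarrow> g e x \<in> E i"
  by (subst E_eq) blast

lemma out_arcs_nonempty: "out_arcs G i \<noteq> {}"
  using E_eq[of i] E_nonempty[of i] by auto

lemma funpow_T_diff: "(T ^^ k) (x - y) = (T ^^ k) x - (T ^^ k) y"
  by (rule linear_diff) (rule bounded_linear.linear[OF bounded_linear_funpow_matrix])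

lemma funpow_T_add: "(T ^^ k) (x + y) = (T ^^ k) x + (T ^^ k) y"
  by (rule linear_add) (rule bounded_linear.linear[OF bounded_linear_funpow_matrix])

lemma foldr_g_diff: "foldr g \<gamma> x - foldr g \<gamma> y = (T ^^ length \<gamma>) (x - y)"
  by (induction \<gamma>)
    (simp_all add: gifs_map_def flip: matrix_vector_mult_diff_distrib)

lemma continuous_on_g: "continuous_on S (g e)"
  unfolding gifs_map_def
  by (intro continuous_on_compose2[OF matrix_vector_mult_linear_continuous_on[of UNIV "matrix_inv A"]]
      continuous_intros) auto

text \<open>The unit interval at a vertex \<open>i\<close> is divided into consecutive intervals, one for each arc \<open>e\<close> leaving
  \<open>i\<close>, in the order \<open>prec\<close> and with lengths proportional to \<open>v (head G e)\<close>. The affine maps \<open>\<tau> e\<close> onto these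
  intervals form a graph-directed system on the line with the same graph, whose invariant sets
  are all equal to \<open>{0..1}\<close>.\<close>

definition arc_length :: "'e \<Rightarrow> real" where
  "arc_length e = v (head G e) / (l * v (tail G e))"

definition arc_start :: "'e \<Rightarrow> real" where
  "arc_start e = (\<Sum>f | f \<in> out_arcs G (tail G e) \<and> (f, e) \<in> prec. arc_length f)"

definition \<tau> :: "'e \<Rightarrow> real \<Rightarrow> real" where
  "\<tau> e t = arc_start e + arc_length e * t"

lemma edge_order: "edge_order G prec"
  using linear by (simp add: linear_gifs_def)

lemma prec_trans: "(e, f) \<in> prec \<Longrightarrow> (f, h) \<in> prec \<Longrightarrow> (e, h) \<in> prec"
  and prec_irrefl: "(e, e) \<notin> prec"
  and prec_arcs: "(e, f) \<in> prec \<Longrightarrow> e \<in> arcs G \<and> f \<in> arcs G \<and> tail G e = tail G f"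
  and prec_total: "e \<in> out_arcs G i \<Longrightarrow> f \<in> out_arcs G i \<Longrightarrow> e \<noteq> f \<Longrightarrow> (e, f) \<in> prec \<or> (f, e) \<in> prec"
proof -
  have o: "prec \<subseteq> arcs G \<times> arcs G" "trans prec" "irrefl prec"
    "\<forall>i. total_on (out_arcs G i) prec" "\<forall>(e, f)\<in>prec. tail G e = tail G f"
    using edge_order unfolding edge_order_def verts by auto
  show "(e, f) \<in> prec \<Longrightarrow> (f, h) \<in> prec \<Longrightarrow> (e, h) \<in> prec" using o(2) by (rule transD)
  show "(e, e) \<notin> prec" using o(3) by (simp add: irrefl_def)
  show "(e, f) \<in> prec \<Longrightarrow> e \<in> arcs G \<and> f \<in> arcs G \<and> tail G e = tail G f" using o(1,5) by auto
  show "e \<in> out_arcs G i \<Longrightarrow> f \<in> out_arcs G i \<Longrightarrow> e \<noteq> f \<Longrightarrow> (e, f) \<in> prec \<or> (f, e) \<in> prec"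
    using o(4) by (simp add: total_on_def)
qed

lemma arc_length_pos: "0 < arc_length e"
  using weight_pos l_gt_1 by (simp add: arc_length_def)

lemma arc_start_nonneg: "0 \<le> arc_start e"
  unfolding arc_start_def by (intro sum_nonneg less_imp_le[OF arc_length_pos])

lemma sum_arc_length: "(\<Sum>e\<in>out_arcs G i. arc_length e) = 1"
proof -
  have "(\<Sum>e\<in>out_arcs G i. arc_length e) = (\<Sum>e\<in>out_arcs G i. v (head G e)) / (l * v i)"
    unfolding sum_divide_distrib by (intro sum.cong) (auto simp: arc_length_def)
  then show ?thesis using weight_eigen[of i] weight_pos[of i] l_gt_1 by simp
qed

lemma arc_start_add_length:
  assumes "e \<in> out_arcs G i"
  shows "arc_start e + arc_length e = (\<Sum>f | f \<in> out_arcs G i \<and> (f = e \<or> (f, e) \<in> prec). arc_length f)"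
proof -
  have "{f. f \<in> out_arcs G i \<and> (f = e \<or> (f, e) \<in> prec)} =
      insert e {f. f \<in> out_arcs G (tail G e) \<and> (f, e) \<in> prec}"
    using assms by auto
  then show ?thesis using prec_irrefl by (simp add: arc_start_def add.commute)
qed

lemma arc_end_le_1:
  assumes "e \<in> out_arcs G i"
  shows "arc_start e + arc_length e \<le> 1"
  unfolding arc_start_add_length[OF assms] sum_arc_length[of i, symmetric]
  by (intro sum_mono2) (auto intro: less_imp_le[OF arc_length_pos])

lemma arc_end_le_start:
  assumes "(e, f) \<in> prec"
  shows "arc_start e + arc_length e \<le> arc_start f"
proof -
  have e: "e \<in> out_arcs G (tail G f)" using prec_arcs[OF assms] by auto
  show ?thesis
    unfolding arc_start_add_length[OF e] unfolding arc_start_def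
    by (intro sum_mono2) (auto intro: less_imp_le[OF arc_length_pos] prec_trans assms)
qed

lemma tau_mono: "t \<le> u \<Longrightarrow> \<tau> e t \<le> \<tau> e u"
  using arc_length_pos[of e] by (simp add: \<tau>_def mult_left_mono)

lemma tau_in_unit: "e \<in> out_arcs G i \<Longrightarrow> t \<in> {0..1} \<Longrightarrow> \<tau> e t \<in> {0..1}"
proof -
  assume e: "e \<in> out_arcs G i" and t: "t \<in> {0..1}"
  have "arc_length e * t \<le> arc_length e" "0 \<le> arc_length e * t"
    using t arc_length_pos[of e] by (simp_all add: mult_left_le)
  then show ?thesis
    using arc_end_le_1[OF e] arc_start_nonneg[of e] unfolding \<tau>_def atLeastAtMost_iff by linarith
qed

text \<open>The last arc that starts at or before \<open>t\<close> is the right one: its interval ends where the next arc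
  starts, or at 1.\<close>

lemma unit_interval_covered:
  assumes t: "t \<in> {0..1}"
  shows "\<exists>e\<in>out_arcs G i. \<exists>u\<in>{0..1}. t = \<tau> e u"
proof -
  let ?O = "out_arcs G i"
  \<comment> \<open>Extremal arcs for the order are found as arcs with extremal starting point.\<close>
  have less: "arc_start e < arc_start f" if "(e, f) \<in> prec" for e f
    using arc_end_le_start[OF that] arc_length_pos[of e] by simp
  obtain e0 where e0: "e0 \<in> ?O" "\<And>f. f \<in> ?O \<Longrightarrow> arc_start e0 \<le> arc_start f"
    using ex_min_if_finite[of "arc_start ` ?O"] out_arcs_nonempty[of i]
    by (metis (no_types, lifting) finite_imageI finite_out_arcs image_iff image_is_empty not_le)
  have "arc_start e0 = 0"
  proof -
    have "{f. f \<in> out_arcs G (tail G e0) \<and> (f, e0) \<in> prec} = {}"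
      using e0 less by fastforce
    then show ?thesis unfolding arc_start_def by (simp only: sum.empty)
  qed
  then have ne: "{e \<in> ?O. arc_start e \<le> t} \<noteq> {}" using e0(1) t by auto
  have fin: "finite {e \<in> ?O. arc_start e \<le> t}" by simp
  obtain e where e: "e \<in> ?O" "arc_start e \<le> t"
      and e_max: "\<And>f. f \<in> ?O \<Longrightarrow> arc_start f \<le> t \<Longrightarrow> arc_start f \<le> arc_start e"
  proof -
    have "Max (arc_start ` {e \<in> ?O. arc_start e \<le> t}) \<in> arc_start ` {e \<in> ?O. arc_start e \<le> t}"
      using fin ne by (intro Max_in) auto
    then obtain e where "e \<in> ?O" "arc_start e \<le> t"
        "arc_start e = Max (arc_start ` {e \<in> ?O. arc_start e \<le> t})" by auto
    then show ?thesis using that[of e] fin by simp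
  qed
  have "t \<le> arc_start e + arc_length e"
  proof (cases "\<exists>f\<in>?O. (e, f) \<in> prec")
    case False
    then have "{f. f \<in> ?O \<and> (f = e \<or> (f, e) \<in> prec)} = ?O"
      using prec_total[OF _ e(1)] by blast
    then show ?thesis using arc_start_add_length[OF e(1)] sum_arc_length t by simp
  next
    case True
    let ?F = "{f \<in> ?O. (e, f) \<in> prec}"
    have "Min (arc_start ` ?F) \<in> arc_start ` ?F" using True by (intro Min_in) auto
    then obtain f where f: "f \<in> ?O" "(e, f) \<in> prec" "arc_start f = Min (arc_start ` ?F)" by auto
    have f_min: "arc_start f \<le> arc_start h" if "h \<in> ?O" "(e, h) \<in> prec" for h
      using f(3) that by simp
    have "{h. h \<in> ?O \<and> (h = e \<or> (h, e) \<in> prec)} = {h. h \<in> out_arcs G (tail G f) \<and> (h, f) \<in> prec}"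
    proof (intro equalityI subsetI)
      fix h assume "h \<in> {h. h \<in> ?O \<and> (h = e \<or> (h, e) \<in> prec)}"
      then show "h \<in> {h. h \<in> out_arcs G (tail G f) \<and> (h, f) \<in> prec}"
        using f prec_trans by auto
    next
      fix h assume "h \<in> {h. h \<in> out_arcs G (tail G f) \<and> (h, f) \<in> prec}"
      then have h: "h \<in> ?O" "(h, f) \<in> prec" using f(1) by auto
      then have "(e, h) \<notin> prec" using f_min[of h] less[of h f] by force
      then show "h \<in> {h. h \<in> ?O \<and> (h = e \<or> (h, e) \<in> prec)}"
        using h(1) prec_total[OF h(1) e(1)] by blast
    qed
    then have "arc_start e + arc_length e = arc_start f"
      unfolding arc_start_add_length[OF e(1)] unfolding arc_start_def by simp
    then show ?thesis using e_max[OF f(1)] arc_length_pos[of e] by force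
  qed
  then have "t = \<tau> e ((t - arc_start e) / arc_length e)" "(t - arc_start e) / arc_length e \<in> {0..1}"
    using e(2) arc_length_pos[of e] by (auto simp: \<tau>_def field_simps)
  then show ?thesis using e(1) by blast
qed

text \<open>The factors \<open>v (head G e) / (l * v (tail G e))\<close> telescope along a walk.\<close>

lemma foldr_tau_diff:
  "\<gamma> \<in> walks G i k \<Longrightarrow> foldr \<tau> \<gamma> t - foldr \<tau> \<gamma> u = v (walk_end G i \<gamma>) / (l ^ k * v i) * (t - u)"
proof (induction k arbitrary: \<gamma> i)
  case 0
  then show ?case using weight_pos[of i] by (simp add: walks_0 verts)
next
  case (Suc k)
  then obtain e \<omega> where \<gamma>: "\<gamma> = e # \<omega>" "e \<in> out_arcs G i" "\<omega> \<in> walks G (head G e) k"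
    unfolding walks_Suc by blast
  have "foldr \<tau> \<gamma> t - foldr \<tau> \<gamma> u = arc_length e * (foldr \<tau> \<omega> t - foldr \<tau> \<omega> u)"
    by (simp add: \<gamma>(1) \<tau>_def algebra_simps)
  also have "\<dots> = arc_length e * (v (walk_end G (head G e) \<omega>) / (l ^ k * v (head G e)) * (t - u))"
    by (simp add: Suc.IH[OF \<gamma>(3)])
  also have "\<dots> = v (walk_end G i \<gamma>) / (l ^ Suc k * v i) * (t - u)"
    using \<gamma>(2) weight_pos[of "head G e"] weight_pos[of i] l_gt_1
    by (simp add: \<gamma>(1) arc_length_def field_simps)
  finally show ?case .
qed

lemma foldr_tau_mono:
  assumes "\<gamma> \<in> walks G i k" "t \<le> u"
  shows "foldr \<tau> \<gamma> t \<le> foldr \<tau> \<gamma> u"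
proof -
  have "0 \<le> v (walk_end G i \<gamma>) / (l ^ k * v i) * (u - t)"
    using weight_pos[of i] weight_pos[of "walk_end G i \<gamma>"] l_gt_1 assms(2) by simp
  then show ?thesis using foldr_tau_diff[OF assms(1), of u t] by linarith
qed

lemma foldr_tau_in_unit: "\<gamma> \<in> walks G i k \<Longrightarrow> t \<in> {0..1} \<Longrightarrow> foldr \<tau> \<gamma> t \<in> {0..1}"
proof (induction k arbitrary: \<gamma> i)
  case 0
  then show ?case by (simp add: walks_0 verts)
next
  case (Suc k)
  then obtain e \<omega> where "\<gamma> = e # \<omega>" "e \<in> out_arcs G i" "\<omega> \<in> walks G (head G e) k"
    unfolding walks_Suc by blast
  then show ?case using Suc.IH Suc.prems(2) tau_in_unit[of e i "foldr \<tau> \<omega> t"] by simp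
qed

text \<open>The lexicographic order of walks is the order of their intervals on the line.\<close>

lemma foldr_tau_lex:
  "\<gamma> \<in> walks G i k \<Longrightarrow> \<omega> \<in> walks G i k \<Longrightarrow> (\<gamma>, \<omega>) \<in> lex prec \<Longrightarrow> foldr \<tau> \<gamma> 1 \<le> foldr \<tau> \<omega> 0"
proof (induction k arbitrary: \<gamma> \<omega> i)
  case 0
  then show ?case by (simp add: walks_0 verts)
next
  case (Suc k)
  obtain e \<gamma>' where \<gamma>: "\<gamma> = e # \<gamma>'" "e \<in> out_arcs G i" "\<gamma>' \<in> walks G (head G e) k"
    using Suc.prems(1) unfolding walks_Suc by blast
  obtain f \<omega>' where \<omega>: "\<omega> = f # \<omega>'" "f \<in> out_arcs G i" "\<omega>' \<in> walks G (head G f) k"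
    using Suc.prems(2) unfolding walks_Suc by blast
  have unit: "foldr \<tau> \<gamma>' 1 \<in> {0..1}" "foldr \<tau> \<omega>' 0 \<in> {0..1}"
    using foldr_tau_in_unit \<gamma>(3) \<omega>(3) by auto
  consider "(e, f) \<in> prec" | "e = f" "(\<gamma>', \<omega>') \<in> lex prec"
    using Suc.prems(3) \<gamma>(1) \<omega>(1) by auto
  then show ?case
  proof cases
    case 1
    have "\<tau> e (foldr \<tau> \<gamma>' 1) \<le> arc_start e + arc_length e"
      using unit(1) arc_length_pos[of e] by (simp add: \<tau>_def mult_left_le)
    also have "\<dots> \<le> arc_start f" by (rule arc_end_le_start[OF 1])
    also have "\<dots> \<le> \<tau> f (foldr \<tau> \<omega>' 0)" using unit(2) arc_length_pos[of f] by (simp add: \<tau>_def)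
    finally show ?thesis by (simp add: \<gamma>(1) \<omega>(1))
  next
    case 2
    then have "foldr \<tau> \<gamma>' 1 \<le> foldr \<tau> \<omega>' 0" using Suc.IH \<gamma>(3) \<omega>(3) by blast
    then show ?thesis using tau_mono by (simp add: \<gamma>(1) \<omega>(1) 2(1))
  qed
qed

lemma lex_total_on_walks:
  "\<gamma> \<in> walks G i k \<Longrightarrow> \<omega> \<in> walks G i k \<Longrightarrow> \<gamma> \<noteq> \<omega> \<Longrightarrow> (\<gamma>, \<omega>) \<in> lex prec \<or> (\<omega>, \<gamma>) \<in> lex prec"
proof (induction k arbitrary: \<gamma> \<omega> i)
  case 0
  then show ?case by (simp add: walks_0 verts)
next
  case (Suc k)
  obtain e \<gamma>' where \<gamma>: "\<gamma> = e # \<gamma>'" "e \<in> out_arcs G i" "\<gamma>' \<in> walks G (head G e) k"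
    using Suc.prems(1) unfolding walks_Suc by blast
  obtain f \<omega>' where \<omega>: "\<omega> = f # \<omega>'" "f \<in> out_arcs G i" "\<omega>' \<in> walks G (head G f) k"
    using Suc.prems(2) unfolding walks_Suc by blast
  have len: "length \<gamma>' = length \<omega>'" using length_walk[OF \<gamma>(3)] length_walk[OF \<omega>(3)] by simp
  show ?case
  proof (cases "e = f")
    case True
    then show ?thesis using Suc.IH[OF \<gamma>(3), of \<omega>'] \<omega>(3) Suc.prems(3) by (auto simp: \<gamma>(1) \<omega>(1))
  next
    case False
    then show ?thesis using prec_total[OF \<gamma>(2) \<omega>(2)] len by (auto simp: \<gamma>(1) \<omega>(1))
  qed
qed

text \<open>The graph of the parametrization is the intersection of the decreasing compact sets
  \<open>K k i\<close>, the unions of the boxes \<open>foldr \<tau> \<gamma> ` {0..1} \<times> piece i \<gamma>\<close> over the walks of length \<open>k\<close> from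
  \<open>i\<close>. This avoids infinite walks and the ambiguity of the codings of endpoints.\<close>

primrec K :: "nat \<Rightarrow> 'v \<Rightarrow> (real \<times> (real^'n)) set" where
  "K 0 i = {0..1} \<times> E i"
| "K (Suc k) i = (\<Union>e\<in>out_arcs G i. map_prod (\<tau> e) (g e) ` K k (head G e))"

lemma compact_K: "compact (K k i)"
proof (induction k arbitrary: i)
  case 0
  then show ?case by (simp add: compact_Times compact_E)
next
  case (Suc k)
  have "continuous_on S (map_prod (\<tau> e) (g e))" for S e
    unfolding map_prod_def case_prod_unfold \<tau>_def
    by (intro continuous_intros continuous_on_compose2[OF continuous_on_g[of UNIV]]) auto
  then show ?case by (auto intro!: compact_UN compact_continuous_image Suc)
qed

lemma K_Suc_subset: "K (Suc k) i \<subseteq> K k i"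
proof (induction k arbitrary: i)
  case 0
  show ?case using tau_in_unit g_in_E by (fastforce simp del: atLeastAtMost_iff)
next
  case (Suc k)
  then show ?case by (simp only: K.simps) blast
qed

lemma K_antimono: "m \<le> k \<Longrightarrow> K k i \<subseteq> K m i"
  by (rule lift_Suc_antimono_le[of "\<lambda>k. K k i"]) (rule K_Suc_subset)

lemma fst_K: "t \<in> {0..1} \<Longrightarrow> \<exists>x. (t, x) \<in> K k i"
proof (induction k arbitrary: i t)
  case 0
  then show ?case using E_nonempty[of i] by auto
next
  case (Suc k)
  obtain e u where e: "e \<in> out_arcs G i" "u \<in> {0..1}" "t = \<tau> e u"
    using unit_interval_covered[OF Suc.prems] by blast
  obtain x where "(u, x) \<in> K k (head G e)" using Suc.IH[OF e(2)] by blast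
  then have "map_prod (\<tau> e) (g e) (u, x) \<in> K (Suc k) i"
    using e(1) by (simp only: K.simps) blast
  then have "(t, g e x) \<in> K (Suc k) i" by (simp only: map_prod_simp e(3))
  then show ?case by blast
qed

lemma snd_K: "x \<in> E i \<Longrightarrow> \<exists>t. (t, x) \<in> K k i"
proof (induction k arbitrary: i x)
  case 0
  then show ?case by (auto intro: exI[of _ 0])
next
  case (Suc k)
  obtain e y where e: "e \<in> out_arcs G i" "y \<in> E (head G e)" "x = g e y"
    using Suc.prems E_eq[of i] by blast
  obtain t where "(t, y) \<in> K k (head G e)" using Suc.IH[OF e(2)] by blast
  then have "map_prod (\<tau> e) (g e) (t, y) \<in> K (Suc k) i"
    using e(1) by (simp only: K.simps) blast
  then have "(\<tau> e t, x) \<in> K (Suc k) i" by (simp only: map_prod_simp e(3))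
  then show ?case by blast
qed

lemma K_walk:
  "p \<in> K k i \<Longrightarrow> \<exists>\<gamma>\<in>walks G i k. fst p \<in> foldr \<tau> \<gamma> ` {0..1} \<and> snd p \<in> piece i \<gamma>"
proof (induction k arbitrary: i p)
  case 0
  then show ?case by (auto simp: walks_0 verts piece_def)
next
  case (Suc k)
  obtain e p' where e: "e \<in> out_arcs G i" "p' \<in> K k (head G e)" "p = map_prod (\<tau> e) (g e) p'"
    using Suc.prems by auto
  obtain \<gamma> where \<gamma>: "\<gamma> \<in> walks G (head G e) k" "fst p' \<in> foldr \<tau> \<gamma> ` {0..1}" "snd p' \<in> piece (head G e) \<gamma>"
    using Suc.IH[OF e(2)] by blast
  have "fst p \<in> foldr \<tau> (e # \<gamma>) ` {0..1}" using \<gamma>(2) e(3) by (auto simp del: atLeastAtMost_iff)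
  moreover have "snd p \<in> piece i (e # \<gamma>)" using \<gamma>(3) e(3) by (auto simp: piece_def)
  moreover have "e # \<gamma> \<in> walks G i (Suc k)" using e(1) \<gamma>(1) Cons_in_walks_iff by blast
  ultimately show ?case by blast
qed

text \<open>At level \<open>k\<close>, all walk intervals have lengths between \<open>min_ratio / l ^ k\<close> and \<open>1 / (min_ratio * l ^ k)\<close>.\<close>

definition min_ratio :: real where
  "min_ratio = Min (range v) / Max (range v)"

lemma min_ratio_pos: "0 < min_ratio" and min_ratio_le: "min_ratio \<le> v j / v i"
proof -
  have pos: "0 < Min (range v)" "0 < Max (range v)"
    using weight_pos by (auto simp: Max_gr_iff)
  then show "0 < min_ratio" by (simp add: min_ratio_def)
  show "min_ratio \<le> v j / v i"
    unfolding min_ratio_def using pos weight_pos[of i]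
    by (intro frac_le) (auto intro: less_imp_le[OF weight_pos])
qed

lemma walk_interval_length_ge:
  assumes "\<gamma> \<in> walks G i k"
  shows "min_ratio / l ^ k \<le> foldr \<tau> \<gamma> 1 - foldr \<tau> \<gamma> 0"
proof -
  have "min_ratio / l ^ k \<le> v (walk_end G i \<gamma>) / v i / l ^ k"
    using l_gt_1 min_ratio_le by (intro divide_right_mono) auto
  then show ?thesis using foldr_tau_diff[OF assms, of 1 0] by (simp add: field_simps)
qed

definition diam_bound :: real where
  "diam_bound = (SOME D. 0 < D \<and> (\<forall>i. \<forall>x\<in>E i. \<forall>y\<in>E i. norm (x - y) \<le> D))"

lemma diam_bound_pos: "0 < diam_bound"
  and diam_bound: "x \<in> E i \<Longrightarrow> y \<in> E i \<Longrightarrow> norm (x - y) \<le> diam_bound"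
proof -
  have "bounded (\<Union>i. E i)" by (intro bounded_UN ballI compact_imp_bounded compact_E) simp
  then obtain B where B: "\<And>i x. x \<in> E i \<Longrightarrow> norm x \<le> B" unfolding bounded_iff by blast
  have "norm (x - y) \<le> 2 * \<bar>B\<bar> + 1" if "x \<in> E i" "y \<in> E i" for i x y
    using norm_triangle_ineq4[of x y] B[OF that(1)] B[OF that(2)] by linarith
  then have "\<exists>D. 0 < D \<and> (\<forall>i. \<forall>x\<in>E i. \<forall>y\<in>E i. norm (x - y) \<le> D)"
    by (intro exI[of _ "2 * \<bar>B\<bar> + 1"]) auto
  from someI_ex[OF this]
  show "0 < diam_bound" "x \<in> E i \<Longrightarrow> y \<in> E i \<Longrightarrow> norm (x - y) \<le> diam_bound"
    by (auto simp: diam_bound_def)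
qed

text \<open>A walk strictly between \<open>\<gamma>\<close> and \<open>\<omega>\<close> would put an interval of length at least
  \<open>min_ratio / l ^ k\<close> between the two parameters. So the walks are equal or adjacent, and adjacent
  pieces meet.\<close>

lemma pieces_close:
  assumes \<gamma>: "\<gamma> \<in> walks G i k" "t \<in> foldr \<tau> \<gamma> ` {0..1}" "x \<in> piece i \<gamma>"
    and \<omega>: "\<omega> \<in> walks G i k" "u \<in> foldr \<tau> \<omega> ` {0..1}" "y \<in> piece i \<omega>"
    and close: "\<bar>t - u\<bar> < min_ratio / l ^ k"
  shows "\<exists>z. norm z \<le> 2 * diam_bound \<and> x - y = (T ^^ k) z"
proof -
  obtain x' where x': "x' \<in> E (walk_end G i \<gamma>)" "x = foldr g \<gamma> x'" using \<gamma>(3) by (auto simp: piece_def)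
  obtain y' where y': "y' \<in> E (walk_end G i \<omega>)" "y = foldr g \<omega> y'" using \<omega>(3) by (auto simp: piece_def)
  have bounds: "foldr \<tau> \<gamma> 0 \<le> t" "t \<le> foldr \<tau> \<gamma> 1" "foldr \<tau> \<omega> 0 \<le> u" "u \<le> foldr \<tau> \<omega> 1"
    using \<gamma>(1,2) \<omega>(1,2) foldr_tau_mono by auto
  show ?thesis
  proof (cases "\<gamma> = \<omega>")
    case True
    then have "x - y = (T ^^ k) (x' - y')"
      using x' y' length_walk[OF \<gamma>(1)] by (simp add: foldr_g_diff)
    moreover have "norm (x' - y') \<le> diam_bound" using x' y' True diam_bound by blast
    ultimately show ?thesis using diam_bound_pos by (intro exI[of _ "x' - y'"]) auto
  next
    case False
    have "k \<noteq> 0"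
    proof
      assume "k = 0"
      then have "\<gamma> = []" "\<omega> = []" using \<gamma>(1) \<omega>(1) by (simp_all add: walks_0 verts)
      then show False using False by simp
    qed
    have gap: "\<not> ((\<gamma>, \<eta>) \<in> lex prec \<and> (\<eta>, \<omega>) \<in> lex prec)" "\<not> ((\<omega>, \<eta>) \<in> lex prec \<and> (\<eta>, \<gamma>) \<in> lex prec)"
      if "\<eta> \<in> walks G i k" for \<eta>
      using foldr_tau_lex[OF \<gamma>(1) that] foldr_tau_lex[OF that \<omega>(1)] foldr_tau_lex[OF \<omega>(1) that]
        foldr_tau_lex[OF that \<gamma>(1)] walk_interval_length_ge[OF that] close bounds
      by linarith+
    then have "adjacent_walks G prec i k \<gamma> \<omega>"
      unfolding adjacent_walks_def using \<gamma>(1) \<omega>(1) False by blast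
    moreover have "1 \<le> k" using \<open>k \<noteq> 0\<close> by simp
    ultimately have "walk_piece G g E \<gamma> \<inter> walk_piece G g E \<omega> \<noteq> {}"
      using linear unfolding linear_gifs_def verts by blast
    moreover have "\<gamma> \<noteq> []" "\<omega> \<noteq> []" using length_walk[OF \<gamma>(1)] length_walk[OF \<omega>(1)] \<open>k \<noteq> 0\<close> by auto
    ultimately obtain p where "p \<in> piece i \<gamma>" "p \<in> piece i \<omega>"
      unfolding walk_piece_eq[OF \<open>\<gamma> \<noteq> []\<close>, of i] walk_piece_eq[OF \<open>\<omega> \<noteq> []\<close>, of i] by blast
    then obtain p1 p2 where p1: "p1 \<in> E (walk_end G i \<gamma>)" "p = foldr g \<gamma> p1"
      and p2: "p2 \<in> E (walk_end G i \<omega>)" "p = foldr g \<omega> p2"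
      by (auto simp: piece_def)
    have "x - y = (foldr g \<gamma> x' - foldr g \<gamma> p1) + (foldr g \<omega> p2 - foldr g \<omega> y')"
      using x' y' p1 p2 by simp
    also have "\<dots> = (T ^^ k) ((x' - p1) + (p2 - y'))"
      unfolding foldr_g_diff funpow_T_add length_walk[OF \<gamma>(1)] length_walk[OF \<omega>(1)] ..
    finally have "x - y = (T ^^ k) ((x' - p1) + (p2 - y'))" .
    moreover have "norm ((x' - p1) + (p2 - y')) \<le> 2 * diam_bound"
      using norm_triangle_ineq[of "x' - p1" "p2 - y'"] diam_bound[OF x'(1) p1(1)] diam_bound[OF p2(1) y'(1)]
      by linarith
    ultimately show ?thesis by blast
  qed
qed

lemma K_close:
  assumes "(t, x) \<in> K k i" "(u, y) \<in> K k i" "\<bar>t - u\<bar> < min_ratio / l ^ k"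
  shows "\<exists>z. norm z \<le> 2 * diam_bound \<and> x - y = (T ^^ k) z"
  using K_walk[OF assms(1)] K_walk[OF assms(2)] pieces_close[OF _ _ _ _ _ _ assms(3)]
  by (metis fst_conv snd_conv)

definition graph :: "'v \<Rightarrow> (real \<times> (real^'n)) set" where
  "graph i = (\<Inter>k. K k i)"

lemma onorm_T_small:
  assumes "0 < \<epsilon>"
  shows "\<exists>k. onorm (T ^^ k) * (2 * diam_bound) < \<epsilon>"
proof -
  have "(\<lambda>k. onorm (T ^^ k) * (2 * diam_bound)) \<longlonglongrightarrow> 0"
    using tendsto_mult_left_zero[OF expanding_inverse_powers_onorm[OF expanding]] .
  from LIMSEQ_D[OF this assms] show ?thesis
    by (metis abs_ge_self diff_zero le_less_trans order_refl real_norm_def)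
qed

lemma norm_funpow_T_le:
  assumes "norm z \<le> 2 * diam_bound"
  shows "norm ((T ^^ k) z) \<le> onorm (T ^^ k) * (2 * diam_bound)"
  by (rule order_trans[OF onorm[OF bounded_linear_funpow_matrix]])
    (intro mult_left_mono assms onorm_pos_le bounded_linear_funpow_matrix)

text \<open>This makes the graph that of a function and also gives its continuity.\<close>

lemma graph_close:
  assumes "0 < \<epsilon>"
  shows "\<exists>\<eta>>0. \<forall>t u x y. (t, x) \<in> graph i \<longrightarrow> (u, y) \<in> graph i \<longrightarrow> \<bar>t - u\<bar> < \<eta> \<longrightarrow> norm (x - y) < \<epsilon>"
proof -
  obtain k where k: "onorm (T ^^ k) * (2 * diam_bound) < \<epsilon>" using onorm_T_small[OF assms] by blast
  show ?thesis
  proof (intro exI[of _ "min_ratio / l ^ k"] conjI allI impI)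
    show "0 < min_ratio / l ^ k" using min_ratio_pos l_gt_1 by simp
    fix t u x y
    assume "(t, x) \<in> graph i" "(u, y) \<in> graph i" "\<bar>t - u\<bar> < min_ratio / l ^ k"
    then obtain z where "norm z \<le> 2 * diam_bound" "x - y = (T ^^ k) z"
      using K_close[of t x k i u y] by (auto simp: graph_def)
    then show "norm (x - y) < \<epsilon>" using norm_funpow_T_le[of z k] k by simp
  qed
qed

lemma graph_unique:
  assumes "(t, x) \<in> graph i" "(t, y) \<in> graph i"
  shows "x = y"
proof (rule ccontr)
  assume "x \<noteq> y"
  then obtain \<eta> where "0 < \<eta>" "\<forall>t u x' y'. (t, x') \<in> graph i \<longrightarrow> (u, y') \<in> graph i \<longrightarrow>
      \<bar>t - u\<bar> < \<eta> \<longrightarrow> norm (x' - y') < norm (x - y)"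
    using graph_close[of "norm (x - y)" i] by auto
  then show False using assms by force
qed

text \<open>The slices of the sets \<open>K k i\<close> at \<open>t\<close> are nonempty, compact and decreasing. The same argument with
  horizontal slices shows that the parametrization is onto.\<close>

lemma fst_graph:
  assumes "t \<in> {0..1}"
  shows "\<exists>x. (t, x) \<in> graph i"
proof -
  have "\<Inter> (range (\<lambda>k. K k i \<inter> {t} \<times> UNIV)) \<noteq> {}"
  proof (rule compact_nest)
    show "compact (K k i \<inter> {t} \<times> UNIV)" for k
      by (intro compact_Int_closed compact_K closed_Times) auto
    show "K k i \<inter> {t} \<times> UNIV \<noteq> {}" for k using fst_K[OF assms, of k i] by auto
    show "K k i \<inter> {t} \<times> UNIV \<subseteq> K m i \<inter> {t} \<times> UNIV" if "m \<le> k" for m k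
      using K_antimono[OF that, of i] by blast
  qed
  then show ?thesis by (auto simp: graph_def)
qed

lemma snd_graph:
  assumes "x \<in> E i"
  shows "\<exists>t. (t, x) \<in> graph i"
proof -
  have "\<Inter> (range (\<lambda>k. K k i \<inter> UNIV \<times> {x})) \<noteq> {}"
  proof (rule compact_nest)
    show "compact (K k i \<inter> UNIV \<times> {x})" for k
      by (intro compact_Int_closed compact_K closed_Times) auto
    show "K k i \<inter> UNIV \<times> {x} \<noteq> {}" for k using snd_K[OF assms, of k] by auto
    show "K k i \<inter> UNIV \<times> {x} \<subseteq> K m i \<inter> UNIV \<times> {x}" if "m \<le> k" for m k
      using K_antimono[OF that, of i] by blast
  qed
  then show ?thesis by (auto simp: graph_def)
qed

lemma graph_subset: "graph i \<subseteq> {0..1} \<times> E i"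
  unfolding graph_def using INT_lower[of 0 UNIV "\<lambda>k. K k i"] by simp

lemma map_prod_graph:
  assumes e: "e \<in> out_arcs G i" and p: "(t, x) \<in> graph (head G e)"
  shows "(\<tau> e t, g e x) \<in> graph i"
proof -
  have Suc: "(\<tau> e t, g e x) \<in> K (Suc k) i" for k
  proof -
    have "(t, x) \<in> K k (head G e)" using p by (simp add: graph_def)
    then have "map_prod (\<tau> e) (g e) (t, x) \<in> K (Suc k) i" using e by (simp only: K.simps) blast
    then show ?thesis by (simp only: map_prod_simp)
  qed
  have "(\<tau> e t, g e x) \<in> K k i" for k by (rule subsetD[OF K_Suc_subset Suc])
  then show ?thesis by (simp add: graph_def)
qed

definition \<psi> :: "'v \<Rightarrow> real \<Rightarrow> real^'n" where
  "\<psi> i t = (THE x. (t, x) \<in> graph i)"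

lemma psi_eqI: "(t, x) \<in> graph i \<Longrightarrow> \<psi> i t = x"
  unfolding \<psi>_def using graph_unique by blast

lemma psi_in_graph: "t \<in> {0..1} \<Longrightarrow> (t, \<psi> i t) \<in> graph i"
  using fst_graph psi_eqI by metis

lemma parametrization_psi: "parametrization (\<psi> i) (E i)"
  unfolding parametrization_def
proof
  show "continuous_on {0..1} (\<psi> i)"
  proof (unfold continuous_on_iff, intro ballI allI impI)
    fix t \<epsilon> :: real assume "t \<in> {0..1}" "0 < \<epsilon>"
    then show "\<exists>\<eta>>0. \<forall>u\<in>{0..1}. dist u t < \<eta> \<longrightarrow> dist (\<psi> i u) (\<psi> i t) < \<epsilon>"
      using graph_close[of \<epsilon> i] psi_in_graph unfolding dist_norm real_norm_def by metis
  qed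
  show "\<psi> i ` {0..1} = E i"
  proof (intro equalityI subsetI)
    fix x assume "x \<in> \<psi> i ` {0..1}"
    then show "x \<in> E i" using psi_in_graph graph_subset by blast
  next
    fix x assume "x \<in> E i"
    then obtain t where t: "(t, x) \<in> graph i" using snd_graph by blast
    then have "t \<in> {0..1}" using graph_subset by blast
    then show "x \<in> \<psi> i ` {0..1}" using psi_eqI[OF t] by blast
  qed
qed

lemma psi_tau: "e \<in> out_arcs G i \<Longrightarrow> t \<in> {0..1} \<Longrightarrow> \<psi> i (\<tau> e t) = g e (\<psi> (head G e) t)"
  by (rule psi_eqI[OF map_prod_graph[OF _ psi_in_graph]])

lemma psi_foldr_tau:
  "\<gamma> \<in> walks G i k \<Longrightarrow> t \<in> {0..1} \<Longrightarrow> \<psi> i (foldr \<tau> \<gamma> t) = foldr g \<gamma> (\<psi> (walk_end G i \<gamma>) t)"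
proof (induction k arbitrary: \<gamma> i)
  case 0
  then show ?case by (simp add: walks_0 verts)
next
  case (Suc k)
  then obtain e \<omega> where \<gamma>: "\<gamma> = e # \<omega>" "e \<in> out_arcs G i" "\<omega> \<in> walks G (head G e) k"
    unfolding walks_Suc by blast
  show ?case
    using Suc.IH[OF \<gamma>(3) Suc.prems(2)] psi_tau[OF \<gamma>(2) foldr_tau_in_unit[OF \<gamma>(3) Suc.prems(2)]]
    by (simp add: \<gamma>(1))
qed

lemma psi_walk_interval:
  assumes "\<gamma> \<in> walks G i k"
  shows "\<psi> i ` foldr \<tau> \<gamma> ` {0..1} = piece i \<gamma>"
proof -
  have "\<psi> i ` foldr \<tau> \<gamma> ` {0..1} = foldr g \<gamma> ` \<psi> (walk_end G i \<gamma>) ` {0..1}"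
    unfolding image_image using psi_foldr_tau[OF assms] by (rule image_cong[OF refl])
  then show ?thesis
    using parametrization_psi[of "walk_end G i \<gamma>"] by (simp add: parametrization_def piece_def)
qed

lemma walk_intervals_cover:
  assumes "t \<in> {0..1}"
  shows "\<exists>\<gamma>\<in>walks G i k. t \<in> foldr \<tau> \<gamma> ` {0..1}"
proof -
  obtain x where "(t, x) \<in> K k i" using fst_K[OF assms] by blast
  from K_walk[OF this] show ?thesis unfolding fst_conv by blast
qed

lemma pieces_cover: "E i \<subseteq> (\<Union>\<gamma>\<in>walks G i k. piece i \<gamma>)"
proof
  fix x assume "x \<in> E i"
  then obtain t where "(t, x) \<in> K k i" using snd_K by blast
  from K_walk[OF this] show "x \<in> (\<Union>\<gamma>\<in>walks G i k. piece i \<gamma>)" unfolding snd_conv by blast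
qed

end

section \<open>Finiteness and positivity of the Hausdorff measure\<close>

text \<open>A ball of radius \<open>\<rho> / 2\<close> contains at most one point of a \<open>\<rho>\<close>-separated set.\<close>

lemma separated_subsets_bounded_card:
  fixes R \<rho> :: real
  assumes "0 < \<rho>"
  shows "\<exists>N. \<forall>S :: 'a::euclidean_space set. S \<subseteq> cball 0 R \<longrightarrow>
    (\<forall>x\<in>S. \<forall>y\<in>S. x \<noteq> y \<longrightarrow> \<rho> \<le> dist x y) \<longrightarrow> finite S \<and> card S \<le> N"
proof -
  have "cball (0::'a) R \<subseteq> (\<Union>x\<in>cball 0 R. ball x (\<rho>/2))" using assms by auto
  then obtain F where F: "finite F" "cball (0::'a) R \<subseteq> (\<Union>x\<in>F. ball x (\<rho>/2))"
    using compactE_image[OF compact_cball, of "cball 0 R" "\<lambda>x. ball x (\<rho>/2)"] open_ball by metis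
  have "finite S \<and> card S \<le> card F"
    if S: "S \<subseteq> cball 0 R" "\<forall>x\<in>S. \<forall>y\<in>S. x \<noteq> y \<longrightarrow> \<rho> \<le> dist x y" for S :: "'a set"
  proof -
    have "\<forall>x\<in>S. \<exists>c\<in>F. dist c x < \<rho> / 2" using S(1) F(2) by fastforce
    then obtain c where c: "\<And>x. x \<in> S \<Longrightarrow> c x \<in> F" "\<And>x. x \<in> S \<Longrightarrow> dist (c x) x < \<rho> / 2" by metis
    have "inj_on c S"
    proof (rule inj_onI, rule ccontr)
      fix x y assume xy: "x \<in> S" "y \<in> S" "c x = c y" "x \<noteq> y"
      then have "dist x y < \<rho>"
        using dist_triangle3[of x y "c x"] c(2)[of x] c(2)[of y] by simp
      then show False using S(2) xy by force
    qed
    moreover have "c ` S \<subseteq> F" using c(1) by blast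
    ultimately show ?thesis using F(1) by (meson card_inj_on_le inj_on_finite)
  qed
  then show ?thesis by blast
qed

text \<open>A gauge \<open>w\<close> that is homogeneous for \<open>A\<inverse>\<close> and comparable with the norm at unit scale. Since
  \<open>\<kappa> powr \<alpha> = 1 / l\<close>, the maps \<open>g e\<close> scale the \<open>\<alpha>\<close>-dimensional Hausdorff measure by \<open>1 / l\<close>, the factor by which
  mass is distributed along arcs.\<close>

locale weighted_linear_gifs_gauge = weighted_linear_gifs G A d prec E v l
  for G :: "('v::finite, 'e) pre_digraph" and A :: "real^'n^'n" and d prec E v l +
  fixes w :: "real^'n \<Rightarrow> real" and \<kappa> \<alpha> :: real and n :: nat
  assumes gauge_T: "\<And>x. w (matrix_inv A *v x) = \<kappa> * w x"
    and gauge_bounded: "\<And>R. \<exists>C. \<forall>x. norm x \<le> R \<longrightarrow> w x \<le> C"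
    and gauge_sublevel: "\<exists>R. \<forall>x. w x \<le> 1 \<longrightarrow> norm x \<le> R"
    and \<kappa>_pos: "0 < \<kappa>" and \<alpha>_pos: "0 < \<alpha>" and \<kappa>_\<alpha>: "\<kappa> powr \<alpha> = 1 / l"
    and osc: "open_set_condition G (gifs_map A d)"
    and connected: "\<And>i j. \<exists>\<gamma>\<in>walks G i n. walk_end G i \<gamma> = j"
begin

abbreviation H :: "(real^'n) set \<Rightarrow> ennreal" where "H \<equiv> hausdorff_outer w \<alpha>"

lemma \<kappa>_less_1: "\<kappa> < 1"
proof (rule ccontr)
  assume "\<not> \<kappa> < 1"
  then have "1 \<le> \<kappa> powr \<alpha>" using \<alpha>_pos by (intro ge_one_powr_ge_zero) auto
  then show False using \<kappa>_\<alpha> l_gt_1 by (simp add: field_simps)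
qed

lemma \<kappa>_power_powr: "(\<kappa> ^ k) powr \<alpha> = 1 / l ^ k"
proof -
  have "(\<kappa> ^ k) powr \<alpha> = (\<kappa> powr \<alpha>) ^ k"
    using \<kappa>_pos by (simp add: powr_powr mult.commute flip: powr_realpow)
  then show ?thesis using \<kappa>_\<alpha> by (simp add: power_one_over)
qed

lemma gauge_funpow_T: "w ((T ^^ k) z) = \<kappa> ^ k * w z"
  by (induction k) (simp_all add: gauge_T)

lemma gauge_bounded_pos: "\<exists>C>0. \<forall>x. norm x \<le> R \<longrightarrow> w x \<le> C"
proof -
  obtain C where "\<forall>x. norm x \<le> R \<longrightarrow> w x \<le> C" using gauge_bounded by blast
  then show ?thesis by (intro exI[of _ "max C 1"]) (auto simp: le_max_iff_disj)
qed

text \<open>Parameters at distance about \<open>min_ratio / l ^ k\<close> have values that differ by the \<open>k\<close>-th power of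
  \<open>A\<inverse>\<close> applied to a bounded vector, and \<open>\<kappa> ^ k = (1 / l ^ k) powr (1 / \<alpha>)\<close>.\<close>

lemma psi_hoelder:
  "\<exists>c>0. \<forall>t\<in>{0..1}. \<forall>u\<in>{0..1}. w (\<psi> i t - \<psi> i u) \<le> c * \<bar>t - u\<bar> powr (1 / \<alpha>)"
proof -
  obtain C where C: "0 < C" "\<And>x. norm x \<le> 2 * diam_bound \<Longrightarrow> w x \<le> C"
    using gauge_bounded_pos by blast
  define c where "c = C * (l / min_ratio) powr (1 / \<alpha>)"
  have "w (\<psi> i t - \<psi> i u) \<le> c * \<bar>t - u\<bar> powr (1 / \<alpha>)" if tu: "t \<in> {0..1}" "u \<in> {0..1}" for t u
  proof (cases "t = u")
    case True
    have "w 0 = \<kappa> * w 0" using gauge_T[of 0] by simp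
    then have "(1 - \<kappa>) * w 0 = 0" by (simp add: algebra_simps)
    then show ?thesis using True \<kappa>_less_1 by simp
  next
    case False
    define \<delta> where "\<delta> = \<bar>t - u\<bar>"
    have \<delta>: "0 < \<delta>" using False by (simp add: \<delta>_def)
    obtain m where m: "min_ratio / \<delta> < l ^ m" using real_arch_pow[OF l_gt_1] by blast
    have "min_ratio < \<delta> * l ^ m" using m \<delta> by (simp add: field_simps)
    also have "\<dots> \<le> \<delta> * l ^ Suc m" using \<delta> l_gt_1 by (intro mult_left_mono) auto
    finally have "min_ratio / l ^ Suc m \<le> \<delta>" using l_gt_1 by (simp add: field_simps)
    then obtain k where k: "min_ratio / l ^ Suc k \<le> \<delta>" "\<And>j. j < k \<Longrightarrow> \<not> min_ratio / l ^ Suc j \<le> \<delta>"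
      using exists_least_iff[of "\<lambda>k. min_ratio / l ^ Suc k \<le> \<delta>"] by blast
    have mem: "(t, \<psi> i t) \<in> K k i" "(u, \<psi> i u) \<in> K k i"
      using psi_in_graph tu by (auto simp: graph_def)
    have "\<exists>z. norm z \<le> 2 * diam_bound \<and> \<psi> i t - \<psi> i u = (T ^^ k) z"
    proof (cases k)
      case 0
      have "\<psi> i t \<in> E i" "\<psi> i u \<in> E i" using psi_in_graph graph_subset tu by blast+
      then have "norm (\<psi> i t - \<psi> i u) \<le> 2 * diam_bound"
        using diam_bound[of "\<psi> i t" i "\<psi> i u"] diam_bound_pos by linarith
      then show ?thesis using 0 by (intro exI[of _ "\<psi> i t - \<psi> i u"]) simp
    next
      case (Suc j)
      then have "\<bar>t - u\<bar> < min_ratio / l ^ k" using k(2)[of j] by (simp add: \<delta>_def)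
      then show ?thesis by (rule K_close[OF mem])
    qed
    then obtain z where z: "norm z \<le> 2 * diam_bound" "\<psi> i t - \<psi> i u = (T ^^ k) z" by blast
    have "\<kappa> ^ k = ((\<kappa> ^ k) powr \<alpha>) powr (1 / \<alpha>)" using \<kappa>_pos \<alpha>_pos by (simp add: powr_powr)
    also have "\<dots> = (1 / l ^ k) powr (1 / \<alpha>)" by (simp only: \<kappa>_power_powr)
    also have "\<dots> \<le> (l / min_ratio * \<delta>) powr (1 / \<alpha>)"
    proof (rule powr_mono2)
      show "1 / l ^ k \<le> l / min_ratio * \<delta>"
        using k(1) l_gt_1 min_ratio_pos by (simp add: field_simps)
    qed (use \<alpha>_pos l_gt_1 in auto)
    also have "\<dots> = (l / min_ratio) powr (1 / \<alpha>) * \<delta> powr (1 / \<alpha>)"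
      by (rule powr_mult)
    finally have "\<kappa> ^ k * C \<le> ((l / min_ratio) powr (1 / \<alpha>) * \<delta> powr (1 / \<alpha>)) * C"
      using C(1) by (intro mult_right_mono) auto
    moreover have "\<kappa> ^ k * w z \<le> \<kappa> ^ k * C" using C(2)[OF z(1)] \<kappa>_pos by (intro mult_left_mono) auto
    ultimately show ?thesis unfolding z(2) gauge_funpow_T by (simp add: c_def \<delta>_def mult_ac)
  qed
  moreover have "0 < c" using C(1) l_gt_1 min_ratio_pos by (simp add: c_def)
  ultimately show ?thesis by blast
qed

lemma wdiam_piece_le:
  assumes C: "\<And>x. norm x \<le> diam_bound \<Longrightarrow> w x \<le> C" and \<gamma>: "\<gamma> \<in> walks G i k"
  shows "wdiam w (piece i \<gamma>) \<le> ennreal (\<kappa> ^ k * C)"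
  unfolding wdiam_le_iff
proof (intro ballI)
  fix x y assume "x \<in> piece i \<gamma>" "y \<in> piece i \<gamma>"
  then obtain x' y' where xy: "x' \<in> E (walk_end G i \<gamma>)" "y' \<in> E (walk_end G i \<gamma>)"
      "x = foldr g \<gamma> x'" "y = foldr g \<gamma> y'"
    by (auto simp: piece_def)
  have "w (x - y) = \<kappa> ^ k * w (x' - y')"
    unfolding xy(3,4) foldr_g_diff gauge_funpow_T length_walk[OF \<gamma>] ..
  also have "\<dots> \<le> \<kappa> ^ k * C" using C diam_bound[OF xy(1,2)] \<kappa>_pos by (intro mult_left_mono) auto
  finally show "ennreal (w (x - y)) \<le> ennreal (\<kappa> ^ k * C)" by (rule ennreal_leI)
qed

text \<open>There are at most \<open>l ^ k / min_ratio\<close> pieces at level \<open>k\<close>, each of diameter of order \<open>\<kappa> ^ k\<close>, and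
  \<open>(\<kappa> ^ k) powr \<alpha> = 1 / l ^ k\<close>.\<close>

lemma H_E_finite: "H (E i) < top"
proof -
  obtain C where C: "0 < C" "\<And>x. norm x \<le> diam_bound \<Longrightarrow> w x \<le> C" using gauge_bounded_pos by blast
  define B where "B = C powr \<alpha> * (1 / min_ratio)"
  have "H (E i) \<le> ennreal B"
  proof (rule hausdorff_outer_leI)
    fix \<delta> :: real assume \<delta>: "0 < \<delta>"
    have "(\<lambda>k. \<kappa> ^ k * C) \<longlonglongrightarrow> 0"
      using \<kappa>_pos \<kappa>_less_1 by (intro tendsto_mult_left_zero LIMSEQ_realpow_zero) auto
    from LIMSEQ_D[OF this \<delta>] obtain k where "\<bar>\<kappa> ^ k * C\<bar> < \<delta>" by (metis diff_zero order_refl real_norm_def)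
    then have k: "\<kappa> ^ k * C \<le> \<delta>" by linarith
    have diam: "wdiam w (piece i \<gamma>) \<le> ennreal (\<kappa> ^ k * C)" if "\<gamma> \<in> walks G i k" for \<gamma>
      by (rule wdiam_piece_le[OF C(2) that])
    have "hausdorff_pre w \<alpha> \<delta> (E i) \<le> (\<Sum>\<gamma>\<in>walks G i k. wdiam_power w \<alpha> (piece i \<gamma>))"
      by (rule hausdorff_pre_le_finite_cover[OF _ pieces_cover])
        (auto simp: finite_walks verts intro: order_trans[OF diam ennreal_leI[OF k]])
    also have "\<dots> \<le> (\<Sum>\<gamma>\<in>walks G i k. ennreal ((\<kappa> ^ k * C) powr \<alpha>))"
      using \<alpha>_pos \<kappa>_pos C(1) by (intro sum_mono wdiam_power_le diam) auto
    also have "\<dots> = ennreal (\<Sum>\<gamma>\<in>walks G i k. (\<kappa> ^ k * C) powr \<alpha>)" by (rule sum_ennreal) simp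
    also have "(\<Sum>\<gamma>\<in>walks G i k. (\<kappa> ^ k * C) powr \<alpha>) \<le> B"
    proof -
      have "(\<Sum>\<gamma>\<in>walks G i k. min_ratio) \<le> (\<Sum>\<gamma>\<in>walks G i k. v (walk_end G i \<gamma>) / v i)"
        by (intro sum_mono min_ratio_le)
      also have "\<dots> = l ^ k"
        unfolding sum_divide_distrib[symmetric]
        using sum_walks_eigenvector[of v l i k] weight_eigen weight_pos[of i] by (simp add: verts)
      finally have "real (card (walks G i k)) \<le> l ^ k / min_ratio"
        using min_ratio_pos by (simp add: field_simps)
      then have "real (card (walks G i k)) * (1 / l ^ k * C powr \<alpha>) \<le> l ^ k / min_ratio * (1 / l ^ k * C powr \<alpha>)"
        using l_gt_1 by (intro mult_right_mono) auto
      also have "\<dots> = B" using l_gt_1 by (simp add: B_def field_simps)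
      finally show ?thesis
        using \<kappa>_pos C(1) \<kappa>_power_powr[of k] by (simp add: powr_mult)
    qed
    finally show "hausdorff_pre w \<alpha> \<delta> (E i) \<le> ennreal B" by (simp add: ennreal_leI)
  qed
  then show ?thesis using ennreal_less_top le_less_trans by blast
qed

lemma inj_g: "inj (g e)"
proof (rule injI)
  fix x y assume "g e x = g e y"
  then have "A *v (matrix_inv A *v (x + d e)) = A *v (matrix_inv A *v (y + d e))"
    by (simp add: gifs_map_def)
  then show "x = y"
    unfolding matrix_vector_mul_assoc matrix_inv_mult[OF expanding_invertible[OF expanding]] by simp
qed

lemma walks_open_set_condition:
  assumes sub: "\<And>i e. e \<in> out_arcs G i \<Longrightarrow> g e ` U (head G e) \<subseteq> U i"
    and disj: "\<And>i. disjoint_family_on (\<lambda>e. g e ` U (head G e)) (out_arcs G i)"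
  shows "\<gamma> \<in> walks G i k \<Longrightarrow> foldr g \<gamma> ` U (walk_end G i \<gamma>) \<subseteq> U i"
    and "\<gamma> \<in> walks G i k \<Longrightarrow> \<omega> \<in> walks G i k \<Longrightarrow> \<gamma> \<noteq> \<omega> \<Longrightarrow>
      foldr g \<gamma> ` U (walk_end G i \<gamma>) \<inter> foldr g \<omega> ` U (walk_end G i \<omega>) = {}"
proof -
  show sub': "foldr g \<gamma> ` U (walk_end G i \<gamma>) \<subseteq> U i" if "\<gamma> \<in> walks G i k" for \<gamma> i k
    using that
  proof (induction k arbitrary: \<gamma> i)
    case 0
    then show ?case by (auto simp: walks_0 verts)
  next
    case (Suc k)
    then obtain e \<omega> where \<gamma>: "\<gamma> = e # \<omega>" "e \<in> out_arcs G i" "\<omega> \<in> walks G (head G e) k"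
      unfolding walks_Suc by blast
    show ?case using Suc.IH[OF \<gamma>(3)] sub[OF \<gamma>(2)] by (fastforce simp: \<gamma>(1))
  qed
  show "\<gamma> \<in> walks G i k \<Longrightarrow> \<omega> \<in> walks G i k \<Longrightarrow> \<gamma> \<noteq> \<omega> \<Longrightarrow>
      foldr g \<gamma> ` U (walk_end G i \<gamma>) \<inter> foldr g \<omega> ` U (walk_end G i \<omega>) = {}"
  proof (induction k arbitrary: \<gamma> \<omega> i)
    case 0
    then show ?case by (simp add: walks_0 verts)
  next
    case (Suc k)
    obtain e \<gamma>' where \<gamma>: "\<gamma> = e # \<gamma>'" "e \<in> out_arcs G i" "\<gamma>' \<in> walks G (head G e) k"
      using Suc.prems(1) unfolding walks_Suc by blast
    obtain f \<omega>' where \<omega>: "\<omega> = f # \<omega>'" "f \<in> out_arcs G i" "\<omega>' \<in> walks G (head G f) k"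
      using Suc.prems(2) unfolding walks_Suc by blast
    let ?X = "foldr g \<gamma>' ` U (walk_end G (head G e) \<gamma>')"
    let ?Y = "foldr g \<omega>' ` U (walk_end G (head G f) \<omega>')"
    have eq: "foldr g \<gamma> ` U (walk_end G i \<gamma>) = g e ` ?X" "foldr g \<omega> ` U (walk_end G i \<omega>) = g f ` ?Y"
      by (simp_all add: \<gamma>(1) \<omega>(1) image_comp)
    show ?case
    proof (cases "e = f")
      case True
      then have "?X \<inter> ?Y = {}" using Suc.IH[OF \<gamma>(3), of \<omega>'] \<omega>(3) Suc.prems(3) \<gamma>(1) \<omega>(1) by auto
      then show ?thesis unfolding eq True image_Int[OF inj_g, symmetric] by simp
    next
      case False
      have "g e ` U (head G e) \<inter> g f ` U (head G f) = {}"
        using disj[of i] False \<gamma>(2) \<omega>(2) by (auto simp: disjoint_family_on_def)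
      then show ?thesis using sub'[OF \<gamma>(3)] sub'[OF \<omega>(3)] unfolding eq by blast
    qed
  qed
qed

text \<open>After rescaling by \<open>A ^ k\<close>, the pieces that meet a set of gauge diameter at most \<open>\<kappa> ^ k\<close> yield
  points in a fixed bounded region; by the open set condition these points are uniformly
  separated.\<close>

lemma bounded_overlap:
  "\<exists>N. \<forall>k i C. (\<forall>x\<in>C. \<forall>y\<in>C. w (x - y) \<le> \<kappa> ^ k) \<longrightarrow>
     card {\<gamma> \<in> walks G i k. piece i \<gamma> \<inter> C \<noteq> {}} \<le> N"
proof -
  obtain U where osc_U: "\<forall>i\<in>verts G. open (U i) \<and> U i \<noteq> {} \<and>
      (\<Union>j\<in>verts G. \<Union>e\<in>arcs_from_to G i j. g e ` U j) \<subseteq> U i \<and>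
      disjoint_family_on (\<lambda>e. g e ` U (head G e)) (out_arcs G i)"
    using osc unfolding open_set_condition_def by (rule exE)
  have all: "i \<in> verts G" for i by (simp add: verts)
  note osc_U' = bspec[OF osc_U all]
  have U: "open (U i)" "U i \<noteq> {}" "(\<Union>j\<in>verts G. \<Union>e\<in>arcs_from_to G i j. g e ` U j) \<subseteq> U i"
      "disjoint_family_on (\<lambda>e. g e ` U (head G e)) (out_arcs G i)" for i
    using conjunct1[OF osc_U'[of i]] conjunct1[OF conjunct2[OF osc_U'[of i]]]
      conjunct1[OF conjunct2[OF conjunct2[OF osc_U'[of i]]]]
      conjunct2[OF conjunct2[OF conjunct2[OF osc_U'[of i]]]] by - assumption+
  have sub: "g e ` U (head G e) \<subseteq> U i" if "e \<in> out_arcs G i" for e i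
  proof -
    have "e \<in> arcs_from_to G i (head G e)" using that by (simp add: arcs_from_to_def)
    then have "g e ` U (head G e) \<subseteq> (\<Union>j\<in>verts G. \<Union>e\<in>arcs_from_to G i j. g e ` U j)"
      using all by blast
    then show ?thesis using U(3)[of i] by (rule subset_trans)
  qed
  note walks_U = walks_open_set_condition(2)[of U, OF sub U(4)]
  have "\<forall>i. \<exists>p r. 0 < r \<and> ball p r \<subseteq> U i"
    using U(1,2) by (metis ex_in_conv openE)
  then obtain p r where pr: "\<And>i. 0 < r i" "\<And>i. ball (p i) (r i) \<subseteq> U i" by metis
  define \<rho> where "\<rho> = Min (range r)"
  have \<rho>: "0 < \<rho>" "\<And>i. \<rho> \<le> r i" using pr(1) by (auto simp: \<rho>_def)
  have "bounded ((\<Union>i. E i) \<union> range p)"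
    by (intro bounded_Un[THEN iffD2] conjI bounded_UN ballI compact_imp_bounded compact_E finite_imp_bounded) auto
  then obtain B where B: "\<And>i x. x \<in> E i \<Longrightarrow> norm x \<le> B" "\<And>i. norm (p i) \<le> B"
    unfolding bounded_iff by blast
  obtain R where R: "\<And>x. w x \<le> 1 \<Longrightarrow> norm x \<le> R" using gauge_sublevel by blast
  obtain N where N: "\<And>S :: (real^'n) set. S \<subseteq> cball 0 (R + 2 * B) \<Longrightarrow>
      (\<forall>x\<in>S. \<forall>y\<in>S. x \<noteq> y \<longrightarrow> \<rho> \<le> dist x y) \<Longrightarrow> finite S \<and> card S \<le> N"
    using separated_subsets_bounded_card[OF \<rho>(1)] by metis
  have "card {\<gamma> \<in> walks G i k. piece i \<gamma> \<inter> C \<noteq> {}} \<le> N"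
    if C: "\<forall>x\<in>C. \<forall>y\<in>C. w (x - y) \<le> \<kappa> ^ k" for k i C
  proof -
    define S where "S = {\<gamma> \<in> walks G i k. piece i \<gamma> \<inter> C \<noteq> {}}"
    show ?thesis
    proof (cases "S = {}")
      case True
      then show ?thesis unfolding S_def[symmetric] by simp
    next
      case False
      then obtain x0 where x0: "x0 \<in> C" by (auto simp: S_def)
      have surj: "\<exists>a. y = (T ^^ k) a" for y
      proof (induction k arbitrary: y)
        case (Suc k)
        obtain a where "A *v y = (T ^^ k) a" using Suc by blast
        then have "(T ^^ Suc k) a = matrix_inv A *v (A *v y)" by simp
        also have "\<dots> = y"
          unfolding matrix_vector_mul_assoc matrix_inv_mult[OF expanding_invertible[OF expanding]] by simp
        finally show ?case by metis
      qed simp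
      have "\<exists>c. norm c \<le> R + 2 * B \<and> foldr g \<gamma> (p (walk_end G i \<gamma>)) = x0 + (T ^^ k) c"
        if \<gamma>: "\<gamma> \<in> S" for \<gamma>
      proof -
        obtain x where x: "x \<in> piece i \<gamma>" "x \<in> C" using \<gamma> by (auto simp: S_def)
        obtain y where y: "y \<in> E (walk_end G i \<gamma>)" "x = foldr g \<gamma> y" using x(1) by (auto simp: piece_def)
        obtain a where a: "x - x0 = (T ^^ k) a" using surj by blast
        have "\<kappa> ^ k * w a \<le> \<kappa> ^ k * 1"
          using C x(2) x0 unfolding gauge_funpow_T[symmetric] a[symmetric] by simp
        then have "w a \<le> 1" using \<kappa>_pos by simp
        then have na: "norm a \<le> R" by (rule R)
        have len: "length \<gamma> = k" using \<gamma> length_walk[of \<gamma> i k] by (simp add: S_def)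
        have "foldr g \<gamma> (p (walk_end G i \<gamma>)) = x0 + (x - x0) + (foldr g \<gamma> (p (walk_end G i \<gamma>)) - foldr g \<gamma> y)"
          using y(2) by simp
        also have "\<dots> = x0 + (T ^^ k) (a + (p (walk_end G i \<gamma>) - y))"
          unfolding foldr_g_diff a funpow_T_add len by simp
        finally show ?thesis
          using norm_triangle_ineq[of a "p (walk_end G i \<gamma>) - y"] norm_triangle_ineq4[of "p (walk_end G i \<gamma>)" y]
            na B(1)[OF y(1)] B(2)[of "walk_end G i \<gamma>"]
          by (intro exI[of _ "a + (p (walk_end G i \<gamma>) - y)"]) auto
      qed
      then obtain c where c: "\<And>\<gamma>. \<gamma> \<in> S \<Longrightarrow> norm (c \<gamma>) \<le> R + 2 * B"
          "\<And>\<gamma>. \<gamma> \<in> S \<Longrightarrow> foldr g \<gamma> (p (walk_end G i \<gamma>)) = x0 + (T ^^ k) (c \<gamma>)"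
        by metis
      have sep: "\<rho> \<le> dist (c \<gamma>) (c \<omega>)" if \<gamma>\<omega>: "\<gamma> \<in> S" "\<omega> \<in> S" "\<gamma> \<noteq> \<omega>" for \<gamma> \<omega>
      proof (rule ccontr)
        assume "\<not> \<rho> \<le> dist (c \<gamma>) (c \<omega>)"
        then have near: "norm (c \<omega> - c \<gamma>) < r (walk_end G i \<gamma>)"
          using \<rho>(2)[of "walk_end G i \<gamma>"] by (simp add: dist_norm norm_minus_commute)
        define y where "y = p (walk_end G i \<gamma>) + (c \<omega> - c \<gamma>)"
        have "y \<in> U (walk_end G i \<gamma>)"
          using near by (intro subsetD[OF pr(2)]) (simp add: y_def dist_norm norm_minus_commute)
        moreover have "p (walk_end G i \<omega>) \<in> U (walk_end G i \<omega>)"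
          using pr(1) by (intro subsetD[OF pr(2)]) simp
        moreover have "foldr g \<gamma> y = foldr g \<omega> (p (walk_end G i \<omega>))"
        proof -
          have "foldr g \<gamma> y - foldr g \<gamma> (p (walk_end G i \<gamma>)) = (T ^^ k) (c \<omega> - c \<gamma>)"
            unfolding foldr_g_diff using \<gamma>\<omega>(1) length_walk[of \<gamma> i k] by (simp add: y_def S_def)
          also have "\<dots> = (T ^^ k) (c \<omega>) - (T ^^ k) (c \<gamma>)" by (rule funpow_T_diff)
          finally show ?thesis using c(2)[OF \<gamma>\<omega>(1)] c(2)[OF \<gamma>\<omega>(2)] by (simp add: algebra_simps)
        qed
        ultimately have "foldr g \<gamma> ` U (walk_end G i \<gamma>) \<inter> foldr g \<omega> ` U (walk_end G i \<omega>) \<noteq> {}"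
          by blast
        then show False using walks_U[of \<gamma> i k \<omega>] \<gamma>\<omega> by (simp add: S_def)
      qed
      have inj: "inj_on c S"
      proof (rule inj_onI, rule ccontr)
        fix \<gamma> \<omega> assume "\<gamma> \<in> S" "\<omega> \<in> S" "c \<gamma> = c \<omega>" "\<gamma> \<noteq> \<omega>"
        then show False using sep[of \<gamma> \<omega>] \<rho>(1) by simp
      qed
      have "c ` S \<subseteq> cball 0 (R + 2 * B)" using c(1) by auto
      moreover have "\<forall>x\<in>c ` S. \<forall>y\<in>c ` S. x \<noteq> y \<longrightarrow> \<rho> \<le> dist x y" using sep by blast
      ultimately have "card (c ` S) \<le> N" using N by blast
      then show ?thesis using card_image[OF inj] unfolding S_def[symmetric] by simp
    qed
  qed
  then show ?thesis by blast
qed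

lemma walk_interval_length_le:
  assumes "\<gamma> \<in> walks G i k"
  shows "foldr \<tau> \<gamma> 1 - foldr \<tau> \<gamma> 0 \<le> 1 / (min_ratio * l ^ k)"
proof -
  have "v (walk_end G i \<gamma>) / v i \<le> 1 / min_ratio"
    using min_ratio_le[of i "walk_end G i \<gamma>"] min_ratio_pos weight_pos[of i] weight_pos[of "walk_end G i \<gamma>"]
    by (simp add: field_simps)
  then have "v (walk_end G i \<gamma>) / v i / l ^ k \<le> 1 / min_ratio / l ^ k"
    using l_gt_1 by (intro divide_right_mono) auto
  then show ?thesis using foldr_tau_diff[OF assms, of 1 0] by (simp add: field_simps)
qed

lemma walk_interval_eq:
  assumes "\<gamma> \<in> walks G i k"
  shows "foldr \<tau> \<gamma> ` {0..1} = {foldr \<tau> \<gamma> 0 .. foldr \<tau> \<gamma> 1}"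
proof -
  define a where "a = foldr \<tau> \<gamma> 1 - foldr \<tau> \<gamma> 0"
  have aff: "foldr \<tau> \<gamma> t = a * t + foldr \<tau> \<gamma> 0" for t
    using foldr_tau_diff[OF assms, of t 0] foldr_tau_diff[OF assms, of 1 0] by (simp add: a_def)
  have "0 \<le> a" using foldr_tau_mono[OF assms, of 0 1] by (simp add: a_def)
  have "foldr \<tau> \<gamma> ` {0..1} = (\<lambda>t. a * t + foldr \<tau> \<gamma> 0) ` {0..1}"
    by (intro image_cong refl aff)
  also have "\<dots> = {foldr \<tau> \<gamma> 0 .. foldr \<tau> \<gamma> 1}"
    using \<open>0 \<le> a\<close> by (simp add: image_affinity_atLeastAtMost a_def)
  finally show ?thesis .
qed

text \<open>The mass distribution principle is applied to Lebesgue measure on the unit interval. A set of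
  diameter of order \<open>\<kappa> ^ k\<close> meets a bounded number of pieces of level \<open>k\<close>, so its preimage lies in the union
  of as many intervals of length of order \<open>1 / l ^ k\<close>.\<close>

lemma H_E_pos: "H (E i) \<noteq> 0"
proof -
  obtain N where N: "\<forall>k i C. (\<forall>x\<in>C. \<forall>y\<in>C. w (x - y) \<le> \<kappa> ^ k) \<longrightarrow>
      card {\<gamma> \<in> walks G i k. piece i \<gamma> \<inter> C \<noteq> {}} \<le> N"
    using bounded_overlap by (rule exE)
  define M where "M = restrict_space lborel {0..1::real}"
  define b where "b = (real N + 1) / min_ratio"
  have b: "0 < b" using min_ratio_pos by (simp add: b_def)
  have J: "\<exists>J\<in>sets M. \<psi> i -` C \<inter> space M \<subseteq> J \<and> emeasure M J \<le> ennreal (b / l ^ k)"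
    if C: "\<forall>x\<in>C. \<forall>y\<in>C. w (x - y) \<le> \<kappa> ^ k" for C k
  proof -
    define S where "S = {\<gamma> \<in> walks G i k. piece i \<gamma> \<inter> C \<noteq> {}}"
    have fin: "finite S" using finite_walks[of i k] by (simp add: S_def verts)
    define J where "J = (\<Union>\<gamma>\<in>S. foldr \<tau> \<gamma> ` {0..1})"
    have walk: "\<gamma> \<in> walks G i k" if "\<gamma> \<in> S" for \<gamma> using that by (simp add: S_def)
    have borel: "foldr \<tau> \<gamma> ` {0..1} \<in> sets lborel" if "\<gamma> \<in> S" for \<gamma>
      by (simp add: walk_interval_eq[OF walk[OF that]])
    have J01: "J \<subseteq> {0..1}" unfolding J_def using foldr_tau_in_unit walk by blast
    have Jb: "J \<in> sets lborel" unfolding J_def using fin borel by (intro sets.finite_UN) auto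
    have "J \<in> sets M" using Jb J01 by (auto simp: M_def sets_restrict_space_iff)
    moreover have "\<psi> i -` C \<inter> space M \<subseteq> J"
    proof
      fix t assume "t \<in> \<psi> i -` C \<inter> space M"
      then have t: "\<psi> i t \<in> C" "t \<in> {0..1}" by (auto simp: M_def space_restrict_space)
      obtain \<gamma> where \<gamma>: "\<gamma> \<in> walks G i k" "t \<in> foldr \<tau> \<gamma> ` {0..1}" using walk_intervals_cover[OF t(2)] by blast
      have "\<psi> i t \<in> piece i \<gamma>" using psi_walk_interval[OF \<gamma>(1)] \<gamma>(2) by blast
      then have "\<gamma> \<in> S" using \<gamma>(1) t(1) by (auto simp: S_def)
      then show "t \<in> J" using \<gamma>(2) by (auto simp: J_def)
    qed
    moreover have "emeasure M J \<le> ennreal (b / l ^ k)"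
    proof -
      have "emeasure M J = emeasure lborel J"
        unfolding M_def using J01 by (intro emeasure_restrict_space) auto
      also have "\<dots> \<le> (\<Sum>\<gamma>\<in>S. emeasure lborel (foldr \<tau> \<gamma> ` {0..1}))"
        unfolding J_def using fin borel by (intro emeasure_subadditive_finite) auto
      also have "\<dots> \<le> (\<Sum>\<gamma>\<in>S. ennreal (1 / (min_ratio * l ^ k)))"
      proof (rule sum_mono)
        fix \<gamma> assume "\<gamma> \<in> S"
        then show "emeasure lborel (foldr \<tau> \<gamma> ` {0..1}) \<le> ennreal (1 / (min_ratio * l ^ k))"
          using walk_interval_length_le[OF walk] foldr_tau_mono[OF walk, of \<gamma> 0 1]
          by (simp add: walk_interval_eq[OF walk] ennreal_leI)
      qed
      also have "\<dots> = ennreal (\<Sum>\<gamma>\<in>S. 1 / (min_ratio * l ^ k))"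
        using min_ratio_pos l_gt_1 by (intro sum_ennreal) auto
      also have "(\<Sum>\<gamma>\<in>S. 1 / (min_ratio * l ^ k)) = real (card S) * (1 / (min_ratio * l ^ k))"
        by (rule sum_constant)
      also have "\<dots> \<le> ennreal (b / l ^ k)"
      proof (rule ennreal_leI)
        have "real (card S) \<le> real N + 1" using N[rule_format, of C k i] C unfolding S_def[symmetric] by simp
        then have "real (card S) * (1 / (min_ratio * l ^ k)) \<le> (real N + 1) * (1 / (min_ratio * l ^ k))"
          using min_ratio_pos l_gt_1 by (intro mult_right_mono) auto
        then show "real (card S) * (1 / (min_ratio * l ^ k)) \<le> b / l ^ k" by (simp add: b_def)
      qed
      finally show ?thesis .
    qed
    ultimately show ?thesis by blast
  qed
  have "emeasure M (space M) \<le> ennreal (b * l) * H (E i)"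
  proof (rule mass_distribution_principle[of _ 1 w M "\<psi> i"])
    show "0 < b * l" using b l_gt_1 by simp
    show "0 < (1::real)" by simp
    show "\<psi> i ` space M \<subseteq> E i"
      using parametrization_psi[of i] by (simp add: M_def space_restrict_space parametrization_def)
    fix C assume diam: "wdiam w C \<le> ennreal 1"
    define \<delta> where "\<delta> = enn2real (wdiam w C)"
    have \<delta>: "wdiam w C = ennreal \<delta>" "0 \<le> \<delta>" "\<delta> \<le> 1"
      using diam enn2real_mono[OF diam] by (auto simp: \<delta>_def ennreal_enn2real_if top_unique)
    have gauge_le: "\<forall>x\<in>C. \<forall>y\<in>C. w (x - y) \<le> \<kappa> ^ k" if "\<delta> \<le> \<kappa> ^ k" for k
    proof (intro ballI)
      fix x y assume "x \<in> C" "y \<in> C"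
      then have "ennreal (w (x - y)) \<le> ennreal \<delta>" using \<delta>(1) wdiam_le_iff[of w C] by auto
      then show "w (x - y) \<le> \<kappa> ^ k" using \<delta>(2) that by (simp add: ennreal_le_iff)
    qed
    show "\<exists>J\<in>sets M. \<psi> i -` C \<inter> space M \<subseteq> J \<and> emeasure M J \<le> ennreal (b * l) * wdiam_power w \<alpha> C"
    proof (cases "\<delta> = 0")
      case False
      then have "0 < \<delta>" using \<delta>(2) by simp
      have "\<exists>k. \<kappa> ^ Suc k < \<delta>"
      proof -
        obtain k where "\<kappa> ^ k < \<delta>" using real_arch_pow_inv[OF \<open>0 < \<delta>\<close> \<kappa>_less_1] by blast
        moreover have "\<kappa> ^ Suc k \<le> \<kappa> ^ k" using \<kappa>_pos \<kappa>_less_1 by (simp add: mult_left_le_one_le)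
        ultimately show ?thesis by (intro exI[of _ k]) linarith
      qed
      then obtain k where k: "\<kappa> ^ Suc k < \<delta>" "\<And>j. j < k \<Longrightarrow> \<not> \<kappa> ^ Suc j < \<delta>"
        using exists_least_iff[of "\<lambda>k. \<kappa> ^ Suc k < \<delta>"] by blast
      have "\<delta> \<le> \<kappa> ^ k" using k(2) \<delta>(3) by (cases k) (auto simp: not_less)
      from J[OF gauge_le[OF this]] obtain J where
        J: "J \<in> sets M" "\<psi> i -` C \<inter> space M \<subseteq> J" "emeasure M J \<le> ennreal (b / l ^ k)" by blast
      have "1 / l ^ Suc k = (\<kappa> ^ Suc k) powr \<alpha>" by (rule \<kappa>_power_powr[symmetric])
      also have "\<dots> \<le> \<delta> powr \<alpha>" using k(1) \<kappa>_pos \<alpha>_pos by (intro powr_mono2) auto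
      finally have "b * l * (1 / l ^ Suc k) \<le> b * l * \<delta> powr \<alpha>" using b l_gt_1 by (intro mult_left_mono) auto
      then have "b / l ^ k \<le> b * l * \<delta> powr \<alpha>" using l_gt_1 by simp
      then have "ennreal (b / l ^ k) \<le> ennreal (b * l) * wdiam_power w \<alpha> C"
        using b l_gt_1 \<alpha>_pos by (simp add: wdiam_power_pos_exponent ennreal_leI flip: \<delta>_def ennreal_mult)
      then show ?thesis using J order_trans by blast
    next
      case True
      \<comment> \<open>A set of diameter 0 is covered at every level, so its preimage is a null set.\<close>
      have "\<forall>k. \<exists>J. J \<in> sets M \<and> \<psi> i -` C \<inter> space M \<subseteq> J \<and> emeasure M J \<le> ennreal (b / l ^ k)"
        using J gauge_le True \<kappa>_pos by (metis less_imp_le zero_less_power)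
      then obtain J where J: "\<And>k. J k \<in> sets M" "\<And>k. \<psi> i -` C \<inter> space M \<subseteq> J k"
          "\<And>k. emeasure M (J k) \<le> ennreal (b / l ^ k)" by metis
      have "emeasure M (\<Inter>k. J k) \<le> 0"
      proof (rule LIMSEQ_le_const)
        have "(\<lambda>k. b * (1 / l) ^ k) \<longlonglongrightarrow> 0"
          using l_gt_1 by (intro tendsto_mult_right_zero LIMSEQ_realpow_zero) auto
        then have "(\<lambda>k. b / l ^ k) \<longlonglongrightarrow> 0" by (simp add: power_one_over)
        then show "(\<lambda>k. ennreal (b / l ^ k)) \<longlonglongrightarrow> 0" using tendsto_ennrealI by fastforce
        have "emeasure M (\<Inter>k. J k) \<le> ennreal (b / l ^ k)" for k
          using emeasure_mono[of "\<Inter>k. J k" "J k" M] J(1,3) order_trans by (metis INT_lower UNIV_I)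
        then show "\<exists>m. \<forall>k\<ge>m. emeasure M (\<Inter>k. J k) \<le> ennreal (b / l ^ k)" by blast
      qed
      moreover have "(\<Inter>k. J k) \<in> sets M" using J(1) by (intro sets.countable_INT) auto
      moreover have "\<psi> i -` C \<inter> space M \<subseteq> (\<Inter>k. J k)" using J(2) by blast
      ultimately show ?thesis by (intro bexI[of _ "\<Inter>k. J k"]) auto
    qed
  qed
  moreover have "emeasure M (space M) = 1"
    by (simp add: M_def space_restrict_space emeasure_restrict_space)
  ultimately show ?thesis by auto
qed

section \<open>The Hausdorff measure as the image of Lebesgue measure\<close>

lemma H_piece_le:
  assumes "\<gamma> \<in> walks G i k"
  shows "H (piece i \<gamma>) \<le> ennreal (1 / l ^ k) * H (E (walk_end G i \<gamma>))"
proof -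
  have "w (foldr g \<gamma> x - foldr g \<gamma> y) = \<kappa> ^ k * w (x - y)" for x y
    unfolding foldr_g_diff gauge_funpow_T length_walk[OF assms] ..
  then have "H (foldr g \<gamma> ` E (walk_end G i \<gamma>)) \<le> ennreal ((\<kappa> ^ k) powr \<alpha>) * H (E (walk_end G i \<gamma>))"
    using \<kappa>_pos by (intro hausdorff_outer_image_le \<alpha>_pos) auto
  then show ?thesis unfolding piece_def \<kappa>_power_powr .
qed

definition h :: "'v \<Rightarrow> real" where
  "h i = enn2real (H (E i))"

lemma H_E_eq: "H (E i) = ennreal (h i)"
  using H_E_finite[of i] by (simp add: h_def)

lemma h_pos: "0 < h i"
  using H_E_pos[of i] H_E_finite[of i] by (simp add: h_def enn2real_positive_iff zero_less_iff_neq_zero)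

lemma h_subeigen: "l ^ k * h i \<le> (\<Sum>\<gamma>\<in>walks G i k. h (walk_end G i \<gamma>))"
proof -
  have fin: "finite (walks G i k)" by (simp add: finite_walks verts)
  have "H (E i) \<le> H (\<Union>\<gamma>\<in>walks G i k. piece i \<gamma>)" by (rule hausdorff_outer_mono[OF pieces_cover])
  also have "\<dots> \<le> (\<Sum>\<gamma>\<in>walks G i k. H (piece i \<gamma>))" by (rule hausdorff_outer_finite_UN_le[OF fin])
  also have "\<dots> \<le> (\<Sum>\<gamma>\<in>walks G i k. ennreal (1 / l ^ k * h (walk_end G i \<gamma>)))"
  proof (rule sum_mono)
    fix \<gamma> assume "\<gamma> \<in> walks G i k"
    from H_piece_le[OF this]
    show "H (piece i \<gamma>) \<le> ennreal (1 / l ^ k * h (walk_end G i \<gamma>))"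
      using l_gt_1 h_pos[of "walk_end G i \<gamma>"] by (simp only: H_E_eq ennreal_mult' zero_le_divide_1_iff zero_le_power)
  qed
  also have "\<dots> = ennreal (\<Sum>\<gamma>\<in>walks G i k. 1 / l ^ k * h (walk_end G i \<gamma>))"
    using l_gt_1 h_pos by (intro sum_ennreal mult_nonneg_nonneg) (auto intro: less_imp_le)
  finally have "ennreal (h i) \<le> ennreal (\<Sum>\<gamma>\<in>walks G i k. 1 / l ^ k * h (walk_end G i \<gamma>))"
    unfolding H_E_eq .
  then have "h i \<le> (\<Sum>\<gamma>\<in>walks G i k. 1 / l ^ k * h (walk_end G i \<gamma>))"
    using l_gt_1 h_pos
    by (subst (asm) ennreal_le_iff) (auto intro!: sum_nonneg mult_nonneg_nonneg intro: less_imp_le)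
  also have "\<dots> = (\<Sum>\<gamma>\<in>walks G i k. h (walk_end G i \<gamma>)) / l ^ k"
    by (simp add: sum_divide_distrib)
  finally show ?thesis using l_gt_1 by (simp add: field_simps)
qed

text \<open>The vector \<open>h\<close> is a subeigenvector for the Perron eigenvalue. At a vertex where \<open>h / v\<close> is
  maximal, the inequality is an equality, which forces the same ratio at the ends of all walks.\<close>

lemma h_proportional: "\<exists>c. \<forall>i. h i = c * v i"
proof -
  define c where "c = Max (range (\<lambda>i. h i / v i))"
  have "c \<in> range (\<lambda>i. h i / v i)" unfolding c_def by (intro Max_in) auto
  then obtain i where "c = h i / v i" by blast
  then have i: "h i = c * v i" using weight_pos[of i] by simp
  have le: "h j \<le> c * v j" for j
  proof -
    have "h j / v j \<le> c" unfolding c_def by (intro Max_ge) auto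
    then show ?thesis using weight_pos[of j] by (simp add: field_simps)
  qed
  have "(\<Sum>\<gamma>\<in>walks G i n. c * v (walk_end G i \<gamma>)) = c * (l ^ n * v i)"
    unfolding sum_distrib_left[symmetric]
    by (subst sum_walks_eigenvector[of v l]) (simp_all add: weight_eigen verts)
  also have "\<dots> \<le> (\<Sum>\<gamma>\<in>walks G i n. h (walk_end G i \<gamma>))"
    using h_subeigen[of n i] i by (simp add: mult_ac)
  finally have "(\<Sum>\<gamma>\<in>walks G i n. c * v (walk_end G i \<gamma>) - h (walk_end G i \<gamma>)) \<le> 0"
    by (simp add: sum_subtractf)
  moreover have nonneg: "0 \<le> c * v (walk_end G i \<gamma>) - h (walk_end G i \<gamma>)" for \<gamma>
    using le[of "walk_end G i \<gamma>"] by simp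
  ultimately have "(\<Sum>\<gamma>\<in>walks G i n. c * v (walk_end G i \<gamma>) - h (walk_end G i \<gamma>)) = 0"
    by (intro antisym sum_nonneg) auto
  then have zero: "\<forall>\<gamma>\<in>walks G i n. c * v (walk_end G i \<gamma>) - h (walk_end G i \<gamma>) = 0"
    using nonneg by (subst (asm) sum_nonneg_eq_0_iff) (auto simp: finite_walks verts)
  have "h j = c * v j" for j
  proof -
    obtain \<gamma> where \<gamma>: "\<gamma> \<in> walks G i n" "walk_end G i \<gamma> = j" using connected by blast
    then show ?thesis using bspec[OF zero \<gamma>(1)] by simp
  qed
  then show ?thesis by blast
qed

lemma H_piece_le_length:
  assumes "\<gamma> \<in> walks G i k"
  shows "H (piece i \<gamma>) \<le> ennreal (h i * (foldr \<tau> \<gamma> 1 - foldr \<tau> \<gamma> 0))"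
proof -
  obtain c where c: "\<And>i. h i = c * v i" using h_proportional by blast
  have "H (piece i \<gamma>) \<le> ennreal (1 / l ^ k) * ennreal (h (walk_end G i \<gamma>))"
    using H_piece_le[OF assms] unfolding H_E_eq .
  also have "\<dots> = ennreal (1 / l ^ k * h (walk_end G i \<gamma>))"
    using l_gt_1 h_pos[of "walk_end G i \<gamma>"] by (intro ennreal_mult[symmetric]) auto
  also have "1 / l ^ k * h (walk_end G i \<gamma>) = h i * (foldr \<tau> \<gamma> 1 - foldr \<tau> \<gamma> 0)"
    using weight_pos[of i] l_gt_1 by (simp add: foldr_tau_diff[OF assms] c field_simps)
  finally show ?thesis .
qed

lemma walk_intervals_ordered:
  assumes "\<gamma> \<in> walks G i k" "\<omega> \<in> walks G i k" "\<gamma> \<noteq> \<omega>"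
  shows "foldr \<tau> \<gamma> 1 \<le> foldr \<tau> \<omega> 0 \<or> foldr \<tau> \<omega> 1 \<le> foldr \<tau> \<gamma> 0"
  using lex_total_on_walks[OF assms] foldr_tau_lex assms by blast

text \<open>The image of an interval is covered by the pieces of level \<open>k\<close> whose parameter intervals meet
  it. These intervals do not overlap, so their total length exceeds that of the interval by at most
  twice the maximal length at level \<open>k\<close>.\<close>

lemma H_psi_interval_le:
  assumes ab: "0 \<le> a" "a \<le> b" "b \<le> 1"
  shows "H (\<psi> i ` {a..b}) \<le> ennreal (h i * (b - a))"
proof (rule LIMSEQ_le_const)
  define m where "m k = 1 / (min_ratio * l ^ k)" for k
  have "(\<lambda>k. 1 / min_ratio * (1 / l) ^ k) \<longlonglongrightarrow> 0"
    using l_gt_1 by (intro tendsto_mult_right_zero LIMSEQ_realpow_zero) auto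
  then have "m \<longlonglongrightarrow> 0" unfolding m_def by (simp add: power_one_over)
  then have "(\<lambda>k. h i * (b - a + 2 * m k)) \<longlonglongrightarrow> h i * (b - a + 2 * 0)" by (intro tendsto_intros)
  then have "(\<lambda>k. h i * (b - a + 2 * m k)) \<longlonglongrightarrow> h i * (b - a)" by simp
  then show "(\<lambda>k. ennreal (h i * (b - a + 2 * m k))) \<longlonglongrightarrow> ennreal (h i * (b - a))"
    by (rule tendsto_ennrealI)
  have "H (\<psi> i ` {a..b}) \<le> ennreal (h i * (b - a + 2 * m k))" for k
  proof -
    define S where "S = {\<gamma> \<in> walks G i k. foldr \<tau> \<gamma> ` {0..1} \<inter> {a..b} \<noteq> {}}"
    define I where "I \<gamma> = {foldr \<tau> \<gamma> 0 <..< foldr \<tau> \<gamma> 1}" for \<gamma>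
    have walk: "\<gamma> \<in> walks G i k" if "\<gamma> \<in> S" for \<gamma> using that by (simp add: S_def)
    have fin: "finite S" using finite_walks[of i k] by (simp add: S_def verts)
    have mono: "foldr \<tau> \<gamma> 0 \<le> foldr \<tau> \<gamma> 1" if "\<gamma> \<in> S" for \<gamma>
      by (rule foldr_tau_mono[OF walk[OF that]]) simp
    have cover: "\<psi> i ` {a..b} \<subseteq> (\<Union>\<gamma>\<in>S. piece i \<gamma>)"
    proof
      fix x assume "x \<in> \<psi> i ` {a..b}"
      then obtain t where t: "t \<in> {a..b}" "x = \<psi> i t" by blast
      then have "t \<in> {0..1}" using ab by simp
      then obtain \<gamma> where \<gamma>: "\<gamma> \<in> walks G i k" "t \<in> foldr \<tau> \<gamma> ` {0..1}" using walk_intervals_cover by blast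
      have "\<gamma> \<in> S" using \<gamma> t(1) unfolding S_def by blast
      moreover have "x \<in> piece i \<gamma>" using psi_walk_interval[OF \<gamma>(1)] \<gamma>(2) t(2) by blast
      ultimately show "x \<in> (\<Union>\<gamma>\<in>S. piece i \<gamma>)" by blast
    qed
    have disj: "disjoint_family_on I S"
      unfolding disjoint_family_on_def
    proof (intro ballI impI)
      fix \<gamma> \<omega> assume "\<gamma> \<in> S" "\<omega> \<in> S" "\<gamma> \<noteq> \<omega>"
      then show "I \<gamma> \<inter> I \<omega> = {}"
        using walk_intervals_ordered[OF walk walk, of \<gamma> \<omega>] by (auto simp: I_def)
    qed
    have sub: "(\<Union>\<gamma>\<in>S. I \<gamma>) \<subseteq> {a - m k .. b + m k}"
    proof
      fix t assume "t \<in> (\<Union>\<gamma>\<in>S. I \<gamma>)"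
      then obtain \<gamma> where \<gamma>: "\<gamma> \<in> S" "t \<in> I \<gamma>" by blast
      have "foldr \<tau> \<gamma> ` {0..1} \<inter> {a..b} \<noteq> {}" using \<gamma>(1) by (simp add: S_def)
      then obtain u where u: "u \<in> {foldr \<tau> \<gamma> 0 .. foldr \<tau> \<gamma> 1}" "u \<in> {a..b}"
        unfolding walk_interval_eq[OF walk[OF \<gamma>(1)]] by blast
      have "foldr \<tau> \<gamma> 1 - foldr \<tau> \<gamma> 0 \<le> m k" unfolding m_def by (rule walk_interval_length_le[OF walk[OF \<gamma>(1)]])
      then show "t \<in> {a - m k .. b + m k}" using u \<gamma>(2) by (simp add: I_def)
    qed
    have m_pos: "0 < m k" using min_ratio_pos l_gt_1 by (simp add: m_def)
    have "(\<Sum>\<gamma>\<in>S. emeasure lborel (I \<gamma>)) = emeasure lborel (\<Union>\<gamma>\<in>S. I \<gamma>)"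
      by (rule sum_emeasure[OF _ disj fin]) (auto simp: I_def)
    also have "\<dots> \<le> emeasure lborel {a - m k .. b + m k}" by (rule emeasure_mono[OF sub]) simp
    also have "\<dots> = ennreal (b - a + 2 * m k)"
      using m_pos ab by (simp add: algebra_simps)
    finally have lens: "(\<Sum>\<gamma>\<in>S. emeasure lborel (I \<gamma>)) \<le> ennreal (b - a + 2 * m k)" .
    have "H (\<psi> i ` {a..b}) \<le> H (\<Union>\<gamma>\<in>S. piece i \<gamma>)" by (rule hausdorff_outer_mono[OF cover])
    also have "\<dots> \<le> (\<Sum>\<gamma>\<in>S. H (piece i \<gamma>))" by (rule hausdorff_outer_finite_UN_le[OF fin])
    also have "\<dots> \<le> (\<Sum>\<gamma>\<in>S. ennreal (h i) * emeasure lborel (I \<gamma>))"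
    proof (rule sum_mono)
      fix \<gamma> assume \<gamma>: "\<gamma> \<in> S"
      have "ennreal (h i) * emeasure lborel (I \<gamma>) = ennreal (h i * (foldr \<tau> \<gamma> 1 - foldr \<tau> \<gamma> 0))"
        using mono[OF \<gamma>] h_pos[of i] by (simp add: I_def flip: ennreal_mult)
      then show "H (piece i \<gamma>) \<le> ennreal (h i) * emeasure lborel (I \<gamma>)"
        using H_piece_le_length[OF walk[OF \<gamma>]] by simp
    qed
    also have "\<dots> = ennreal (h i) * (\<Sum>\<gamma>\<in>S. emeasure lborel (I \<gamma>))" by (rule sum_distrib_left[symmetric])
    also have "\<dots> \<le> ennreal (h i) * ennreal (b - a + 2 * m k)" by (intro mult_left_mono lens) simp
    also have "\<dots> = ennreal (h i * (b - a + 2 * m k))"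
      using h_pos[of i] ab m_pos by (intro ennreal_mult[symmetric]) auto
    finally show ?thesis .
  qed
  then show "\<exists>N. \<forall>k\<ge>N. H (\<psi> i ` {a..b}) \<le> ennreal (h i * (b - a + 2 * m k))" by blast
qed

lemma continuous_on_psi: "continuous_on {0..1} (\<psi> i)" and psi_image: "\<psi> i ` {0..1} = E i"
  using parametrization_psi[of i] by (simp_all add: parametrization_def)

lemma emeasure_unit_subset:
  assumes "F \<in> sets borel" "F \<subseteq> {0..1::real}"
  shows "emeasure lborel F = ennreal (measure lborel F)"
proof (rule emeasure_eq_ennreal_measure)
  have "emeasure lborel F \<le> emeasure lborel {0..1::real}" using assms by (intro emeasure_mono) auto
  then show "emeasure lborel F \<noteq> top" by (auto simp: top_unique)
qed

text \<open>A Borel set is covered by countably many nonoverlapping intervals of nearly the same total length.\<close>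

lemma H_psi_le:
  assumes F: "F \<in> sets borel" "F \<subseteq> {0..1}"
  shows "H (\<psi> i ` F) \<le> ennreal (h i * measure lborel F)"
proof (rule ennreal_le_epsilon)
  fix \<epsilon> :: real assume \<epsilon>: "0 < \<epsilon>"
  define e where "e = \<epsilon> / h i"
  have e: "0 < e" using \<epsilon> h_pos[of i] by (simp add: e_def)
  have leb: "F \<in> sets lebesgue" using F(1) by simp
  have "bounded F" by (rule bounded_subset[OF compact_imp_bounded[OF compact_Icc] F(2)])
  then have meas: "F \<in> lmeasurable" using leb by (rule bounded_set_imp_lmeasurable)
  have unit: "F \<subseteq> cbox 0 1" using F(2) by simp
  obtain D where D: "countable D"
      "\<And>K. K \<in> D \<Longrightarrow> K \<subseteq> cbox 0 1 \<and> K \<noteq> {} \<and> (\<exists>c d. K = cbox c d)"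
      "pairwise (\<lambda>A B. interior A \<inter> interior B = {}) D"
      "F \<subseteq> \<Union>D" "\<Union>D \<in> lmeasurable" "measure lebesgue (\<Union>D) \<le> measure lebesgue F + e"
    by (rule measurable_outer_intervals_bounded[OF meas unit e]; rule that; assumption)
  have interval: "H (\<psi> i ` K) \<le> ennreal (h i) * emeasure lborel (interior K)" if K: "K \<in> D" for K
  proof -
    obtain a b where ab: "K = {a..b}" using D(2)[OF K] by auto
    have "a \<le> b" using D(2)[OF K] ab by auto
    moreover have "0 \<le> a" "b \<le> 1" using D(2)[OF K] ab \<open>a \<le> b\<close> by auto
    ultimately have "H (\<psi> i ` K) \<le> ennreal (h i * (b - a))" unfolding ab by (intro H_psi_interval_le)
    then show ?thesis using \<open>a \<le> b\<close> h_pos[of i] by (simp add: ab flip: ennreal_mult)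
  qed
  have "\<psi> i ` F \<subseteq> (\<Union>K\<in>D. \<psi> i ` K)" using D(4) by blast
  then have "H (\<psi> i ` F) \<le> H (\<Union>K\<in>D. \<psi> i ` K)" by (rule hausdorff_outer_mono)
  also have "\<dots> \<le> (\<integral>\<^sup>+K. H (\<psi> i ` K) \<partial>count_space D)" by (rule hausdorff_outer_countable_UN_le[OF D(1)])
  also have "\<dots> \<le> (\<integral>\<^sup>+K. ennreal (h i) * emeasure lborel (interior K) \<partial>count_space D)"
    by (rule nn_integral_mono) (simp add: interval)
  also have "\<dots> = ennreal (h i) * (\<integral>\<^sup>+K. emeasure lborel (interior K) \<partial>count_space D)"
    by (rule nn_integral_cmult) simp
  also have "(\<integral>\<^sup>+K. emeasure lborel (interior K) \<partial>count_space D) = emeasure lborel (\<Union>K\<in>D. interior K)"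
    by (rule emeasure_UN_countable[symmetric])
      (use D(1,3) in \<open>auto simp: disjoint_family_on_def pairwise_def\<close>)
  also have "\<dots> = emeasure lebesgue (\<Union>K\<in>D. interior K)"
  proof -
    have "open (\<Union>K\<in>D. interior K)" by (intro open_UN ballI open_interior)
    then show ?thesis by (simp add: emeasure_completion)
  qed
  also have "\<dots> \<le> emeasure lebesgue (\<Union>D)"
    using D(5) interior_subset by (intro emeasure_mono) (blast, simp add: fmeasurable_def)
  also have "\<dots> = ennreal (measure lebesgue (\<Union>D))" by (rule emeasure_eq_measure2[OF D(5)])
  also have "\<dots> \<le> ennreal (measure lborel F + e)"
    using D(6) F(1) by (simp add: ennreal_leI)
  finally have "H (\<psi> i ` F) \<le> ennreal (h i) * ennreal (measure lborel F + e)"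
    by (simp add: mult_left_mono)
  also have "\<dots> = ennreal (h i * (measure lborel F + e))"
    using h_pos[of i] e by (intro ennreal_mult[symmetric]) auto
  also have "h i * (measure lborel F + e) = h i * measure lborel F + \<epsilon>"
    using h_pos[of i] by (simp add: e_def distrib_left)
  also have "ennreal \<dots> = ennreal (h i * measure lborel F) + ennreal \<epsilon>"
    using h_pos[of i] \<epsilon> by (intro ennreal_plus) auto
  finally show "H (\<psi> i ` F) \<le> ennreal (h i * measure lborel F) + ennreal \<epsilon>" .
qed

text \<open>Equality holds because the upper bounds for \<open>F\<close> and for its complement add up to the measure of
  \<open>E i\<close>, while the outer measure \<open>H\<close> is subadditive.\<close>

lemma H_psi:
  assumes F: "F \<in> sets borel" "F \<subseteq> {0..1}"
  shows "H (\<psi> i ` F) = ennreal (h i * measure lborel F)"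
proof -
  define F' where "F' = {0..1} - F"
  have F': "F' \<in> sets borel" "F' \<subseteq> {0..1}" using F by (auto simp: F'_def)
  have "measure lborel F' = measure lborel {0..1::real} - measure lborel F"
    unfolding F'_def using F by (intro measure_Diff) auto
  then have meas: "measure lborel F' = 1 - measure lborel F" by simp
  obtain x where x: "0 \<le> x" "H (\<psi> i ` F) = ennreal x" "x \<le> h i * measure lborel F"
  proof (cases "H (\<psi> i ` F)")
    case (real x)
    then show ?thesis using that[of x] H_psi_le[OF F, of i] h_pos[of i]
      by (auto simp: ennreal_le_iff2)
  next
    case top
    then show ?thesis using H_psi_le[OF F, of i] by (simp add: top_unique)
  qed
  have "E i = \<psi> i ` F \<union> \<psi> i ` F'"
    using psi_image[of i] F(2) unfolding F'_def by blast
  then have "H (E i) \<le> H (\<psi> i ` F) + H (\<psi> i ` F')" using hausdorff_outer_Un_le by metis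
  also have "\<dots> \<le> ennreal x + ennreal (h i * measure lborel F')"
    unfolding x(2) by (intro add_left_mono H_psi_le F')
  also have "\<dots> = ennreal (x + h i * measure lborel F')"
    using x(1) h_pos[of i] by (intro ennreal_plus[symmetric]) auto
  finally have "h i \<le> x + h i * measure lborel F'"
    unfolding H_E_eq using x(1) h_pos[of i] by (subst (asm) ennreal_le_iff) auto
  then have "h i * measure lborel F \<le> x" by (simp add: meas algebra_simps)
  then show ?thesis using x by simp
qed

lemma borel_vimage_psi:
  assumes "B \<in> sets borel"
  shows "\<psi> i -` B \<inter> {0..1} \<in> sets borel"
proof -
  have "\<psi> i \<in> borel_measurable (restrict_space borel {0..1})"
    by (rule borel_measurable_continuous_on_restrict[OF continuous_on_psi])
  from measurable_sets[OF this assms]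
  show ?thesis by (simp add: space_restrict_space sets_restrict_space_iff)
qed

lemma psi_vimage:
  assumes "B \<subseteq> E i"
  shows "\<psi> i ` (\<psi> i -` B \<inter> {0..1}) = B"
proof (intro equalityI subsetI)
  fix x assume "x \<in> B"
  moreover from this have "x \<in> \<psi> i ` {0..1}" using assms psi_image by blast
  ultimately show "x \<in> \<psi> i ` (\<psi> i -` B \<inter> {0..1})" by blast
qed blast

lemma measure_vimage_psi:
  assumes "B \<in> sets borel" "B \<subseteq> E i"
  shows "H B = ennreal (h i * measure lborel (\<psi> i -` B \<inter> {0..1}))"
  using H_psi[OF borel_vimage_psi[OF assms(1)], of i i] unfolding psi_vimage[OF assms(2)] by simp

lemma compact_piece:
  assumes "\<gamma> \<in> walks G i k"
  shows "compact (piece i \<gamma>)"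
proof -
  have "continuous_on (foldr \<tau> \<gamma> ` {0..1}) (\<psi> i)"
    by (rule continuous_on_subset[OF continuous_on_psi]) (use foldr_tau_in_unit[OF assms] in blast)
  then have "compact (\<psi> i ` foldr \<tau> \<gamma> ` {0..1})"
    by (rule compact_continuous_image) (simp add: walk_interval_eq[OF assms])
  then show ?thesis by (simp only: psi_walk_interval[OF assms])
qed

text \<open>The intersection of two distinct pieces of the same level is the image of a subset of either
  parameter interval, hence also of the union of these two subsets. The three measures agree, and
  the subsets overlap in at most one point.\<close>

lemma H_piece_Int_eq_0:
  assumes \<gamma>: "\<gamma> \<in> walks G i k" and \<omega>: "\<omega> \<in> walks G i k" and ne: "\<gamma> \<noteq> \<omega>"
  shows "H (piece i \<gamma> \<inter> piece i \<omega>) = 0"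
proof -
  define P where "P = piece i \<gamma> \<inter> piece i \<omega>"
  define I where "I \<eta> = foldr \<tau> \<eta> ` {0..1}" for \<eta>
  have P: "P \<in> sets borel"
    using compact_piece[OF \<gamma>] compact_piece[OF \<omega>] unfolding P_def by (intro sets.Int borel_compact)
  define F where "F \<eta> = \<psi> i -` P \<inter> {0..1} \<inter> I \<eta>" for \<eta>
  have I: "I \<eta> \<in> sets borel" "\<psi> i ` I \<eta> = piece i \<eta>" "I \<eta> \<subseteq> {0..1}" if "\<eta> \<in> walks G i k" for \<eta>
  proof -
    show "I \<eta> \<in> sets borel" by (simp add: I_def walk_interval_eq[OF that])
    show "\<psi> i ` I \<eta> = piece i \<eta>" unfolding I_def by (rule psi_walk_interval[OF that])
    show "I \<eta> \<subseteq> {0..1}" unfolding I_def using foldr_tau_in_unit[OF that] by blast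
  qed
  have F: "F \<eta> \<in> sets borel" "F \<eta> \<subseteq> {0..1}" if "\<eta> \<in> walks G i k" for \<eta>
    using borel_vimage_psi[OF P] I(1)[OF that] by (auto simp: F_def)
  have img: "\<psi> i ` F \<gamma> = P" "\<psi> i ` F \<omega> = P" "\<psi> i ` (F \<gamma> \<union> F \<omega>) = P"
  proof -
    have P1: "P \<subseteq> \<psi> i ` I \<gamma>" "P \<subseteq> \<psi> i ` I \<omega>" unfolding I(2)[OF \<gamma>] I(2)[OF \<omega>] P_def by auto
    show "\<psi> i ` F \<gamma> = P" using P1(1) I(3)[OF \<gamma>] unfolding F_def by blast
    moreover show "\<psi> i ` F \<omega> = P" using P1(2) I(3)[OF \<omega>] unfolding F_def by blast
    ultimately show "\<psi> i ` (F \<gamma> \<union> F \<omega>) = P" by (simp add: image_Un)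
  qed
  have "ennreal (h i * measure lborel (F \<gamma>)) = ennreal (h i * measure lborel (F \<gamma> \<union> F \<omega>))"
    "ennreal (h i * measure lborel (F \<omega>)) = ennreal (h i * measure lborel (F \<gamma> \<union> F \<omega>))"
    using H_psi[OF F[OF \<gamma>], of i] H_psi[OF F[OF \<omega>], of i] H_psi[of "F \<gamma> \<union> F \<omega>" i] F[OF \<gamma>] F[OF \<omega>]
    unfolding img by auto
  then have eq: "measure lborel (F \<gamma>) = measure lborel (F \<gamma> \<union> F \<omega>)"
    "measure lborel (F \<omega>) = measure lborel (F \<gamma> \<union> F \<omega>)"
    using h_pos[of i] by (auto simp: ennreal_inj)
  have fm: "F \<eta> \<in> fmeasurable lborel" if "\<eta> \<in> walks G i k" for \<eta>
    using F[OF that] emeasure_unit_subset[OF F[OF that]] by (intro fmeasurableI) auto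
  have "\<exists>t. F \<gamma> \<inter> F \<omega> \<subseteq> {t}"
  proof -
    let ?X = "{foldr \<tau> \<gamma> 0 .. foldr \<tau> \<gamma> 1} \<inter> {foldr \<tau> \<omega> 0 .. foldr \<tau> \<omega> 1}"
    have "F \<gamma> \<inter> F \<omega> \<subseteq> ?X"
      unfolding F_def I_def walk_interval_eq[OF \<gamma>] walk_interval_eq[OF \<omega>] by blast
    moreover have "?X \<subseteq> {foldr \<tau> \<gamma> 0} \<or> ?X \<subseteq> {foldr \<tau> \<gamma> 1}"
      using walk_intervals_ordered[OF \<gamma> \<omega> ne] by auto
    ultimately show ?thesis by (meson subset_trans)
  qed
  then obtain t where "F \<gamma> \<inter> F \<omega> \<subseteq> {t}" by blast
  then have "F \<gamma> \<inter> F \<omega> = {} \<or> F \<gamma> \<inter> F \<omega> = {t}" by blast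
  then have "measure lborel (F \<gamma> \<inter> F \<omega>) = 0" by (auto simp: measure_def)
  then have "measure lborel (F \<gamma>) = 0"
    using measure_Un3[OF fm[OF \<gamma>] fm[OF \<omega>]] eq by linarith
  then show ?thesis using H_psi[OF F[OF \<gamma>], of i] unfolding img P_def by simp
qed

text \<open>Two parameters with the same value lie in the intervals of distinct walks of some common length,
  so the value belongs to one of the countably many null sets \<open>piece i \<gamma> \<inter> piece i \<omega>\<close>. Outside their union
  the parametrization is injective.\<close>

lemma measure_isomorphism_psi: "measure_isomorphism (\<psi> i) (E i) H"
proof -
  define W where "W k = {p \<in> walks G i k \<times> walks G i k. fst p \<noteq> snd p}" for k
  define Z where "Z k = (\<Union>p\<in>W k. piece i (fst p) \<inter> piece i (snd p))" for k
  have finW: "finite (W k)" for k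
    using finite_walks[of i k] by (simp add: W_def verts)
  have Z_borel: "Z k \<in> sets borel" for k
    unfolding Z_def using finW
    by (intro sets.finite_UN) (auto simp: W_def intro!: sets.Int borel_compact compact_piece)
  have H_Z: "H (Z k) = 0" for k
  proof -
    have "H (Z k) \<le> (\<Sum>p\<in>W k. H (piece i (fst p) \<inter> piece i (snd p)))"
      unfolding Z_def by (rule hausdorff_outer_finite_UN_le[OF finW])
    also have "\<dots> = 0" by (intro sum.neutral) (auto simp: W_def H_piece_Int_eq_0)
    finally show ?thesis by simp
  qed
  define E' where "E' = E i - (\<Union>k. Z k)"
  define I' where "I' = \<psi> i -` E' \<inter> {0..1}"
  have E'_borel: "E' \<in> sets borel"
    unfolding E'_def using compact_E[of i] Z_borel by (intro sets.Diff borel_compact sets.countable_UN) auto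
  have E_borel: "E i \<in> sets borel" using compact_E[of i] by (rule borel_compact)
  have "H (E i - E') \<le> H (\<Union>k. Z k)" by (rule hausdorff_outer_mono) (auto simp: E'_def)
  also have "\<dots> \<le> (\<Sum>k. H (Z k))" by (rule hausdorff_outer_UN_le)
  finally have null: "H (E i - E') = 0" by (simp add: H_Z)
  have "{0..1} - I' = \<psi> i -` (E i - E') \<inter> {0..1}"
    using psi_image[of i] unfolding I'_def by blast
  moreover have "h i * measure lborel (\<psi> i -` (E i - E') \<inter> {0..1}) = 0"
  proof -
    have "ennreal (h i * measure lborel (\<psi> i -` (E i - E') \<inter> {0..1})) = 0"
      using measure_vimage_psi[of "E i - E'" i] E_borel E'_borel null by simp
    moreover have "0 \<le> h i * measure lborel (\<psi> i -` (E i - E') \<inter> {0..1})" using h_pos[of i] by simp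
    ultimately show ?thesis by (simp only: ennreal_eq_0_iff)
  qed
  ultimately have "measure lborel ({0..1} - I') = 0" using h_pos[of i] by simp
  moreover have I'_borel: "I' \<in> sets borel" unfolding I'_def by (rule borel_vimage_psi[OF E'_borel])
  ultimately have I'_full: "emeasure lborel ({0..1} - I') = 0"
    using emeasure_unit_subset[of "{0..1} - I'"] by simp
  have "inj_on (\<psi> i) I'"
  proof (rule inj_onI, rule ccontr)
    fix t u assume tu: "t \<in> I'" "u \<in> I'" "\<psi> i t = \<psi> i u" "t \<noteq> u"
    \<comment> \<open>At a fine enough level, distinct parameters lie in the intervals of distinct walks.\<close>
    have "0 < \<bar>t - u\<bar> * min_ratio" using tu(4) min_ratio_pos by simp
    moreover obtain k where "1 / (\<bar>t - u\<bar> * min_ratio) < l ^ k" using real_arch_pow[OF l_gt_1] by blast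
    ultimately have k: "1 / (min_ratio * l ^ k) < \<bar>t - u\<bar>"
      using l_gt_1 min_ratio_pos by (simp add: field_simps)
    obtain \<gamma> where \<gamma>: "\<gamma> \<in> walks G i k" "t \<in> foldr \<tau> \<gamma> ` {0..1}"
      using walk_intervals_cover tu(1) unfolding I'_def by blast
    obtain \<omega> where \<omega>: "\<omega> \<in> walks G i k" "u \<in> foldr \<tau> \<omega> ` {0..1}"
      using walk_intervals_cover tu(2) unfolding I'_def by blast
    have "\<gamma> \<noteq> \<omega>"
    proof
      assume "\<gamma> = \<omega>"
      then have "t \<in> {foldr \<tau> \<gamma> 0..foldr \<tau> \<gamma> 1}" "u \<in> {foldr \<tau> \<gamma> 0..foldr \<tau> \<gamma> 1}"
        using \<gamma> \<omega> walk_interval_eq[OF \<gamma>(1)] by auto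
      then have "\<bar>t - u\<bar> \<le> foldr \<tau> \<gamma> 1 - foldr \<tau> \<gamma> 0" by auto
      then show False using walk_interval_length_le[OF \<gamma>(1)] k by linarith
    qed
    then have "(\<gamma>, \<omega>) \<in> W k" using \<gamma>(1) \<omega>(1) by (simp add: W_def)
    moreover have "\<psi> i t \<in> piece i \<gamma>" "\<psi> i t \<in> piece i \<omega>"
      using psi_walk_interval[OF \<gamma>(1)] psi_walk_interval[OF \<omega>(1)] \<gamma>(2) \<omega>(2) tu(3) by blast+
    ultimately have "\<psi> i t \<in> Z k" unfolding Z_def by force
    then show False using tu(1) by (auto simp: I'_def E'_def)
  qed
  moreover have "\<psi> i ` I' = E'" unfolding I'_def by (rule psi_vimage) (auto simp: E'_def)
  ultimately have bij: "bij_betw (\<psi> i) I' E'" by (simp add: bij_betw_def)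
  have H_image: "H (\<psi> i ` F) = H (E i) * emeasure lborel F" if "F \<in> sets borel" "F \<subseteq> {0..1}" for F
    unfolding H_psi[OF that] H_E_eq emeasure_unit_subset[OF that]
    using h_pos[of i] by (intro ennreal_mult) auto
  have vimage: "emeasure lborel (\<psi> i -` B \<inter> {0..1}) = inverse (H (E i)) * H B"
    if B: "B \<in> sets borel" "B \<subseteq> E i" for B
  proof -
    have "H B = H (E i) * emeasure lborel (\<psi> i -` B \<inter> {0..1})"
      using H_image[OF borel_vimage_psi[OF B(1), of i]] unfolding psi_vimage[OF B(2)] by simp
    then have "inverse (H (E i)) * H B = (inverse (H (E i)) * H (E i)) * emeasure lborel (\<psi> i -` B \<inter> {0..1})"
      by (simp add: mult.assoc)
    also have "inverse (H (E i)) * H (E i) = 1"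
      unfolding H_E_eq using h_pos[of i] by (simp add: inverse_ennreal flip: ennreal_mult)
    finally show ?thesis by simp
  qed
  show ?thesis
    unfolding measure_isomorphism_def
  proof (intro conjI ballI impI exI[of _ I'] exI[of _ E'])
    show "I' \<subseteq> {0..1}" by (simp add: I'_def)
    show "E' \<subseteq> E i" by (auto simp: E'_def)
  qed (fact I'_borel I'_full E'_borel null bij | erule (1) H_image | erule (1) vimage)+
qed

lemma hausdorff_dim_E: "hausdorff_dim w (E i) = \<alpha>"
  by (rule hausdorff_dim_eqI[OF \<alpha>_pos H_E_pos H_E_finite])

end

theorem theorem1p2:
  fixes G :: "('v::finite, 'e) pre_digraph"
    and A :: "real^'n^'n"
    and d :: "'e \<Rightarrow> real^'n"
    and prec :: "('e \<times> 'e) set"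
    and E :: "'v \<Rightarrow> (real^'n) set"
    and \<delta> :: real
    and \<phi> :: "real^'n \<Rightarrow> real"
  assumes "fin_digraph G" and "verts G = UNIV"
    and "expanding A"
    and "invariant_sets G (gifs_map A d) E"
    and "linear_gifs G (gifs_map A d) prec E"
    and "open_set_condition G (gifs_map A d)"
    and "primitive_matrix (associated_matrix G)"
    and not_a_single_loop: "2 \<le> card (arcs G)"
    and "0 < \<delta>" and "\<delta> < 1/2" and "mollifier \<delta> \<phi>"
  shows "\<forall>j. let w = pseudo_norm A \<phi>; \<alpha> = hausdorff_dim w (E j) in
    \<exists>\<psi>. parametrization \<psi> (E j) \<and>
        measure_isomorphism \<psi> (E j) (hausdorff_outer w \<alpha>) \<and>
        (\<exists>c>0. \<forall>x\<in>{0..1}. \<forall>y\<in>{0..1}. w (\<psi> x - \<psi> y) \<le> c * \<bar>x - y\<bar> powr (1 / \<alpha>))"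
proof -
  obtain n where n: "1 \<le> n" "\<forall>i j. 0 < matrix_pow (associated_matrix G) n $ i $ j"
    using assms(7) unfolding primitive_matrix_def by blast
  have connected: "\<exists>\<gamma>\<in>walks G i n. walk_end G i \<gamma> = j" for i j
    using walk_if_entry_pos[OF assms(1,2)] n(2) by blast
  obtain v l where vl: "\<forall>i. 0 < v i" "0 < l" "\<forall>i. (\<Sum>e\<in>out_arcs G i. v (head G e)) = l * (v i :: real)"
    using perron_eigenvector[OF assms(1,2) _ connected] n(1) by auto
  have l: "1 < l"
    using perron_eigenvalue_gt_1[OF assms(1,2) connected, of v l] vl not_a_single_loop by simp
  define \<rho> where "\<rho> = \<bar>det A\<bar> powr (1 / real CARD('n))"
  have \<rho>: "1 < \<rho>" using expanding_abs_det_gt_1[OF assms(3)] by (simp add: \<rho>_def)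
  \<comment> \<open>The dimension solves \<open>\<rho> powr \<alpha> = l\<close>: the factor of the pseudo-norm matches that of the mass.\<close>
  define \<alpha> where "\<alpha> = ln l / ln \<rho>"
  have \<alpha>: "0 < \<alpha>" using l \<rho> by (simp add: \<alpha>_def)
  have \<rho>\<alpha>: "\<rho> powr \<alpha> = l" using l \<rho> by (simp add: \<alpha>_def powr_def)
  have AT: "A *v (matrix_inv A *v x) = x" for x
    by (simp add: matrix_vector_mul_assoc matrix_inv_mult expanding_invertible[OF assms(3)])
  interpret weighted_linear_gifs G A d prec E v l
    by (rule weighted_linear_gifs.intro[OF assms(1)], unfold_locales) (use assms vl l in auto)
  interpret weighted_linear_gifs_gauge G A d prec E v l "pseudo_norm A \<phi>" "1 / \<rho>" \<alpha> n
  proof unfold_locales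
    show "pseudo_norm A \<phi> (matrix_inv A *v x) = 1 / \<rho> * pseudo_norm A \<phi> x" for x
      using pseudo_norm_mult[OF assms(3), of \<phi> "matrix_inv A *v x"] \<rho> unfolding AT \<rho>_def[symmetric]
      by (simp add: field_simps)
    show "(1 / \<rho>) powr \<alpha> = 1 / l" using \<rho> \<rho>\<alpha> by (simp add: powr_divide)
  qed (use \<rho> \<alpha> connected assms pseudo_norm_bounded_on_bounded
      pseudo_norm_sublevel_bounded in \<open>auto simp del: atLeastAtMost_iff\<close>)
  show ?thesis
    unfolding Let_def hausdorff_dim_E
    using parametrization_psi measure_isomorphism_psi psi_hoelder by blast
qed

end
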